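(* Let $\mathcal{H}$ be a Hilbert space, $J\in B(\mathcal{H})$ an isometry and $B_J\subseteq B(\mathcal{H})$ a $C^*$-subalgebra containing the identity $I$ such that $\alpha_J(a):=JaJ^*\in B_J$ and $\beta_J(a):=J^*aJ\in B_J$ for all $a\in B_J$. Let $A_J$ be the $C^*$-algebra generated by $B_J$ and $J$. Assume that there is a family $\{\mathcal{U}_\theta\}_{\theta\in\mathbb{R}/\mathbb{Z}}$ of unitary operators on $\mathcal{H}$ with $\mathcal{U}_\theta a=a\,\mathcal{U}_\theta$ for all $a\in B_J$ and $\mathcal{U}_\theta J=e^{2\pi i\theta}J\,\mathcal{U}_\theta$. Let $I_J$ be an ideal in $B_J$ which is invariant under $\alpha_J$ and $\beta_J$, and let $\mathcal{I}_J:=C^*(aJ^n\mid a\in I_J,\ n=0,1,2,\dots)$, which is an ideal in $A_J$. Let $[\alpha_J]:B_J/I_J\to B_J/I_J$ be given by $[\alpha_J](a+I_J)=\alpha_J(a)+I_J$. Then there is an isomorphism of $C^*$-algebras $$B_J/I_J\rtimes_{[\alpha_J]}\mathbb{N}\;\cong\;A_J/\mathcal{I}_J .$$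
   Context: Ideals are closed and two-sided. $C^*(X)$ denotes the $C^*$-subalgebra of $B(\mathcal{H})$ generated by the set $X$. Invariance of $I_J$ means $\alpha_J(I_J)\subseteq I_J$ and $\beta_J(I_J)\subseteq I_J$. The map $[\alpha_J]$ is an injective $*$-endomorphism with hereditary range. For a unital $C^*$-algebra $B$ and an injective $*$-endomorphism $\alpha$ of $B$ with hereditary range, $B\rtimes_\alpha\mathbb{N}$ denotes (Stacey's) crossed product: the universal unital $C^*$-algebra generated by a (unital) copy of $B$ and an isometry $L$ such that $LaL^*=\alpha(a)$ for all $a\in B$. *)

theory Defs
  imports "HOL-Analysis.Analysis" "HOL-Algebra.QuotRing"
begin

section \<open>Complex Hilbert spaces\<close>

text \<open>The norm, the topology and completeness come from the underlying real Hilbert space; the last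
  two axioms tie the complex structure to it, so that the norm of \<open>x\<close> is the square root of
  \<open>cinner x x\<close>, and \<open>cinner\<close> is positive definite. It is linear in its second argument.\<close>

class complex_hilbert_space = real_inner + complete_space +
  fixes scaleC :: "complex \<Rightarrow> 'a \<Rightarrow> 'a"
    and cinner :: "'a \<Rightarrow> 'a \<Rightarrow> complex"
  assumes scaleC_add_right: "scaleC c (x + y) = scaleC c x + scaleC c y"
    and scaleC_add_left: "scaleC (c + d) x = scaleC c x + scaleC d x"
    and scaleC_scaleC: "scaleC c (scaleC d x) = scaleC (c * d) x"
    and scaleC_one: "scaleC 1 x = x"
    and cinner_commute: "cinner x y = cnj (cinner y x)"
    and cinner_add_right: "cinner x (y + z) = cinner x y + cinner x z"
    and cinner_scaleC_right: "cinner x (scaleC c y) = c * cinner x y"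
    and scaleR_eq_scaleC: "scaleR r x = scaleC (complex_of_real r) x"
    and inner_eq_Re_cinner: "inner x y = Re (cinner x y)"

section \<open>C*-algebras\<close>

record 'a cstar = "'a ring" +
  cscale :: "complex \<Rightarrow> 'a \<Rightarrow> 'a"
  star :: "'a \<Rightarrow> 'a"
  cnorm :: "'a \<Rightarrow> real"

text \<open>The zero algebra is allowed: a quotient by the whole algebra is one.\<close>

locale unital_cstar_algebra = ring A for A :: "'a cstar" (structure) +
  assumes cscale_closed: "x \<in> carrier A \<Longrightarrow> cscale A c x \<in> carrier A"
    and cscale_add_right: "x \<in> carrier A \<Longrightarrow> y \<in> carrier A \<Longrightarrow>
          cscale A c (x \<oplus> y) = cscale A c x \<oplus> cscale A c y"
    and cscale_add_left: "x \<in> carrier A \<Longrightarrow> cscale A (c + d) x = cscale A c x \<oplus> cscale A d x"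
    and cscale_cscale: "x \<in> carrier A \<Longrightarrow> cscale A c (cscale A d x) = cscale A (c * d) x"
    and cscale_one: "x \<in> carrier A \<Longrightarrow> cscale A 1 x = x"
    and cscale_mult_left: "x \<in> carrier A \<Longrightarrow> y \<in> carrier A \<Longrightarrow>
          cscale A c x \<otimes> y = cscale A c (x \<otimes> y)"
    and cscale_mult_right: "x \<in> carrier A \<Longrightarrow> y \<in> carrier A \<Longrightarrow>
          x \<otimes> cscale A c y = cscale A c (x \<otimes> y)"
    and star_closed: "x \<in> carrier A \<Longrightarrow> star A x \<in> carrier A"
    and star_star: "x \<in> carrier A \<Longrightarrow> star A (star A x) = x"
    and star_add: "x \<in> carrier A \<Longrightarrow> y \<in> carrier A \<Longrightarrow> star A (x \<oplus> y) = star A x \<oplus> star A y"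
    and star_cscale: "x \<in> carrier A \<Longrightarrow> star A (cscale A c x) = cscale A (cnj c) (star A x)"
    and star_mult: "x \<in> carrier A \<Longrightarrow> y \<in> carrier A \<Longrightarrow> star A (x \<otimes> y) = star A y \<otimes> star A x"
    and cnorm_nonneg: "x \<in> carrier A \<Longrightarrow> 0 \<le> cnorm A x"
    and cnorm_eq_0_iff: "x \<in> carrier A \<Longrightarrow> cnorm A x = 0 \<longleftrightarrow> x = \<zero>"
    and cnorm_cscale: "x \<in> carrier A \<Longrightarrow> cnorm A (cscale A c x) = cmod c * cnorm A x"
    and cnorm_triangle: "x \<in> carrier A \<Longrightarrow> y \<in> carrier A \<Longrightarrow>
          cnorm A (x \<oplus> y) \<le> cnorm A x + cnorm A y"
    and cnorm_mult: "x \<in> carrier A \<Longrightarrow> y \<in> carrier A \<Longrightarrow>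
          cnorm A (x \<otimes> y) \<le> cnorm A x * cnorm A y"
    and cstar_identity: "x \<in> carrier A \<Longrightarrow> cnorm A (star A x \<otimes> x) = (cnorm A x)\<^sup>2"
    and complete: "(\<And>n::nat. X n \<in> carrier A) \<Longrightarrow>
          (\<And>e. e > 0 \<Longrightarrow> \<exists>N. \<forall>m\<ge>N. \<forall>n\<ge>N. cnorm A (X m \<ominus> X n) < e) \<Longrightarrow>
          \<exists>x\<in>carrier A. (\<lambda>n. cnorm A (X n \<ominus> x)) \<longlonglongrightarrow> 0"

definition norm_closed :: "'a cstar \<Rightarrow> 'a set \<Rightarrow> bool" where
  "norm_closed A S \<longleftrightarrow>
     (\<forall>X x. (\<forall>n::nat. X n \<in> S) \<and> x \<in> carrier A \<and> (\<lambda>n. cnorm A (X n \<ominus>\<^bsub>A\<^esub> x)) \<longlonglongrightarrow> 0 \<longrightarrow> x \<in> S)"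

definition cstar_subalgebra :: "'a cstar \<Rightarrow> 'a set \<Rightarrow> bool" where
  "cstar_subalgebra A S \<longleftrightarrow> S \<subseteq> carrier A \<and> \<zero>\<^bsub>A\<^esub> \<in> S \<and>
     (\<forall>x\<in>S. \<forall>y\<in>S. x \<oplus>\<^bsub>A\<^esub> y \<in> S) \<and> (\<forall>x\<in>S. \<forall>y\<in>S. x \<otimes>\<^bsub>A\<^esub> y \<in> S) \<and>
     (\<forall>c. \<forall>x\<in>S. cscale A c x \<in> S) \<and> (\<forall>x\<in>S. star A x \<in> S) \<and> norm_closed A S"

text \<open>Not necessarily unital.\<close>

definition cstar_generated :: "'a cstar \<Rightarrow> 'a set \<Rightarrow> 'a set" where
  "cstar_generated A X = \<Inter>{S. cstar_subalgebra A S \<and> X \<subseteq> S}"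

text \<open>Closure under complex scalars is automatic in the unital algebras to which this is applied.\<close>

definition closed_ideal :: "'a cstar \<Rightarrow> 'a set \<Rightarrow> bool" where
  "closed_ideal A I \<longleftrightarrow> ideal I A \<and> norm_closed A I"

text \<open>The map on cosets induced by \<open>f\<close>: it sends \<open>a + I\<close> to \<open>f a + I\<close> whenever that is well defined.
  The target ideal \<open>I\<close> may be larger than the one whose cosets are the arguments.\<close>

definition coset_map :: "'a cstar \<Rightarrow> 'a set \<Rightarrow> ('a \<Rightarrow> 'a) \<Rightarrow> 'a set \<Rightarrow> 'a set" where
  "coset_map A I f X = (\<Union>a\<in>X. I +>\<^bsub>A\<^esub> f a)"

definition cstar_quotient :: "'a cstar \<Rightarrow> 'a set \<Rightarrow> 'a set cstar" where
  "cstar_quotient A I = ring.extend (A Quot I)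
     (cstar.fields (\<lambda>c. coset_map A I (cscale A c)) (coset_map A I (star A))
        (\<lambda>X. Inf (cnorm A ` X)))"

definition star_hom :: "'a cstar \<Rightarrow> 'b cstar \<Rightarrow> ('a \<Rightarrow> 'b) \<Rightarrow> bool" where
  "star_hom A B f \<longleftrightarrow> f \<in> carrier A \<rightarrow> carrier B \<and>
     (\<forall>x\<in>carrier A. \<forall>y\<in>carrier A. f (x \<oplus>\<^bsub>A\<^esub> y) = f x \<oplus>\<^bsub>B\<^esub> f y) \<and>
     (\<forall>x\<in>carrier A. \<forall>y\<in>carrier A. f (x \<otimes>\<^bsub>A\<^esub> y) = f x \<otimes>\<^bsub>B\<^esub> f y) \<and>
     (\<forall>c. \<forall>x\<in>carrier A. f (cscale A c x) = cscale B c (f x)) \<and>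
     (\<forall>x\<in>carrier A. f (star A x) = star B (f x))"

definition unital_star_hom :: "'a cstar \<Rightarrow> 'b cstar \<Rightarrow> ('a \<Rightarrow> 'b) \<Rightarrow> bool" where
  "unital_star_hom A B f \<longleftrightarrow> star_hom A B f \<and> f \<one>\<^bsub>A\<^esub> = \<one>\<^bsub>B\<^esub>"

definition cstar_isomorphic :: "'a cstar \<Rightarrow> 'b cstar \<Rightarrow> bool" where
  "cstar_isomorphic A B \<longleftrightarrow> (\<exists>f. star_hom A B f \<and> bij_betw f (carrier A) (carrier B))"

definition isometry_in :: "'a cstar \<Rightarrow> 'a \<Rightarrow> bool" where
  "isometry_in A v \<longleftrightarrow> v \<in> carrier A \<and> star A v \<otimes>\<^bsub>A\<^esub> v = \<one>\<^bsub>A\<^esub>"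

definition unitary_in :: "'a cstar \<Rightarrow> 'a \<Rightarrow> bool" where
  "unitary_in A u \<longleftrightarrow> isometry_in A u \<and> u \<otimes>\<^bsub>A\<^esub> star A u = \<one>\<^bsub>A\<^esub>"

definition positive_in :: "'a cstar \<Rightarrow> 'a \<Rightarrow> bool" where
  "positive_in A x \<longleftrightarrow> (\<exists>y\<in>carrier A. x = star A y \<otimes>\<^bsub>A\<^esub> y)"

definition hereditary_subalgebra :: "'a cstar \<Rightarrow> 'a set \<Rightarrow> bool" where
  "hereditary_subalgebra A S \<longleftrightarrow> cstar_subalgebra A S \<and>
     (\<forall>s\<in>S. \<forall>b\<in>carrier A. positive_in A b \<and> positive_in A (s \<ominus>\<^bsub>A\<^esub> b) \<longrightarrow> b \<in> S)"

section \<open>Stacey's crossed product\<close>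

text \<open>A unital representation \<open>\<pi>\<close> of \<open>B\<close> in a unital C*-algebra \<open>D\<close> together with an isometry
  \<open>T\<close> that implements \<open>\<alpha>\<close>.\<close>

definition covariant_pair :: "'b cstar \<Rightarrow> ('b \<Rightarrow> 'b) \<Rightarrow> 'd cstar \<Rightarrow> ('b \<Rightarrow> 'd) \<Rightarrow> 'd \<Rightarrow> bool" where
  "covariant_pair B \<alpha> D \<pi> T \<longleftrightarrow>
     unital_cstar_algebra D \<and> unital_star_hom B D \<pi> \<and> isometry_in D T \<and>
     (\<forall>b\<in>carrier B. T \<otimes>\<^bsub>D\<^esub> \<pi> b \<otimes>\<^bsub>D\<^esub> star D T = \<pi> (\<alpha> b))"

text \<open>\<open>(C, \<iota>, L)\<close> is a crossed product of \<open>B\<close> by \<open>\<alpha>\<close>: \<open>C\<close> is generated by a unital copy of \<open>B\<close> and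
  an isometry implementing \<open>\<alpha>\<close>, and every covariant pair factors through it. The factoring
  homomorphism is unique because \<open>C\<close> is generated by \<open>\<iota>\<close> and \<open>L\<close>. A formula of HOL cannot
  quantify over types, so the type of the algebras against which universality is tested
  is a parameter; full universality is the conjunction of the instances at all types.\<close>

definition crossed_product ::
    "'d itself \<Rightarrow> 'b cstar \<Rightarrow> ('b \<Rightarrow> 'b) \<Rightarrow> 'c cstar \<Rightarrow> ('b \<Rightarrow> 'c) \<Rightarrow> 'c \<Rightarrow> bool" where
  "crossed_product _ B \<alpha> C \<iota> L \<longleftrightarrow>
     unital_cstar_algebra B \<and> star_hom B B \<alpha> \<and> inj_on \<alpha> (carrier B) \<and>
     hereditary_subalgebra B (\<alpha> ` carrier B) \<and>
     covariant_pair B \<alpha> C \<iota> L \<and> inj_on \<iota> (carrier B) \<and>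
     cstar_generated C (\<iota> ` carrier B \<union> {L}) = carrier C \<and>
     (\<forall>(D :: 'd cstar) \<pi> T. covariant_pair B \<alpha> D \<pi> T \<longrightarrow>
        (\<exists>\<Phi>. unital_star_hom C D \<Phi> \<and> (\<forall>b\<in>carrier B. \<Phi> (\<iota> b) = \<pi> b) \<and> \<Phi> L = T))"

section \<open>Operators on a Hilbert space\<close>

definition adj :: "('h::complex_hilbert_space \<Rightarrow> 'h) \<Rightarrow> 'h \<Rightarrow> 'h" where
  "adj T = (THE S. \<forall>x y. cinner (S x) y = cinner x (T y))"

definition bounded_operators :: "('h::complex_hilbert_space \<Rightarrow> 'h) cstar" where
  "bounded_operators =
     \<lparr>carrier = {T. bounded_linear T \<and> (\<forall>c x. T (scaleC c x) = scaleC c (T x))},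
      mult = (\<circ>), one = id, zero = (\<lambda>x. 0), add = (\<lambda>S T x. S x + T x),
      cscale = (\<lambda>c T x. scaleC c (T x)), star = adj, cnorm = onorm\<rparr>"

abbreviation subalg :: "('h::complex_hilbert_space \<Rightarrow> 'h) set \<Rightarrow> ('h \<Rightarrow> 'h) cstar" where
  "subalg S \<equiv> bounded_operators\<lparr>carrier := S\<rparr>"

definition alpha :: "('h::complex_hilbert_space \<Rightarrow> 'h) \<Rightarrow> ('h \<Rightarrow> 'h) \<Rightarrow> 'h \<Rightarrow> 'h" where
  "alpha J a = J \<circ> a \<circ> adj J"

definition beta :: "('h::complex_hilbert_space \<Rightarrow> 'h) \<Rightarrow> ('h \<Rightarrow> 'h) \<Rightarrow> 'h \<Rightarrow> 'h" where
  "beta J a = adj J \<circ> a \<circ> J"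

definition alg_gen :: "('h::complex_hilbert_space \<Rightarrow> 'h) set \<Rightarrow> ('h \<Rightarrow> 'h) \<Rightarrow> ('h \<Rightarrow> 'h) set" where
  "alg_gen B J = cstar_generated bounded_operators (B \<union> {J})"

definition ideal_gen :: "('h::complex_hilbert_space \<Rightarrow> 'h) set \<Rightarrow> ('h \<Rightarrow> 'h) \<Rightarrow> ('h \<Rightarrow> 'h) set" where
  "ideal_gen I J = cstar_generated bounded_operators {a \<circ> (J ^^ n) | a n. a \<in> I}"

end

theory Submission
  imports Defs
begin

text \<open>Finite sums of the monomials \<open>a J\<^sup>n\<close> and \<open>J*\<^sup>n a\<close> with \<open>a\<close> in \<open>B\<close> (in \<open>I\<close>) are dense in the algebra generated by
  \<open>B\<close> and \<open>J\<close> (in the ideal generated by \<open>I\<close> and \<open>J\<close>). Averaging over the unitaries \<open>U \<theta>\<close> at roots of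
  unity extracts the zeroth coefficient, a contraction; hence the ideal meets \<open>B\<close> in \<open>I\<close> only.
  Given a covariant pair in \<open>D\<close>, the same sum has a value \<open>f\<close> in \<open>D\<close>, and a value \<open>x\<close> in the algebra of
  operators. For a self-adjoint sum with square \<open>y\<close>, the values of \<open>y\<close> obtained by twisting with the \<open>N\<close>-th
  roots of unity are positive and add up to \<open>N\<close> times the zeroth coefficient, so \<open>\<parallel>y\<parallel>\<close> in \<open>D\<close> is at most
  \<open>N\<close> times the norm of that coefficient, which is bounded by the norm of \<open>y\<close> modulo the ideal. Applied to
  the powers \<open>(x* x)\<^sup>m\<close>, for which \<open>N\<close> grows linearly in \<open>m\<close>, this gives that \<open>\<parallel>f\<parallel>\<close> is at most the norm of
  \<open>x\<close> modulo the ideal after taking roots. So \<open>x \<mapsto> f\<close> is well defined and extends to the quotient,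
  which is therefore universal, without any averaging of \<open>D\<close> itself. Two algebras with the universal
  property are isomorphic.\<close>

section \<open>Positivity in C*-algebras\<close>


text \<open>Words are needed because different words may give the same operator, and that their
  values in \<open>D\<close> then agree is exactly what has to be proved; before the norm estimate
  there is no map from operators to \<open>D\<close>. The word product involves only
  \<open>alpha J\<close> and \<open>beta J\<close>, because a covariant pair for
  \<open>alpha J\<close> automatically implements \<open>beta J\<close> as the compression by its
  isometry. On the side of \<open>D\<close> no gauge unitaries are given; what survives there is
  that multiplying the isometry by a scalar of modulus one gives again a covariant pair, so that
  squares stay squares at every twist. Spectral theory is replaced throughout by one construction,
  the square root of \<open>1 - x\<close> for a self-adjoint contraction \<open>x\<close>, with a
  root that commutes with everything commuting with \<open>x\<close>. Positivity accordingly means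
  being the square of a self-adjoint element, which is why the powers of \<open>x* x\<close> enter
  through a tower of squares, beginning at the square of \<open>x* x\<close> itself.\<close>

context unital_cstar_algebra
begin

declare cscale_closed [simp, intro] star_closed [simp, intro] star_star [simp] cscale_one [simp]

lemma cscale_zero_left [simp]: assumes "x \<in> carrier A" shows "cscale A 0 x = \<zero>"
proof -
  have "cscale A 0 x \<oplus> cscale A 0 x = cscale A 0 x"
    using cscale_add_left[OF assms, of 0 0] by simp
  then show ?thesis
    using assms by (metis add.l_cancel_one cscale_closed)
qed

lemma cscale_zero_right [simp]: "cscale A c \<zero> = \<zero>"
  by (metis cscale_cscale cscale_zero_left mult_zero_right zero_closed)

lemma minus_eq_cscale: assumes "x \<in> carrier A" shows "\<ominus> x = cscale A (-1) x"
proof -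
  have "cscale A (-1) x \<oplus> x = \<zero>"
    using cscale_add_left[OF assms, of "-1" 1] assms by simp
  then show ?thesis using assms
    by (metis cscale_closed minus_equality)
qed

lemma cscale_minus_right: "x \<in> carrier A \<Longrightarrow> cscale A c (\<ominus> x) = \<ominus> (cscale A c x)"
  by (simp add: minus_eq_cscale cscale_cscale)

lemma cscale_diff_right: "x \<in> carrier A \<Longrightarrow> y \<in> carrier A \<Longrightarrow>
    cscale A c (x \<ominus> y) = cscale A c x \<ominus> cscale A c y"
  by (simp add: a_minus_def cscale_add_right cscale_minus_right)

lemma cscale_2: "x \<in> carrier A \<Longrightarrow> cscale A 2 x = x \<oplus> x"
  using cscale_add_left[of x 1 1] by simp

lemma star_minus [simp]: "x \<in> carrier A \<Longrightarrow> star A (\<ominus> x) = \<ominus> (star A x)"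
  by (simp add: minus_eq_cscale star_cscale)

lemma star_diff: "x \<in> carrier A \<Longrightarrow> y \<in> carrier A \<Longrightarrow> star A (x \<ominus> y) = star A x \<ominus> star A y"
  by (simp add: a_minus_def star_add)

lemma star_zero [simp]: "star A \<zero> = \<zero>"
  using star_cscale[of \<zero> 0] by simp

lemma star_one [simp]: "star A \<one> = \<one>"
  using star_mult[of \<one> "star A \<one>"] by simp

lemma cnorm_zero [simp]: "cnorm A \<zero> = 0"
  by (simp add: cnorm_eq_0_iff)

lemma cnorm_minus [simp]: "x \<in> carrier A \<Longrightarrow> cnorm A (\<ominus> x) = cnorm A x"
  by (simp add: minus_eq_cscale cnorm_cscale)

lemma cnorm_diff_triangle: "x \<in> carrier A \<Longrightarrow> y \<in> carrier A \<Longrightarrow>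
    cnorm A (x \<ominus> y) \<le> cnorm A x + cnorm A y"
  using cnorm_triangle[of x "\<ominus> y"] by (simp add: a_minus_def)

lemma cnorm_diff_commute: "x \<in> carrier A \<Longrightarrow> y \<in> carrier A \<Longrightarrow> cnorm A (x \<ominus> y) = cnorm A (y \<ominus> x)"
  using cnorm_minus[of "x \<ominus> y"] by (simp add: minus_add a_minus_def add.m_comm)

lemma cnorm_diff_trans:
  assumes "x \<in> carrier A" "y \<in> carrier A" "z \<in> carrier A"
  shows "cnorm A (x \<ominus> z) \<le> cnorm A (x \<ominus> y) + cnorm A (y \<ominus> z)"
proof -
  have "x \<ominus> z = (x \<ominus> y) \<oplus> (y \<ominus> z)" using assms by algebra
  then show ?thesis using cnorm_triangle[of "x \<ominus> y" "y \<ominus> z"] assms by simp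
qed

lemma cnorm_diff_ge: "x \<in> carrier A \<Longrightarrow> y \<in> carrier A \<Longrightarrow> \<bar>cnorm A x - cnorm A y\<bar> \<le> cnorm A (x \<ominus> y)"
  using cnorm_diff_trans[of x y \<zero>] cnorm_diff_trans[of y x \<zero>] cnorm_diff_commute[of x y]
  by (simp add: a_minus_def)

lemma diff_self [simp]: "x \<in> carrier A \<Longrightarrow> x \<ominus> x = \<zero>"
  by (simp add: a_minus_def r_neg)

lemma diff_eq_zero: "x \<in> carrier A \<Longrightarrow> y \<in> carrier A \<Longrightarrow> x \<ominus> y = \<zero> \<longleftrightarrow> x = y"
  by (metis a_minus_def add.inv_solve_right diff_self l_zero zero_closed)

lemma eq_if_cnorm_diff_0: "x \<in> carrier A \<Longrightarrow> y \<in> carrier A \<Longrightarrow> cnorm A (x \<ominus> y) = 0 \<Longrightarrow> x = y"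
  by (simp add: cnorm_eq_0_iff diff_eq_zero)

text \<open>The C*-identity bounds the square of the norm of \<open>y\<close> by the product of the
  norms of \<open>y\<close> and its adjoint; one factor cancels, and exchanging \<open>y\<close>
  with its adjoint gives equality.\<close>

lemma cnorm_star [simp]: assumes "x \<in> carrier A" shows "cnorm A (star A x) = cnorm A x"
proof -
  have *: "cnorm A y \<le> cnorm A (star A y)" if y: "y \<in> carrier A" for y
  proof (cases "cnorm A y = 0")
    case False
    then have "cnorm A y > 0" using cnorm_nonneg[OF y] by simp
    moreover have "cnorm A y * cnorm A y \<le> cnorm A (star A y) * cnorm A y"
      using cnorm_mult[of "star A y" y] cstar_identity[of y] y by (simp add: power2_eq_square)
    ultimately show ?thesis by simp
  qed (use y cnorm_nonneg in auto)
  from *[of x] *[of "star A x"] assms show ?thesis by simp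
qed

text \<open>The C*-identity makes the norm of the unit idempotent, hence 0 or 1; the value 0 occurs
  in the zero algebra.\<close>

lemma cnorm_one_le: "cnorm A \<one> \<le> 1"
proof -
  have "cnorm A \<one> = (cnorm A \<one>)\<^sup>2" using cstar_identity[of \<one>] by simp
  then have "cnorm A \<one> = 0 \<or> cnorm A \<one> = 1" by (simp add: power2_eq_square)
  then show ?thesis by auto
qed

lemma cnorm_cscale_one_le: "0 \<le> t \<Longrightarrow> cnorm A (cscale A (complex_of_real t) \<one>) \<le> t"
  using cnorm_one_le by (simp add: cnorm_cscale mult_left_le)

lemma cnorm_square: "x \<in> carrier A \<Longrightarrow> star A x = x \<Longrightarrow> cnorm A (x \<otimes> x) = (cnorm A x)\<^sup>2"
  using cstar_identity[of x] by simp

section \<open>Norm limits of sequences\<close>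

definition nlim :: "(nat \<Rightarrow> 'a) \<Rightarrow> 'a \<Rightarrow> bool" where
  "nlim X x \<longleftrightarrow> (\<forall>n. X n \<in> carrier A) \<and> x \<in> carrier A \<and> (\<lambda>n. cnorm A (X n \<ominus> x)) \<longlonglongrightarrow> 0"

lemma nlimD: "nlim X x \<Longrightarrow> X n \<in> carrier A" "nlim X x \<Longrightarrow> x \<in> carrier A"
  "nlim X x \<Longrightarrow> (\<lambda>n. cnorm A (X n \<ominus> x)) \<longlonglongrightarrow> 0"
  by (auto simp: nlim_def)

lemma nlimI_bound:
  assumes "\<And>n. X n \<in> carrier A" "x \<in> carrier A" "\<And>n. cnorm A (X n \<ominus> x) \<le> f n" "f \<longlonglongrightarrow> 0"
  shows "nlim X x"
  using assms unfolding nlim_def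
  by (auto intro: Lim_null_comparison[where g=f] simp: cnorm_nonneg)

lemma nlim_const: "x \<in> carrier A \<Longrightarrow> nlim (\<lambda>_. x) x"
  by (simp add: nlim_def)

lemma nlim_unique: assumes "nlim X x" "nlim X y" shows "x = y"
proof -
  note c = nlimD[OF assms(1)] nlimD[OF assms(2)]
  have "(\<lambda>n. cnorm A (X n \<ominus> x) + cnorm A (X n \<ominus> y)) \<longlonglongrightarrow> 0"
    using tendsto_add[OF c(3) c(6)] by simp
  moreover have "cnorm A (x \<ominus> y) \<le> cnorm A (X n \<ominus> x) + cnorm A (X n \<ominus> y)" for n
    using cnorm_diff_trans[of x "X n" y] cnorm_diff_commute[of x "X n"] c by simp
  ultimately have "cnorm A (x \<ominus> y) \<le> 0"
    by (meson LIMSEQ_le_const)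
  then show ?thesis using c eq_if_cnorm_diff_0 cnorm_nonneg[of "x \<ominus> y"] by force
qed

lemma nlim_norm: assumes "nlim X x" shows "(\<lambda>n. cnorm A (X n)) \<longlonglongrightarrow> cnorm A x"
proof -
  have "(\<lambda>n. cnorm A (X n) - cnorm A x) \<longlonglongrightarrow> 0"
    by (rule Lim_null_comparison[OF _ nlimD(3)[OF assms]])
      (simp add: cnorm_diff_ge nlimD(1,2)[OF assms])
  then show ?thesis by (rule LIM_zero_cancel)
qed

lemma nlim_add: assumes "nlim X x" "nlim Y y" shows "nlim (\<lambda>n. X n \<oplus> Y n) (x \<oplus> y)"
proof -
  note c = nlimD[OF assms(1)] nlimD[OF assms(2)]
  show ?thesis
  proof (rule nlimI_bound)
    fix n
    have "(X n \<oplus> Y n) \<ominus> (x \<oplus> y) = (X n \<ominus> x) \<oplus> (Y n \<ominus> y)" using c by algebra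
    then show "cnorm A ((X n \<oplus> Y n) \<ominus> (x \<oplus> y)) \<le> cnorm A (X n \<ominus> x) + cnorm A (Y n \<ominus> y)"
      using cnorm_triangle[of "X n \<ominus> x" "Y n \<ominus> y"] c by simp
  qed (use tendsto_add[OF c(3) c(6)] c in auto)
qed

lemma nlim_mult: assumes "nlim X x" "nlim Y y" shows "nlim (\<lambda>n. X n \<otimes> Y n) (x \<otimes> y)"
proof -
  note c = nlimD[OF assms(1)] nlimD[OF assms(2)]
  show ?thesis
  proof (rule nlimI_bound)
    fix n
    have "(X n \<otimes> Y n) \<ominus> (x \<otimes> y) = (X n \<ominus> x) \<otimes> Y n \<oplus> x \<otimes> (Y n \<ominus> y)" using c by algebra
    then have "cnorm A ((X n \<otimes> Y n) \<ominus> (x \<otimes> y)) \<le> cnorm A ((X n \<ominus> x) \<otimes> Y n) + cnorm A (x \<otimes> (Y n \<ominus> y))"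
      using cnorm_triangle[of "(X n \<ominus> x) \<otimes> Y n" "x \<otimes> (Y n \<ominus> y)"] c by simp
    also have "\<dots> \<le> cnorm A (X n \<ominus> x) * cnorm A (Y n) + cnorm A x * cnorm A (Y n \<ominus> y)"
      using c by (intro add_mono cnorm_mult) auto
    finally show "cnorm A ((X n \<otimes> Y n) \<ominus> (x \<otimes> y)) \<le>
      cnorm A (X n \<ominus> x) * cnorm A (Y n) + cnorm A x * cnorm A (Y n \<ominus> y)" .
    show "(\<lambda>n. cnorm A (X n \<ominus> x) * cnorm A (Y n) + cnorm A x * cnorm A (Y n \<ominus> y)) \<longlonglongrightarrow> 0"
      using tendsto_add[OF tendsto_mult[OF c(3) nlim_norm[OF assms(2)]]
          tendsto_mult[OF tendsto_const[of "cnorm A x"] c(6)]] by simp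
  qed (use c in auto)
qed

lemma nlim_cscale: assumes "nlim X x" shows "nlim (\<lambda>n. cscale A c (X n)) (cscale A c x)"
proof -
  note c = nlimD[OF assms]
  show ?thesis
    by (rule nlimI_bound[where f="\<lambda>n. cmod c * cnorm A (X n \<ominus> x)"])
      (use tendsto_mult[OF tendsto_const[of "cmod c"] c(3)] c in
       \<open>auto simp: cscale_diff_right[symmetric] cnorm_cscale\<close>)
qed

lemma nlim_star: assumes "nlim X x" shows "nlim (\<lambda>n. star A (X n)) (star A x)"
  using nlimD[OF assms] by (simp add: nlim_def star_diff[symmetric])

lemma nlim_Suc: "nlim X x \<Longrightarrow> nlim (\<lambda>n. X (Suc n)) x"
  unfolding nlim_def using LIMSEQ_Suc by blast

lemma nlim_diff: assumes "nlim X x" "nlim Y y" shows "nlim (\<lambda>n. X n \<ominus> Y n) (x \<ominus> y)"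
  using nlim_add[OF assms(1) nlim_cscale[OF assms(2), of "-1"]] nlimD[OF assms(1)] nlimD[OF assms(2)]
  by (simp add: a_minus_def minus_eq_cscale)

lemma norm_closedD: "norm_closed A S \<Longrightarrow> nlim X x \<Longrightarrow> (\<And>n. X n \<in> S) \<Longrightarrow> x \<in> S"
  unfolding norm_closed_def nlim_def by blast

lemma norm_closedI: "(\<And>X x. nlim X x \<Longrightarrow> (\<And>n. X n \<in> S) \<Longrightarrow> x \<in> S) \<Longrightarrow> S \<subseteq> carrier A \<Longrightarrow> norm_closed A S"
  unfolding norm_closed_def nlim_def by blast

lemma nlim_exists:
  assumes "\<And>n. X n \<in> carrier A"
    and "\<And>e. e > 0 \<Longrightarrow> \<exists>N. \<forall>m\<ge>N. \<forall>n\<ge>N. cnorm A (X m \<ominus> X n) < e"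
  shows "\<exists>x. nlim X x"
  using complete[of X, OF assms] assms(1) unfolding nlim_def by blast

text \<open>The square root of \<open>1 - x\<close> is \<open>1 - y\<close> for the fixed point \<open>y = (x + y\<^sup>2) / 2\<close>; the iteration for
  \<open>x\<close> is dominated by the scalar iteration for \<open>1\<close>, which converges as it is increasing and bounded.\<close>

lemma sqrt_one_minus:
  assumes x: "x \<in> carrier A" "star A x = x" "cnorm A x \<le> 1"
  shows "\<exists>s\<in>carrier A. star A s = s \<and> s \<otimes> s = \<one> \<ominus> x \<and>
           (\<forall>c\<in>carrier A. c \<otimes> x = x \<otimes> c \<longrightarrow> c \<otimes> s = s \<otimes> c)"
proof -
  define Y where "Y = rec_nat \<zero> (\<lambda>_ y. cscale A (1/2) (x \<oplus> y \<otimes> y))"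
  define t where "t = rec_nat (0::real) (\<lambda>_ u. (1 + u\<^sup>2) / 2)"
  have Y0: "Y 0 = \<zero>" and YS: "\<And>n. Y (Suc n) = cscale A (1/2) (x \<oplus> Y n \<otimes> Y n)" by (simp_all add: Y_def)
  have t0: "t 0 = 0" and tS: "\<And>n. t (Suc n) = (1 + (t n)\<^sup>2) / 2" by (simp_all add: t_def)
  have Yc [simp]: "Y n \<in> carrier A" for n by (induction n) (simp_all add: Y0 YS x)
  have Ysa: "star A (Y n) = Y n" for n
    by (induction n) (simp_all add: Y0 YS x star_cscale star_add star_mult)
  \<comment> \<open>Each iterate is a polynomial in \<open>x\<close>, so it commutes with whatever
    commutes with \<open>x\<close>. This passes to the limit and is what later makes the roots of
    commuting elements commute.\<close>
  have comm: "c \<otimes> Y n = Y n \<otimes> c" if c: "c \<in> carrier A" "c \<otimes> x = x \<otimes> c" for c n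
  proof (induction n)
    case (Suc n)
    have "c \<otimes> (Y n \<otimes> Y n) = (Y n \<otimes> Y n) \<otimes> c"
      using Suc c by (metis Yc m_assoc)
    then have "c \<otimes> (x \<oplus> Y n \<otimes> Y n) = (x \<oplus> Y n \<otimes> Y n) \<otimes> c"
      using c x by (simp add: r_distr l_distr)
    then show ?case using c x by (simp add: YS cscale_mult_left cscale_mult_right)
  qed (use c in \<open>simp add: Y0\<close>)
  have Ycomm: "Y m \<otimes> Y n = Y n \<otimes> Y m" for m n
    using comm[of x] comm[of "Y m" n] x by simp
  have tb: "0 \<le> t n \<and> t n \<le> 1" for n
    by (induction n) (auto simp: t0 tS power_le_one)
  have Yb: "cnorm A (Y n) \<le> t n" for n
  proof (induction n)
    case (Suc n)
    have "cnorm A (Y (Suc n)) = cnorm A (x \<oplus> Y n \<otimes> Y n) / 2" by (simp add: YS cnorm_cscale x)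
    also have "\<dots> \<le> (cnorm A x + cnorm A (Y n) * cnorm A (Y n)) / 2"
      using cnorm_triangle[of x "Y n \<otimes> Y n"] cnorm_mult[of "Y n" "Y n"] x by simp
    also have "\<dots> \<le> (1 + t n * t n) / 2"
      using x Suc tb[of n] cnorm_nonneg[of "Y n"] by (intro divide_right_mono add_mono mult_mono) auto
    finally show ?case by (simp add: tS power2_eq_square)
  qed (simp add: Y0 t0)
  \<comment> \<open>The difference of squares factors because the iterates commute, and the
    increments of the scalar iteration satisfy the same recursion with equality.\<close>
  have step: "cnorm A (Y (Suc n) \<ominus> Y n) \<le> t (Suc n) - t n" for n
  proof (induction n)
    case 0
    then show ?case using Yb[of "Suc 0"] by (simp add: Y0 t0 a_minus_def)
  next
    case (Suc n)
    let ?a = "Y (Suc n)" and ?b = "Y n"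
    have "(x \<oplus> ?a \<otimes> ?a) \<ominus> (x \<oplus> ?b \<otimes> ?b) = (?a \<ominus> ?b) \<otimes> (?a \<oplus> ?b) \<oplus> (?b \<otimes> ?a \<ominus> ?a \<otimes> ?b)"
      using x(1) Yc[of "Suc n"] Yc[of n] by algebra
    also have "\<dots> = (?a \<ominus> ?b) \<otimes> (?a \<oplus> ?b)" using Ycomm[of n "Suc n"] by simp
    finally have eq0: "(x \<oplus> ?a \<otimes> ?a) \<ominus> (x \<oplus> ?b \<otimes> ?b) = (?a \<ominus> ?b) \<otimes> (?a \<oplus> ?b)" .
    have "Y (Suc (Suc n)) \<ominus> Y (Suc n) = cscale A (1/2) (x \<oplus> ?a \<otimes> ?a) \<ominus> cscale A (1/2) (x \<oplus> ?b \<otimes> ?b)"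
      using arg_cong2[OF YS[of "Suc n"] YS[of n], of "\<lambda>u v. u \<ominus> v"] .
    also have "\<dots> = cscale A (1/2) ((?a \<ominus> ?b) \<otimes> (?a \<oplus> ?b))"
      unfolding eq0[symmetric] using x by (simp add: cscale_diff_right)
    finally have eq: "Y (Suc (Suc n)) \<ominus> Y (Suc n) = cscale A (1/2) ((?a \<ominus> ?b) \<otimes> (?a \<oplus> ?b))" .
    have "cnorm A (Y (Suc (Suc n)) \<ominus> Y (Suc n)) \<le> (cnorm A (?a \<ominus> ?b) * cnorm A (?a \<oplus> ?b)) / 2"
      unfolding eq using cnorm_mult[of "?a \<ominus> ?b" "?a \<oplus> ?b"] by (simp add: cnorm_cscale)
    also have "\<dots> \<le> ((t (Suc n) - t n) * (t (Suc n) + t n)) / 2"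
      using Suc Yb[of n] Yb[of "Suc n"] cnorm_triangle[of ?a ?b] cnorm_nonneg[of "?a \<ominus> ?b"] cnorm_nonneg[of "?a \<oplus> ?b"]
      by (intro divide_right_mono mult_mono) auto
    also have "\<dots> = t (Suc (Suc n)) - t (Suc n)"
      by (simp add: tS[of "Suc n"]) (simp add: tS[of n] field_simps power2_eq_square)
    finally show ?case .
  qed
  have inc: "t n \<le> t (Suc n)" for n
    using step[of n] cnorm_nonneg[of "Y (Suc n) \<ominus> Y n"] by simp
  have dist: "cnorm A (Y (n + k) \<ominus> Y n) \<le> t (n + k) - t n" for n k
  proof (induction k)
    case (Suc k)
    show ?case using cnorm_diff_trans[of "Y (n + Suc k)" "Y (n+k)" "Y n"] step[of "n+k"] Suc by simp
  qed (simp add: a_minus_def r_neg)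
  have "convergent t"
    using tb inc by (intro Bseq_mono_convergent BseqI'[of _ 1]) (auto intro: lift_Suc_mono_le)
  then have "Cauchy t" by (simp add: convergent_Cauchy)
  have "\<exists>y. nlim Y y"
  proof (rule nlim_exists)
    fix e :: real assume "e > 0"
    then obtain N where N: "\<And>m n. m \<ge> N \<Longrightarrow> n \<ge> N \<Longrightarrow> dist (t m) (t n) < e"
      using \<open>Cauchy t\<close> by (meson metric_CauchyD)
    have le: "cnorm A (Y m \<ominus> Y n) < e" if "n \<ge> N" "m \<ge> n" for m n
      using dist[of n "m - n"] N[of m n] that by (simp add: dist_real_def)
    have "cnorm A (Y m \<ominus> Y n) < e" if "n \<ge> N" "m \<ge> N" for m n
      using le[of n m] le[of m n] that cnorm_diff_commute[of "Y m" "Y n"] by (cases "m \<ge> n") auto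
    then show "\<exists>N. \<forall>m\<ge>N. \<forall>n\<ge>N. cnorm A (Y m \<ominus> Y n) < e" by blast
  qed simp
  then obtain y where y: "nlim Y y" by blast
  then have yc [simp]: "y \<in> carrier A" by (simp add: nlim_def)
  have "nlim (\<lambda>n. Y (Suc n)) (cscale A (1/2) (x \<oplus> y \<otimes> y))"
    unfolding YS by (intro nlim_cscale nlim_add nlim_mult nlim_const y x)
  then have yfix: "y = cscale A (1/2) (x \<oplus> y \<otimes> y)" using nlim_unique nlim_Suc[OF y] by blast
  have y2: "y \<oplus> y = x \<oplus> y \<otimes> y"
  proof -
    have "y \<oplus> y = cscale A 2 y" by (simp add: cscale_2)
    also have "\<dots> = cscale A 2 (cscale A (1/2) (x \<oplus> y \<otimes> y))" by (rule arg_cong[OF yfix])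
    also have "\<dots> = x \<oplus> y \<otimes> y" using x by (simp add: cscale_cscale)
    finally show ?thesis .
  qed
  have "nlim Y (star A y)" using nlim_star[OF y] by (simp only: Ysa)
  then have ysa: "star A y = y" using nlim_unique y by blast
  have ycomm: "c \<otimes> y = y \<otimes> c" if c: "c \<in> carrier A" "c \<otimes> x = x \<otimes> c" for c
  proof -
    have "nlim (\<lambda>n. Y n \<otimes> c) (c \<otimes> y)"
      using nlim_mult[OF nlim_const[OF c(1)] y] by (simp only: comm[OF c])
    then show ?thesis using nlim_unique nlim_mult[OF y nlim_const[OF c(1)]] by blast
  qed
  have "(\<one> \<ominus> y) \<otimes> (\<one> \<ominus> y) = \<one> \<ominus> (y \<oplus> y) \<oplus> y \<otimes> y"
    using yc by (simp add: a_minus_def l_distr r_distr l_minus r_minus minus_add a_ac)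
  also have "\<dots> = \<one> \<ominus> x" unfolding y2 using x(1) yc by algebra
  finally have "(\<one> \<ominus> y) \<otimes> (\<one> \<ominus> y) = \<one> \<ominus> x" .
  moreover have "c \<otimes> (\<one> \<ominus> y) = (\<one> \<ominus> y) \<otimes> c" if "c \<in> carrier A" "c \<otimes> x = x \<otimes> c" for c
    using ycomm[OF that] that by (simp add: a_minus_def r_distr l_distr r_minus l_minus)
  moreover have "star A (\<one> \<ominus> y) = \<one> \<ominus> y" by (simp add: star_diff ysa)
  ultimately show ?thesis using minus_closed[OF one_closed yc] by blast
qed

lemma sqrt_scalar_minus:
  assumes x: "x \<in> carrier A" "star A x = x" "cnorm A x \<le> t"
  shows "\<exists>s\<in>carrier A. star A s = s \<and> s \<otimes> s = cscale A (complex_of_real t) \<one> \<ominus> x \<and>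
           (\<forall>c\<in>carrier A. c \<otimes> x = x \<otimes> c \<longrightarrow> c \<otimes> s = s \<otimes> c)"
proof (cases "t > 0")
  case True
  let ?x = "cscale A (complex_of_real (1/t)) x"
  have "cnorm A ?x \<le> 1" using x True by (simp add: cnorm_cscale norm_divide)
  moreover have "star A ?x = ?x" using x by (simp add: star_cscale)
  ultimately obtain s where s: "s \<in> carrier A" "star A s = s" "s \<otimes> s = \<one> \<ominus> ?x"
    "\<And>c. c\<in>carrier A \<Longrightarrow> c \<otimes> ?x = ?x \<otimes> c \<Longrightarrow> c \<otimes> s = s \<otimes> c"
    using sqrt_one_minus[of ?x] x(1) by blast
  let ?r = "complex_of_real (sqrt t)"
  have r: "?r * ?r = complex_of_real t" using True by (metis of_real_mult abs_of_pos real_sqrt_mult_self)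
  have "cscale A ?r s \<otimes> cscale A ?r s = cscale A (complex_of_real t) (\<one> \<ominus> ?x)"
    using s(1,3) x(1) by (simp add: cscale_mult_left cscale_mult_right cscale_cscale r)
  also have "\<dots> = cscale A (complex_of_real t) \<one> \<ominus> x"
  proof -
    have "complex_of_real t * complex_of_real (1/t) = 1" using True by simp
    then show ?thesis using x(1) by (simp only: cscale_diff_right cscale_cscale cscale_one one_closed cscale_closed)
  qed
  finally have sq: "cscale A ?r s \<otimes> cscale A ?r s = cscale A (complex_of_real t) \<one> \<ominus> x" .
  have "c \<otimes> cscale A ?r s = cscale A ?r s \<otimes> c" if c: "c \<in> carrier A" "c \<otimes> x = x \<otimes> c" for c
  proof -
    have "c \<otimes> ?x = ?x \<otimes> c" using c x(1) by (simp add: cscale_mult_left cscale_mult_right)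
    then have "c \<otimes> s = s \<otimes> c" by (rule s(4)[OF c(1)])
    then show ?thesis using c(1) s(1) by (simp add: cscale_mult_left cscale_mult_right)
  qed
  moreover have "star A (cscale A ?r s) = cscale A ?r s" using s(1,2) by (simp add: star_cscale)
  ultimately show ?thesis using sq s(1) by blast
next
  case False
  \<comment> \<open>Here \<open>t\<close> is at most 0 and yet bounds a norm, so both
    \<open>t\<close> and \<open>x\<close> vanish and zero is a root.\<close>
  then have "cnorm A x = 0" "t = 0" using x cnorm_nonneg[of x] by linarith+
  then have "x = \<zero>" using cnorm_eq_0_iff x by simp
  then show ?thesis using \<open>t = 0\<close> by (intro bexI[of _ \<zero>]) (auto simp: a_minus_def)
qed

text \<open>As \<open>a\<close> and \<open>b\<close> commute, \<open>w = a + i b\<close> satisfies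
  \<open>w* w = a a + b b\<close>, and its real part \<open>a\<close> has norm at most that of
  \<open>w\<close>. This is the only comparison of norms from which the order estimates below are
  built.\<close>

lemma cnorm_commuting_squares:
  assumes a: "a \<in> carrier A" "star A a = a" and b: "b \<in> carrier A" "star A b = b"
    and ab: "a \<otimes> b = b \<otimes> a"
  shows "(cnorm A a)\<^sup>2 \<le> cnorm A (a \<otimes> a \<oplus> b \<otimes> b)"
proof -
  let ?w = "a \<oplus> cscale A \<i> b"
  have sw: "star A ?w = a \<oplus> cscale A (-\<i>) b" using a b by (simp add: star_add star_cscale)
  have "star A ?w \<otimes> ?w = a \<otimes> a \<oplus> (cscale A \<i> (b \<otimes> a) \<oplus> cscale A (-\<i>) (b \<otimes> a)) \<oplus> b \<otimes> b"
    unfolding sw using a b ab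
    by (simp add: l_distr r_distr cscale_mult_left cscale_mult_right cscale_cscale cscale_add_right a_ac)
  also have "\<dots> = a \<otimes> a \<oplus> b \<otimes> b"
    using a b by (simp flip: cscale_add_left)
  finally have 1: "cnorm A (a \<otimes> a \<oplus> b \<otimes> b) = (cnorm A ?w)\<^sup>2"
    using cstar_identity[of ?w] a b by simp
  have "?w \<oplus> star A ?w = (a \<oplus> a) \<oplus> (cscale A \<i> b \<oplus> cscale A (-\<i>) b)"
    unfolding sw using a b by (simp add: a_ac)
  also have "\<dots> = cscale A 2 a" using a b by (simp add: cscale_2 flip: cscale_add_left)
  finally have "2 * cnorm A a = cnorm A (?w \<oplus> star A ?w)" using a by (simp add: cnorm_cscale)
  also have "\<dots> \<le> 2 * cnorm A ?w" using cnorm_triangle[of ?w "star A ?w"] a b by simp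
  finally show ?thesis unfolding 1 using cnorm_nonneg[of a] a by (simp add: power_mono)
qed

section \<open>The cone of positive elements\<close>

definition pos :: "'a \<Rightarrow> bool" where
  "pos p \<longleftrightarrow> (\<exists>h\<in>carrier A. star A h = h \<and> p = h \<otimes> h)"

lemma pos_carrier [simp]: "pos p \<Longrightarrow> p \<in> carrier A" and pos_star [simp]: "pos p \<Longrightarrow> star A p = p"
  unfolding pos_def by (auto simp add: star_mult)

lemma pos_square: "h \<in> carrier A \<Longrightarrow> star A h = h \<Longrightarrow> pos (h \<otimes> h)"
  unfolding pos_def by blast

lemma pos_one: "pos \<one>"
  using pos_square[of \<one>] by simp

lemma pos_scalar_minus:
  "x \<in> carrier A \<Longrightarrow> star A x = x \<Longrightarrow> cnorm A x \<le> t \<Longrightarrow> pos (cscale A (complex_of_real t) \<one> \<ominus> x)"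
  using sqrt_scalar_minus[of x t] unfolding pos_def by metis

text \<open>The root \<open>h\<close> of \<open>p\<close> commutes with a root \<open>s\<close> of
  \<open>t - p\<close>, and the squares of the two add up to \<open>t\<close>; the estimate for
  commuting squares bounds that of \<open>s\<close>. Together with \<open>pos_scalar_minus\<close>
  this makes positivity a norm condition.\<close>

lemma cnorm_scalar_minus_pos:
  assumes "pos p" "cnorm A p \<le> t"
  shows "cnorm A (cscale A (complex_of_real t) \<one> \<ominus> p) \<le> t"
proof -
  obtain h where h: "h \<in> carrier A" "star A h = h" "p = h \<otimes> h" using assms pos_def by blast
  obtain s where s: "s \<in> carrier A" "star A s = s" "s \<otimes> s = cscale A (complex_of_real t) \<one> \<ominus> p" "h \<otimes> s = s \<otimes> h"
    using sqrt_scalar_minus[of p t] assms h by (metis m_assoc pos_carrier pos_star)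
  have "cnorm A (s \<otimes> s) \<le> cnorm A (s \<otimes> s \<oplus> h \<otimes> h)"
    using cnorm_commuting_squares[OF s(1,2) h(1,2) s(4)[symmetric]] unfolding cnorm_square[OF s(1,2)] .
  also have "s \<otimes> s \<oplus> h \<otimes> h = cscale A (complex_of_real t) \<one>"
    unfolding s(3) h(3) using h(1) cscale_closed[OF one_closed] by algebra
  also have "cnorm A \<dots> \<le> t"
    using cnorm_cscale_one_le assms cnorm_nonneg[of p] by fastforce
  finally show ?thesis using s by simp
qed

text \<open>With \<open>t\<close> the norm of \<open>p\<close>, write \<open>p = t - (t - p)\<close>
  and use that \<open>t - p\<close> has norm at most \<open>t\<close>. The gain over the definition
  of \<open>pos\<close> is a root that commutes with everything commuting with
  \<open>p\<close>.\<close>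

lemma pos_sqrt:
  assumes "pos p"
  shows "\<exists>s\<in>carrier A. star A s = s \<and> s \<otimes> s = p \<and> (\<forall>c\<in>carrier A. c \<otimes> p = p \<otimes> c \<longrightarrow> c \<otimes> s = s \<otimes> c)"
proof -
  let ?t = "cscale A (complex_of_real (cnorm A p)) \<one>"
  have t: "?t \<in> carrier A" "p \<in> carrier A" using assms by simp_all
  have eq: "?t \<ominus> (?t \<ominus> p) = p" using t by algebra
  have sa: "star A (?t \<ominus> p) = ?t \<ominus> p" using assms by (simp add: star_diff star_cscale)
  have "c \<otimes> (?t \<ominus> p) = (?t \<ominus> p) \<otimes> c" if "c \<in> carrier A" "c \<otimes> p = p \<otimes> c" for c
    using that t by (simp add: a_minus_def l_distr r_distr l_minus r_minus cscale_mult_left cscale_mult_right)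
  moreover obtain s where "s \<in> carrier A" "star A s = s" "s \<otimes> s = p"
    "\<forall>c\<in>carrier A. c \<otimes> (?t \<ominus> p) = (?t \<ominus> p) \<otimes> c \<longrightarrow> c \<otimes> s = s \<otimes> c"
    using sqrt_scalar_minus[OF minus_closed[OF t] sa cnorm_scalar_minus_pos[OF assms order_refl]]
    unfolding eq by blast
  ultimately show ?thesis by blast
qed

text \<open>A self-adjoint \<open>a\<close> is a square as soon as \<open>\<parallel>t - a\<parallel> \<le> t\<close> for some \<open>t\<close>; this criterion is additive.\<close>

lemma pos_add: assumes "pos p" "pos q" shows "pos (p \<oplus> q)"
proof -
  let ?t = "cnorm A p" and ?u = "cnorm A q"
  let ?T = "cscale A (complex_of_real ?t) \<one>" and ?U = "cscale A (complex_of_real ?u) \<one>"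
  let ?S = "cscale A (complex_of_real (?t + ?u)) \<one>"
  have c: "?T \<in> carrier A" "?U \<in> carrier A" "?S \<in> carrier A" "p \<in> carrier A" "q \<in> carrier A" using assms by simp_all
  have S: "?S = ?T \<oplus> ?U" by (simp add: cscale_add_left)
  have "?S \<ominus> (p \<oplus> q) = (?T \<ominus> p) \<oplus> (?U \<ominus> q)" unfolding S using c by algebra
  then have "cnorm A (?S \<ominus> (p \<oplus> q)) \<le> ?t + ?u"
    using cnorm_triangle[of "?T \<ominus> p" "?U \<ominus> q"] c cnorm_scalar_minus_pos[OF assms(1) order_refl]
      cnorm_scalar_minus_pos[OF assms(2) order_refl] by simp
  moreover have "star A (?S \<ominus> (p \<oplus> q)) = ?S \<ominus> (p \<oplus> q)"
    using assms c by (simp add: star_diff star_cscale star_add)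
  ultimately have "pos (?S \<ominus> (?S \<ominus> (p \<oplus> q)))" using c by (intro pos_scalar_minus) auto
  moreover have "?S \<ominus> (?S \<ominus> (p \<oplus> q)) = p \<oplus> q" using c by algebra
  ultimately show ?thesis by simp
qed

lemma pos_cscale: assumes "pos p" "0 \<le> t" shows "pos (cscale A (complex_of_real t) p)"
proof -
  obtain h where h: "h \<in> carrier A" "star A h = h" "p = h \<otimes> h" using assms pos_def by blast
  have "complex_of_real (sqrt t) * complex_of_real (sqrt t) = complex_of_real t"
    using assms(2) by (metis of_real_mult real_sqrt_mult_self abs_of_nonneg)
  then show ?thesis
    using pos_square[of "cscale A (complex_of_real (sqrt t)) h"] h
    by (simp add: star_cscale cscale_mult_left cscale_mult_right cscale_cscale)
qed

text \<open>The root of \<open>p\<close> commutes with \<open>q\<close>, hence with the root of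
  \<open>q\<close>; so the product of the roots is self-adjoint and squares to the product of
  \<open>p\<close> and \<open>q\<close>.\<close>

lemma pos_mult: assumes "pos p" "pos q" "p \<otimes> q = q \<otimes> p" shows "pos (p \<otimes> q)"
proof -
  obtain s where s: "s \<in> carrier A" "star A s = s" "s \<otimes> s = p"
    "\<And>c. c\<in>carrier A \<Longrightarrow> c \<otimes> p = p \<otimes> c \<Longrightarrow> c \<otimes> s = s \<otimes> c" using pos_sqrt[OF assms(1)] by blast
  obtain r where r: "r \<in> carrier A" "star A r = r" "r \<otimes> r = q"
    "\<And>c. c\<in>carrier A \<Longrightarrow> c \<otimes> q = q \<otimes> c \<Longrightarrow> c \<otimes> r = r \<otimes> c" using pos_sqrt[OF assms(2)] by blast
  have sr: "s \<otimes> r = r \<otimes> s" using s(4)[of q] r(4)[of s] assms s(1) by simp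
  have "(s \<otimes> r) \<otimes> (s \<otimes> r) = (s \<otimes> s) \<otimes> (r \<otimes> r)"
    using sr s(1) r(1) by (metis m_assoc m_closed)
  then show ?thesis using pos_square[of "s \<otimes> r"] s r sr by (simp add: star_mult)
qed

text \<open>With \<open>b\<close> the norm of \<open>p + q\<close>, the element
  \<open>b - p = (b - (p + q)) + q\<close> is positive. Its root commutes with the root of
  \<open>p\<close>, and the two squares add up to \<open>b\<close>, which bounds the norm of
  \<open>p\<close>.\<close>

lemma cnorm_pos_mono: assumes "pos p" "pos q" shows "cnorm A p \<le> cnorm A (p \<oplus> q)"
proof -
  let ?b = "cnorm A (p \<oplus> q)"
  let ?B = "cscale A (complex_of_real ?b) \<one>"
  have c: "?B \<in> carrier A" "p \<in> carrier A" "q \<in> carrier A" using assms by simp_all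
  obtain h where h: "h \<in> carrier A" "star A h = h" "p = h \<otimes> h" using assms pos_def by blast
  have "pos ((?B \<ominus> (p \<oplus> q)) \<oplus> q)"
    using assms pos_add[OF assms] by (intro pos_add pos_scalar_minus) auto
  moreover have "(?B \<ominus> (p \<oplus> q)) \<oplus> q = ?B \<ominus> p" using c by algebra
  ultimately have "pos (?B \<ominus> p)" by simp
  moreover have "h \<otimes> (?B \<ominus> p) = (?B \<ominus> p) \<otimes> h"
    using h c by (simp add: a_minus_def l_distr r_distr l_minus r_minus m_assoc cscale_mult_left cscale_mult_right)
  ultimately obtain s where s: "s \<in> carrier A" "star A s = s" "s \<otimes> s = ?B \<ominus> p" "h \<otimes> s = s \<otimes> h"
    using pos_sqrt h(1) by metis
  have "cnorm A p \<le> cnorm A (h \<otimes> h \<oplus> s \<otimes> s)"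
    using cnorm_commuting_squares[OF h(1,2) s(1,2) s(4)] unfolding h(3) cnorm_square[OF h(1,2)] .
  also have "h \<otimes> h \<oplus> s \<otimes> s = ?B" unfolding s(3) h(3)[symmetric] using c by algebra
  also have "cnorm A ?B \<le> ?b" using cnorm_cscale_one_le c cnorm_nonneg[of "p \<oplus> q"] by simp
  finally show ?thesis .
qed


section \<open>Powers, Bernoulli's inequality and approximate units\<close>

lemma star_pow: "x \<in> carrier A \<Longrightarrow> star A x = x \<Longrightarrow> star A (x [^] (n::nat)) = x [^] n"
  by (induction n) (simp_all add: star_mult nat_pow_Suc2[symmetric])

lemma commute_pow: "c \<in> carrier A \<Longrightarrow> x \<in> carrier A \<Longrightarrow> c \<otimes> x = x \<otimes> c \<Longrightarrow>
    c \<otimes> x [^] (n::nat) = x [^] n \<otimes> c"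
proof (induction n)
  case (Suc n)
  then show ?case by (metis m_assoc nat_pow_Suc nat_pow_closed)
qed simp

lemma r_diff_distr: "x \<in> carrier A \<Longrightarrow> y \<in> carrier A \<Longrightarrow> z \<in> carrier A \<Longrightarrow>
    x \<otimes> (y \<ominus> z) = x \<otimes> y \<ominus> x \<otimes> z"
  by (simp add: a_minus_def r_distr r_minus)

lemma diff_diff_eq_add: "x \<in> carrier A \<Longrightarrow> y \<in> carrier A \<Longrightarrow> z \<in> carrier A \<Longrightarrow>
    x \<ominus> (y \<ominus> z) = (x \<ominus> y) \<oplus> z"
  by (simp add: a_minus_def minus_add a_assoc)

lemma add_diff_cancel: "x \<in> carrier A \<Longrightarrow> y \<in> carrier A \<Longrightarrow> x \<oplus> (y \<ominus> x) = y"
  by algebra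

lemma pos_pow: assumes "pos x" shows "pos (x [^] (n::nat))"
proof (induction n)
  case (Suc n)
  have "x [^] n \<otimes> x = x \<otimes> x [^] n"
    by (rule commute_pow[symmetric]) (simp_all add: assms)
  then show ?case using pos_mult[OF Suc assms] by simp
qed (simp add: pos_one)

lemma cnorm_pow_le: assumes "x \<in> carrier A" "cnorm A x \<le> 1" shows "cnorm A (x [^] (n::nat)) \<le> 1"
proof (induction n)
  case (Suc n)
  have "cnorm A (x [^] n \<otimes> x) \<le> cnorm A (x [^] n) * cnorm A x"
    using assms by (intro cnorm_mult) auto
  also have "\<dots> \<le> 1" using Suc assms cnorm_nonneg by (simp add: mult_le_one)
  finally show ?case by simp
qed (simp add: cnorm_one_le)

text \<open>Bernoulli's inequality for the commuting elements \<open>h\<close> and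
  \<open>1 - h\<close>: passing from \<open>n\<close> to \<open>n + 1\<close> adds
  \<open>(n + 1) (1 - h)^n h^2\<close>, a product of commuting positive elements.\<close>

lemma pos_bernoulli:
  assumes h: "pos h" and g: "pos (\<one> \<ominus> h)"
  shows "pos (\<one> \<ominus> (\<one> \<ominus> h) [^] n \<otimes> (\<one> \<oplus> cscale A (of_nat n) h))"
proof (induction n)
  case 0
  have "\<one> \<ominus> \<one> \<otimes> (\<one> \<oplus> \<zero>) = \<zero> \<otimes> \<zero>" by simp
  then show ?case using pos_square[of \<zero>] h by simp
next
  case (Suc n)
  let ?G = "(\<one> \<ominus> h) [^] n" and ?N = "cscale A (of_nat n) h"
  note c = pos_carrier[OF h] pos_carrier[OF pos_pow[OF g, of n]] cscale_closed[OF pos_carrier[OF h], of "of_nat n"]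
  have Nh: "h \<otimes> ?N = ?N \<otimes> h" using c by (simp add: cscale_mult_left cscale_mult_right)
  have hG: "h \<otimes> ?G = ?G \<otimes> h"
    using c by (intro commute_pow) (simp_all add: a_minus_def l_distr r_distr l_minus r_minus)
  have S: "cscale A (of_nat (Suc n)) h = ?N \<oplus> h"
    using cscale_add_left[of h "of_nat n" 1] c by (simp add: add.commute)
  have "(\<one> \<ominus> h) \<otimes> (\<one> \<oplus> (?N \<oplus> h)) = \<one> \<oplus> ?N \<ominus> (h \<otimes> ?N \<oplus> h \<otimes> h)"
    using c(1,3) by (simp add: ring_simprules)
  then have *: "(\<one> \<ominus> h) \<otimes> (\<one> \<oplus> (?N \<oplus> h)) = (\<one> \<oplus> ?N) \<ominus> (?N \<otimes> h \<oplus> h \<otimes> h)"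
    unfolding Nh .
  have "(\<one> \<ominus> h) [^] Suc n \<otimes> (\<one> \<oplus> (?N \<oplus> h)) = ?G \<otimes> ((\<one> \<ominus> h) \<otimes> (\<one> \<oplus> (?N \<oplus> h)))"
    using c by (simp only: nat_pow_Suc m_assoc one_closed minus_closed a_closed)
  also have "\<dots> = ?G \<otimes> (\<one> \<oplus> ?N) \<ominus> (?G \<otimes> (?N \<otimes> h \<oplus> h \<otimes> h))"
    unfolding * using c by (intro r_diff_distr) auto
  finally have "(\<one> \<ominus> h) [^] Suc n \<otimes> (\<one> \<oplus> (?N \<oplus> h)) = ?G \<otimes> (\<one> \<oplus> ?N) \<ominus> (?G \<otimes> (?N \<otimes> h \<oplus> h \<otimes> h))" .
  then have "\<one> \<ominus> (\<one> \<ominus> h) [^] Suc n \<otimes> (\<one> \<oplus> (?N \<oplus> h)) =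
      (\<one> \<ominus> ?G \<otimes> (\<one> \<oplus> ?N)) \<oplus> ?G \<otimes> (?N \<otimes> h \<oplus> h \<otimes> h)"
    using c by (simp only: diff_diff_eq_add m_closed a_closed one_closed)
  also have "?N \<otimes> h \<oplus> h \<otimes> h = cscale A (complex_of_real (real (Suc n))) (h \<otimes> h)"
    using c cscale_add_left[of "h \<otimes> h" "of_nat n" 1] by (simp add: cscale_mult_left add.commute)
  finally have eq: "\<one> \<ominus> (\<one> \<ominus> h) [^] Suc n \<otimes> (\<one> \<oplus> cscale A (of_nat (Suc n)) h) =
      (\<one> \<ominus> ?G \<otimes> (\<one> \<oplus> ?N)) \<oplus> ?G \<otimes> cscale A (complex_of_real (real (Suc n))) (h \<otimes> h)"
    unfolding S .
  have "pos (?G \<otimes> (h \<otimes> h))"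
  proof (rule pos_mult[OF pos_pow[OF g] pos_mult[OF h h refl]])
    show "?G \<otimes> (h \<otimes> h) = (h \<otimes> h) \<otimes> ?G" using hG c by (metis m_assoc)
  qed
  then have "pos (cscale A (complex_of_real (real (Suc n))) (?G \<otimes> (h \<otimes> h)))"
    by (rule pos_cscale) simp
  then show ?case unfolding eq using Suc c by (intro pos_add) (simp_all add: cscale_mult_right)
qed

text \<open>With \<open>G = (1 - h)^n\<close> the unit is the sum of \<open>n h G\<close>,
  \<open>G\<close> and \<open>1 - G (1 + n h)\<close>, all positive, so the first of them has norm
  at most 1.\<close>

lemma cnorm_mult_pow_bound:
  assumes h: "pos h" and g: "pos (\<one> \<ominus> h)"
  shows "real n * cnorm A (h \<otimes> (\<one> \<ominus> h) [^] n) \<le> 1"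
proof -
  let ?G = "(\<one> \<ominus> h) [^] n" and ?N = "cscale A (of_nat n) h"
  note c = pos_carrier[OF h] pos_carrier[OF pos_pow[OF g, of n]] cscale_closed[OF pos_carrier[OF h], of "of_nat n"]
  have hG: "h \<otimes> ?G = ?G \<otimes> h"
    using c by (intro commute_pow) (simp_all add: a_minus_def l_distr r_distr l_minus r_minus)
  have 1: "pos (cscale A (complex_of_real (real n)) (h \<otimes> ?G))"
    by (rule pos_cscale[OF pos_mult[OF h pos_pow[OF g] hG]]) simp
  have "real n * cnorm A (h \<otimes> ?G) = cnorm A (cscale A (complex_of_real (real n)) (h \<otimes> ?G))"
    using c by (simp add: cnorm_cscale)
  also have "\<dots> \<le> cnorm A (cscale A (complex_of_real (real n)) (h \<otimes> ?G) \<oplus> (?G \<oplus> (\<one> \<ominus> ?G \<otimes> (\<one> \<oplus> ?N))))"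
    by (rule cnorm_pos_mono[OF 1 pos_add[OF pos_pow[OF g] pos_bernoulli[OF h g]]])
  also have "cscale A (complex_of_real (real n)) (h \<otimes> ?G) = ?G \<otimes> ?N"
    using c hG by (simp add: cscale_mult_right)
  also have "?G \<otimes> ?N \<oplus> (?G \<oplus> (\<one> \<ominus> ?G \<otimes> (\<one> \<oplus> ?N))) = \<one>"
    using c(2,3) by (simp add: ring_simprules)
  finally show ?thesis using cnorm_one_le by simp
qed

text \<open>The witness is \<open>e = (1 - h)^n\<close> with \<open>h\<close> the square of a
  rescaled \<open>k\<close>. Expanding the power shows that \<open>1 - e\<close> is a multiple of
  \<open>h\<close> and so lies in every ideal containing \<open>k\<close>, while
  \<open>h e^2\<close> has norm at most 1/(2n).\<close>

lemma approximate_unit: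
  assumes k: "k \<in> carrier A" "star A k = k" and "\<delta> > 0"
  shows "\<exists>e\<in>carrier A. star A e = e \<and> cnorm A e \<le> 1 \<and> cnorm A (e \<otimes> k \<otimes> e) < \<delta> \<and>
    (\<forall>I. ideal I A \<longrightarrow> k \<in> I \<longrightarrow> \<one> \<ominus> e \<in> I)"
proof -
  \<comment> \<open>The summand 1 keeps the factor finite for \<open>k = 0\<close>, and the rescaled
    \<open>k\<close> becomes a contraction.\<close>
  define r where "r = 1 / (cnorm A k + 1)"
  have r: "r > 0" "r * cnorm A k \<le> 1" using cnorm_nonneg[OF k(1)] by (simp_all add: r_def)
  define k' where "k' = cscale A (complex_of_real r) k"
  have k': "k' \<in> carrier A" "star A k' = k'" "cnorm A k' = r * cnorm A k"
    using k r by (simp_all add: k'_def star_cscale cnorm_cscale)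
  define h where "h = k' \<otimes> k'"
  define g where "g = \<one> \<ominus> h"
  have h: "pos h" unfolding h_def by (rule pos_square[OF k'(1,2)])
  have "cnorm A h \<le> 1" unfolding h_def cnorm_square[OF k'(1,2)] k'(3)
    using r cnorm_nonneg[OF k(1)] by (simp add: power_le_one)
  then have g: "pos g" "cnorm A g \<le> 1"
    using pos_scalar_minus[of h 1] cnorm_scalar_minus_pos[OF h, of 1] h by (simp_all add: g_def)
  note c = k'(1) pos_carrier[OF h] pos_carrier[OF g(1)]
  have "(r * \<delta>)\<^sup>2 > 0" using r \<open>\<delta> > 0\<close> by simp
  \<comment> \<open>The square of the norm of \<open>k' e\<close> will be at most 1/(2n); it has to
    fall below the square of the tolerance rescaled by \<open>r\<close>.\<close>
  then obtain n :: nat where n: "n > 0" "1 / real n < (r * \<delta>)\<^sup>2"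
    using nat_approx_posE by (metis zero_less_Suc)
  define e where "e = g [^] n"
  have e: "e \<in> carrier A" "star A e = e" "cnorm A e \<le> 1"
    unfolding e_def using g star_pow cnorm_pow_le by simp_all
  have "k' \<otimes> g = g \<otimes> k'"
    unfolding g_def h_def using c by (simp add: a_minus_def l_distr r_distr l_minus r_minus m_assoc)
  then have ke: "k' \<otimes> e = e \<otimes> k'" unfolding e_def using commute_pow c by simp
  have "(cnorm A (k' \<otimes> e))\<^sup>2 = cnorm A ((e \<otimes> k') \<otimes> (k' \<otimes> e))"
    using cstar_identity[of "k' \<otimes> e"] e k' by (simp add: star_mult)
  also have "(e \<otimes> k') \<otimes> (k' \<otimes> e) = h \<otimes> (e \<otimes> e)"
    unfolding h_def using c e ke by (metis m_assoc m_closed)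
  also have "e \<otimes> e = g [^] (n + n)" unfolding e_def using c by (simp add: nat_pow_mult)
  also have "cnorm A (h \<otimes> g [^] (n + n)) \<le> 1 / real (n + n)"
    using cnorm_mult_pow_bound[OF h, of "n + n"] g n by (simp add: g_def field_simps)
  also have "\<dots> \<le> 1 / real n" using n by (simp add: frac_le)
  also have "\<dots> < (r * \<delta>)\<^sup>2" by (fact n)
  finally have "cnorm A (k' \<otimes> e) < r * \<delta>"
    using r \<open>\<delta> > 0\<close> by (simp add: power_less_imp_less_base)
  then have "cnorm A (k \<otimes> e) < \<delta>"
    using r k e by (simp add: k'_def cscale_mult_left cnorm_cscale)
  moreover have "cnorm A (e \<otimes> k \<otimes> e) \<le> 1 * cnorm A (k \<otimes> e)"
    using e k cnorm_mult[of e "k \<otimes> e"] cnorm_nonneg[of "k \<otimes> e"]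
    by (simp add: m_assoc) (meson mult_left_le_one_le order_trans cnorm_nonneg)
  moreover have "\<one> \<ominus> e \<in> I" if I: "ideal I A" "k \<in> I" for I
  proof -
    interpret ideal I A by fact
    have "h = k \<otimes> cscale A (complex_of_real r) k'"
      unfolding h_def k'_def using k by (simp add: cscale_mult_left cscale_mult_right)
    then have hI: "h \<in> I" using I_r_closed[OF I(2)] c by simp
    have "\<one> \<ominus> g [^] m \<in> I" for m :: nat
    proof (induction m)
      case (Suc m)
      have "\<one> \<ominus> g [^] Suc m = (\<one> \<ominus> g [^] m) \<oplus> g [^] m \<otimes> h"
        using c by (simp add: g_def) (simp add: a_minus_def r_distr r_minus minus_add a_ac)
      then show ?case using Suc hI c I_l_closed a_closed by simp
    qed simp
    then show ?thesis by (simp add: e_def)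
  qed
  ultimately show ?thesis using e by (intro bexI[of _ e]) auto
qed

text \<open>For the approximate unit \<open>1 - e n\<close> belonging to \<open>k\<close>, the
  products \<open>x (1 - e n)\<close> lie in the ideal and converge to \<open>x\<close>, since the
  norms of \<open>x (e n)\<close> are controlled by those of \<open>e n k e n\<close>. The
  hypothesis expresses that \<open>x* x\<close> is dominated by \<open>k\<close> through norms of
  compressions only.\<close>

lemma closed_ideal_dominated:
  assumes I: "closed_ideal A I" and x: "x \<in> carrier A" and k: "k \<in> I" "star A k = k"
    and le: "\<And>e. e \<in> carrier A \<Longrightarrow> star A e = e \<Longrightarrow> (cnorm A (x \<otimes> e))\<^sup>2 \<le> cnorm A (e \<otimes> k \<otimes> e)"
  shows "x \<in> I"
proof -
  have id: "ideal I A" and cl: "norm_closed A I" using I by (simp_all add: closed_ideal_def)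
  interpret ideal I A by fact
  have kc: "k \<in> carrier A" using k by simp
  have "\<exists>e\<in>carrier A. star A e = e \<and> cnorm A (e \<otimes> k \<otimes> e) < inverse (real (Suc n)) \<and> \<one> \<ominus> e \<in> I" for n
    using approximate_unit[OF kc k(2), of "inverse (real (Suc n))"] k id by fastforce
  then obtain e where e: "\<And>n. e n \<in> carrier A" "\<And>n. star A (e n) = e n"
    "\<And>n. cnorm A (e n \<otimes> k \<otimes> e n) < inverse (real (Suc n))" "\<And>n. \<one> \<ominus> e n \<in> I" by metis
  have "nlim (\<lambda>n. x \<otimes> (\<one> \<ominus> e n)) x"
  proof (rule nlimI_bound[where f="\<lambda>n. sqrt (inverse (real (Suc n)))"])
    fix n
    have "x \<otimes> (\<one> \<ominus> e n) \<ominus> x = \<ominus> (x \<otimes> e n)"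
      using x e by (simp add: a_minus_def r_distr r_minus) (simp add: a_ac r_neg1 r_neg2)
    then have "cnorm A (x \<otimes> (\<one> \<ominus> e n) \<ominus> x) = cnorm A (x \<otimes> e n)" using x e by simp
    also have "\<dots> \<le> sqrt (inverse (real (Suc n)))"
      using le[OF e(1,2), of n] e(3)[of n] by (intro real_le_rsqrt) simp
    finally show "cnorm A (x \<otimes> (\<one> \<ominus> e n) \<ominus> x) \<le> sqrt (inverse (real (Suc n)))" .
  next
    show "(\<lambda>n. sqrt (inverse (real (Suc n)))) \<longlonglongrightarrow> 0"
      using tendsto_real_sqrt[OF LIMSEQ_inverse_real_of_nat] by simp
  qed (use x e in auto)
  then show ?thesis by (rule norm_closedD[OF cl]) (use e(4) x I_l_closed in auto)
qed

text \<open>The product of \<open>x\<close> with its adjoint lies in the ideal and dominates the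
  adjoint of \<open>x\<close>, in fact with equality of norms by the C*-identity.\<close>

lemma closed_ideal_star: assumes I: "closed_ideal A I" and x: "x \<in> I" shows "star A x \<in> I"
proof -
  have id: "ideal I A" using I by (simp add: closed_ideal_def)
  interpret ideal I A by fact
  have xc: "x \<in> carrier A" using x by simp
  show ?thesis
  proof (rule closed_ideal_dominated[OF I, where k="x \<otimes> star A x"])
    fix e assume e: "e \<in> carrier A" "star A e = e"
    show "(cnorm A (star A x \<otimes> e))\<^sup>2 \<le> cnorm A (e \<otimes> (x \<otimes> star A x) \<otimes> e)"
      using cstar_identity[of "star A x \<otimes> e"] e xc by (simp add: star_mult m_assoc)
  qed (use xc x I_r_closed in \<open>auto simp: star_mult\<close>)
qed

end

section \<open>Homomorphisms and their contractivity\<close>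

lemma star_homD:
  assumes "star_hom A D f"
  shows "x \<in> carrier A \<Longrightarrow> f x \<in> carrier D"
    and "x \<in> carrier A \<Longrightarrow> y \<in> carrier A \<Longrightarrow> f (x \<oplus>\<^bsub>A\<^esub> y) = f x \<oplus>\<^bsub>D\<^esub> f y"
    and "x \<in> carrier A \<Longrightarrow> y \<in> carrier A \<Longrightarrow> f (x \<otimes>\<^bsub>A\<^esub> y) = f x \<otimes>\<^bsub>D\<^esub> f y"
    and "x \<in> carrier A \<Longrightarrow> f (cscale A c x) = cscale D c (f x)"
    and "x \<in> carrier A \<Longrightarrow> f (star A x) = star D (f x)"
  using assms by (auto simp: star_hom_def)

lemma star_homI:
  assumes "\<And>x. x \<in> carrier A \<Longrightarrow> f x \<in> carrier D"
    and "\<And>x y. x \<in> carrier A \<Longrightarrow> y \<in> carrier A \<Longrightarrow> f (x \<oplus>\<^bsub>A\<^esub> y) = f x \<oplus>\<^bsub>D\<^esub> f y"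
    and "\<And>x y. x \<in> carrier A \<Longrightarrow> y \<in> carrier A \<Longrightarrow> f (x \<otimes>\<^bsub>A\<^esub> y) = f x \<otimes>\<^bsub>D\<^esub> f y"
    and "\<And>c x. x \<in> carrier A \<Longrightarrow> f (cscale A c x) = cscale D c (f x)"
    and "\<And>x. x \<in> carrier A \<Longrightarrow> f (star A x) = star D (f x)"
  shows "star_hom A D f"
  using assms by (auto simp: star_hom_def)

lemma star_hom_zero:
  assumes "unital_cstar_algebra A" "unital_cstar_algebra D" "star_hom A D f"
  shows "f \<zero>\<^bsub>A\<^esub> = \<zero>\<^bsub>D\<^esub>"
proof -
  interpret A: unital_cstar_algebra A by fact
  interpret D: unital_cstar_algebra D by fact
  show ?thesis
    using star_homD(4)[OF assms(3) A.zero_closed, of 0] star_homD(1)[OF assms(3) A.zero_closed] by simp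
qed

lemma star_hom_diff:
  assumes "unital_cstar_algebra A" "unital_cstar_algebra D" "star_hom A D f"
    and "x \<in> carrier A" "y \<in> carrier A"
  shows "f (x \<ominus>\<^bsub>A\<^esub> y) = f x \<ominus>\<^bsub>D\<^esub> f y"
proof -
  interpret A: unital_cstar_algebra A by fact
  interpret D: unital_cstar_algebra D by fact
  show ?thesis
    using assms(4,5) by (simp add: a_minus_def A.minus_eq_cscale D.minus_eq_cscale star_homD[OF assms(3)])
qed

text \<open>A square root takes the place of the spectral radius. For \<open>h = x* x\<close> and
  \<open>t\<close> the squared norm of \<open>h\<close>, the element \<open>t - h^2\<close> is the
  square of some \<open>s\<close> commuting with \<open>h\<close>. The images satisfy the same
  identity, so the estimate for commuting squares bounds the image of \<open>h\<close>, and the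
  C*-identity that of \<open>x\<close>.\<close>

lemma unital_star_hom_cnorm_le:
  assumes A: "unital_cstar_algebra A" and D: "unital_cstar_algebra D"
    and f: "unital_star_hom A D f" and x: "x \<in> carrier A"
  shows "cnorm D (f x) \<le> cnorm A x"
proof -
  interpret A: unital_cstar_algebra A by fact
  interpret D: unital_cstar_algebra D by fact
  have sh: "star_hom A D f" and f1: "f \<one>\<^bsub>A\<^esub> = \<one>\<^bsub>D\<^esub>" using f by (simp_all add: unital_star_hom_def)
  note fD = star_homD[OF sh]
  let ?h = "star A x \<otimes>\<^bsub>A\<^esub> x"
  have h: "?h \<in> carrier A" "star A ?h = ?h" using x by (simp_all add: A.star_mult)
  let ?t = "(cnorm A ?h)\<^sup>2"
  obtain s where s: "s \<in> carrier A" "star A s = s"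
    "s \<otimes>\<^bsub>A\<^esub> s = cscale A (complex_of_real ?t) \<one>\<^bsub>A\<^esub> \<ominus>\<^bsub>A\<^esub> ?h \<otimes>\<^bsub>A\<^esub> ?h" "?h \<otimes>\<^bsub>A\<^esub> s = s \<otimes>\<^bsub>A\<^esub> ?h"
  proof -
    have "?h \<otimes>\<^bsub>A\<^esub> (?h \<otimes>\<^bsub>A\<^esub> ?h) = (?h \<otimes>\<^bsub>A\<^esub> ?h) \<otimes>\<^bsub>A\<^esub> ?h" using h(1) by (simp add: A.m_assoc)
    moreover have "star A (?h \<otimes>\<^bsub>A\<^esub> ?h) = ?h \<otimes>\<^bsub>A\<^esub> ?h" by (simp only: A.star_mult[OF h(1) h(1)] h(2))
    ultimately show ?thesis
      using A.sqrt_scalar_minus[of "?h \<otimes>\<^bsub>A\<^esub> ?h" ?t] A.cnorm_square[OF h] h(1) that by fastforce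
  qed
  have fs: "f s \<in> carrier D" "star D (f s) = f s" using fD(1)[OF s(1)] fD(5)[OF s(1)] s(2) by simp_all
  have fh: "f ?h \<in> carrier D" "star D (f ?h) = f ?h" using fD(1)[OF h(1)] fD(5)[OF h(1)] h(2) by simp_all
  have comm: "f ?h \<otimes>\<^bsub>D\<^esub> f s = f s \<otimes>\<^bsub>D\<^esub> f ?h"
    using arg_cong[OF s(4), of f] by (simp only: fD(3)[OF h(1) s(1)] fD(3)[OF s(1) h(1)])
  have "f s \<otimes>\<^bsub>D\<^esub> f s = f (s \<otimes>\<^bsub>A\<^esub> s)" by (simp only: fD(3)[OF s(1) s(1)])
  also have "\<dots> = cscale D (complex_of_real ?t) \<one>\<^bsub>D\<^esub> \<ominus>\<^bsub>D\<^esub> f ?h \<otimes>\<^bsub>D\<^esub> f ?h"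
    unfolding s(3) using h(1) by (simp only: star_hom_diff[OF A D sh] A.cscale_closed A.one_closed A.m_closed fD(3,4) f1)
  finally have sum: "f ?h \<otimes>\<^bsub>D\<^esub> f ?h \<oplus>\<^bsub>D\<^esub> f s \<otimes>\<^bsub>D\<^esub> f s = cscale D (complex_of_real ?t) \<one>\<^bsub>D\<^esub>"
    using D.add_diff_cancel[OF D.m_closed[OF fh(1) fh(1)] D.cscale_closed[OF D.one_closed]] by (simp only:)
  have "(cnorm D (f ?h))\<^sup>2 \<le> ?t"
    using D.cnorm_commuting_squares[OF fh fs comm] D.cnorm_cscale_one_le[of ?t] unfolding sum by simp
  then have "cnorm D (f ?h) \<le> cnorm A ?h" using A.cnorm_nonneg[OF h(1)] by (rule power2_le_imp_le)
  moreover have "f ?h = star D (f x) \<otimes>\<^bsub>D\<^esub> f x" using x by (simp add: fD)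
  ultimately have "(cnorm D (f x))\<^sup>2 \<le> (cnorm A x)\<^sup>2"
    using D.cstar_identity[of "f x"] A.cstar_identity[OF x] fD(1)[OF x] by simp
  then show ?thesis using A.cnorm_nonneg[OF x] by (rule power2_le_imp_le)
qed

section \<open>Quotients\<close>

lemma cstar_quotient_simps:
  "carrier (cstar_quotient A I) = a_rcosets\<^bsub>A\<^esub> I"
  "\<one>\<^bsub>cstar_quotient A I\<^esub> = I +>\<^bsub>A\<^esub> \<one>\<^bsub>A\<^esub>"
  "\<zero>\<^bsub>cstar_quotient A I\<^esub> = I"
  "mult (cstar_quotient A I) = rcoset_mult A I"
  "add (cstar_quotient A I) = set_add A"
  "cscale (cstar_quotient A I) c = coset_map A I (cscale A c)"
  "star (cstar_quotient A I) = coset_map A I (star A)"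
  "cnorm (cstar_quotient A I) X = Inf (cnorm A ` X)"
  by (simp_all add: cstar_quotient_def ring.defs cstar.defs FactRing_def)

text \<open>The quotient ring is a plain ring record, whereas the quotient C*-algebra carries
  further fields; the ring axioms see only the common operations.\<close>

lemma ring_cong:
  assumes "ring R" "carrier S = carrier R" "mult S = mult R" "one S = one R" "zero S = zero R" "add S = add R"
  shows "ring S"
proof -
  interpret R: ring R by fact
  show ?thesis
  proof (intro ringI abelian_groupI monoidI)
    fix x assume "x \<in> carrier S"
    then show "\<exists>y\<in>carrier S. y \<oplus>\<^bsub>S\<^esub> x = \<zero>\<^bsub>S\<^esub>"
      unfolding assms(2-) using R.l_neg R.a_inv_closed by blast
  qed (unfold assms(2-), auto simp: R.m_assoc R.l_distr R.r_distr R.a_ac)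
qed

lemma coset_map_rcos:
  assumes "ideal I A" "x \<in> carrier A" "f x \<in> carrier A" "K \<noteq> {}"
    and "\<And>k. k \<in> K \<Longrightarrow> \<exists>i\<in>I. f (k \<oplus>\<^bsub>A\<^esub> x) = i \<oplus>\<^bsub>A\<^esub> f x"
  shows "coset_map A I f (K +>\<^bsub>A\<^esub> x) = I +>\<^bsub>A\<^esub> f x"
proof -
  interpret ideal I A by fact
  have *: "I +>\<^bsub>A\<^esub> f (k \<oplus>\<^bsub>A\<^esub> x) = I +>\<^bsub>A\<^esub> f x" if k: "k \<in> K" for k
  proof -
    obtain i where i: "i \<in> I" "f (k \<oplus>\<^bsub>A\<^esub> x) = i \<oplus>\<^bsub>A\<^esub> f x" using assms(5)[OF k] by blast
    then show ?thesis using assms(3) by (simp add: a_coset_add_assoc[symmetric] a_rcos_const a_subset)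
  qed
  have "K +>\<^bsub>A\<^esub> x = (\<lambda>k. k \<oplus>\<^bsub>A\<^esub> x) ` K" by (auto simp: a_r_coset_def' )
  then have "coset_map A I f (K +>\<^bsub>A\<^esub> x) = (\<Union>k\<in>K. I +>\<^bsub>A\<^esub> f (k \<oplus>\<^bsub>A\<^esub> x))"
    by (simp add: coset_map_def)
  also have "\<dots> = I +>\<^bsub>A\<^esub> f x" using * assms(4) by fastforce
  finally show ?thesis .
qed

locale cstar_ideal = unital_cstar_algebra A for A :: "'a cstar" (structure) +
  fixes I :: "'a set"
  assumes closed_ideal: "closed_ideal A I"
begin

sublocale ideal I A
  using closed_ideal by (simp add: closed_ideal_def)

lemma rcos_cases: assumes "X \<in> carrier (cstar_quotient A I)"
  obtains x where "x \<in> carrier A" "X = I +> x"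
  using assms by (auto simp: cstar_quotient_simps A_RCOSETS_def')

lemma rcos_carrier [simp]: "x \<in> carrier A \<Longrightarrow> I +> x \<in> carrier (cstar_quotient A I)"
  by (auto simp: cstar_quotient_simps A_RCOSETS_def')

lemma rcos_eq_iff: assumes "x \<in> carrier A" "y \<in> carrier A" shows "I +> x = I +> y \<longleftrightarrow> x \<ominus> y \<in> I"
proof
  assume "I +> x = I +> y"
  then have "x \<in> I +> y" using a_rcos_self[OF assms(1)] by simp
  then show "x \<ominus> y \<in> I" using a_rcos_module_minus[OF ring_axioms assms(2,1)] by simp
next
  assume "x \<ominus> y \<in> I"
  then have "x \<in> I +> y" using a_rcos_module_minus[OF ring_axioms assms(2,1)] by simp
  then show "I +> x = I +> y" using a_repr_independence'[OF _ assms(2)] by simp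
qed

lemma rcos_image: "I +> x = (\<lambda>i. i \<oplus> x) ` I"
  by (auto simp: a_r_coset_def')

lemma cscale_ideal: "i \<in> I \<Longrightarrow> cscale A c i \<in> I"
  using I_l_closed[of i "cscale A c \<one>"] by (simp add: cscale_mult_left)

lemma star_ideal: "i \<in> I \<Longrightarrow> star A i \<in> I"
  using closed_ideal_star closed_ideal by blast

lemma ideal_ne: "I = {} \<Longrightarrow> False"
  using additive_subgroup.zero_closed[OF is_additive_subgroup] by blast

lemma rcos_hom:
  "x \<in> carrier A \<Longrightarrow> y \<in> carrier A \<Longrightarrow> (I +> x) \<oplus>\<^bsub>cstar_quotient A I\<^esub> (I +> y) = I +> (x \<oplus> y)"
  "x \<in> carrier A \<Longrightarrow> y \<in> carrier A \<Longrightarrow> (I +> x) \<otimes>\<^bsub>cstar_quotient A I\<^esub> (I +> y) = I +> (x \<otimes> y)"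
  "x \<in> carrier A \<Longrightarrow> cscale (cstar_quotient A I) c (I +> x) = I +> cscale A c x"
  "x \<in> carrier A \<Longrightarrow> star (cstar_quotient A I) (I +> x) = I +> star A x"
  "\<one>\<^bsub>cstar_quotient A I\<^esub> = I +> \<one>"
  "\<zero>\<^bsub>cstar_quotient A I\<^esub> = I +> \<zero>"
proof -
  show "x \<in> carrier A \<Longrightarrow> cscale (cstar_quotient A I) c (I +> x) = I +> cscale A c x"
    unfolding cstar_quotient_simps
    by (rule coset_map_rcos) (auto simp: cscale_add_right intro: cscale_ideal ideal_axioms dest: ideal_ne)
  show "x \<in> carrier A \<Longrightarrow> star (cstar_quotient A I) (I +> x) = I +> star A x"
    unfolding cstar_quotient_simps
    by (rule coset_map_rcos) (auto simp: star_add intro: star_ideal ideal_axioms dest: ideal_ne)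
qed (simp_all add: cstar_quotient_simps a_rcos_sum rcoset_mult_add a_rcos_const)

lemma rcos_zero_iff: "x \<in> carrier A \<Longrightarrow> I +> x = I +> \<zero> \<longleftrightarrow> x \<in> I"
  by (simp add: rcos_eq_iff a_minus_def)

lemma quotient_ring: "ring (cstar_quotient A I)"
  by (rule ring_cong[OF quotient_is_ring]) (simp_all add: cstar_quotient_simps FactRing_def)

lemma rcos_minus: "x \<in> carrier A \<Longrightarrow> y \<in> carrier A \<Longrightarrow>
    (I +> x) \<ominus>\<^bsub>cstar_quotient A I\<^esub> (I +> y) = I +> (x \<ominus> y)"
proof -
  assume x: "x \<in> carrier A" and y: "y \<in> carrier A"
  interpret Q: ring "cstar_quotient A I" by (rule quotient_ring)
  have "(I +> \<ominus> y) \<oplus>\<^bsub>cstar_quotient A I\<^esub> (I +> y) = \<zero>\<^bsub>cstar_quotient A I\<^esub>"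
    using y by (simp add: rcos_hom(1,6) l_neg)
  then have "\<ominus>\<^bsub>cstar_quotient A I\<^esub> (I +> y) = I +> \<ominus> y"
    using Q.minus_equality y by simp
  then show ?thesis using x y by (simp add: a_minus_def rcos_hom)
qed

section \<open>The quotient norm and completeness of the quotient\<close>

definition qnorm :: "'a \<Rightarrow> real" where "qnorm x = cnorm (cstar_quotient A I) (I +> x)"

lemma qnorm_eq: "qnorm x = (INF i\<in>I. cnorm A (i \<oplus> x))"
  by (simp add: qnorm_def cstar_quotient_simps rcos_image image_image)

lemma qnorm_le: "x \<in> carrier A \<Longrightarrow> i \<in> I \<Longrightarrow> qnorm x \<le> cnorm A (i \<oplus> x)"
  unfolding qnorm_eq by (rule cINF_lower) (auto intro!: bdd_belowI[of _ 0] cnorm_nonneg)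

lemma qnorm_greatest: "(\<And>i. i \<in> I \<Longrightarrow> r \<le> cnorm A (i \<oplus> x)) \<Longrightarrow> r \<le> qnorm x"
  unfolding qnorm_eq using additive_subgroup.zero_closed[OF is_additive_subgroup]
  by (intro cINF_greatest) blast+

lemma qnorm_less: "qnorm x < r \<Longrightarrow> \<exists>i\<in>I. cnorm A (i \<oplus> x) < r"
  using qnorm_greatest[of r x] by force

lemma qnorm_le_cnorm: "x \<in> carrier A \<Longrightarrow> qnorm x \<le> cnorm A x"
  using qnorm_le[of x \<zero>] by simp

lemma qnorm_nonneg: "x \<in> carrier A \<Longrightarrow> 0 \<le> qnorm x"
  by (rule qnorm_greatest) (simp add: cnorm_nonneg)

lemma qnorm_cong: "x \<in> carrier A \<Longrightarrow> y \<in> carrier A \<Longrightarrow> x \<ominus> y \<in> I \<Longrightarrow> qnorm x = qnorm y"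
  by (metis qnorm_def rcos_eq_iff)

lemma qnorm_star: assumes "x \<in> carrier A" shows "qnorm (star A x) = qnorm x"
proof -
  have "qnorm (star A y) \<le> qnorm y" if y: "y \<in> carrier A" for y
  proof (rule qnorm_greatest)
    fix i assume i: "i \<in> I"
    have "qnorm (star A y) \<le> cnorm A (star A i \<oplus> star A y)"
      by (rule qnorm_le) (use y i star_ideal in auto)
    also have "\<dots> = cnorm A (i \<oplus> y)" using i y by (simp flip: star_add)
    finally show "qnorm (star A y) \<le> cnorm A (i \<oplus> y)" .
  qed
  from this[of x] this[of "star A x"] assms show ?thesis by simp
qed

lemma qnorm_zero_iff: assumes x: "x \<in> carrier A" shows "qnorm x = 0 \<longleftrightarrow> x \<in> I"
proof
  assume x0: "qnorm x = 0"
  have "\<exists>i\<in>I. cnorm A (i \<oplus> x) < inverse (real (Suc n))" for n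
    by (rule qnorm_less) (simp add: x0)
  then obtain i where i: "\<And>n. i n \<in> I" "\<And>n. cnorm A (i n \<oplus> x) < inverse (real (Suc n))" by metis
  have "nlim (\<lambda>n. \<ominus> (i n)) x"
  proof (rule nlimI_bound[OF _ x _ LIMSEQ_inverse_real_of_nat])
    fix n
    have "\<ominus> (i n) \<ominus> x = \<ominus> (i n \<oplus> x)" using i(1)[of n] x by (simp add: a_minus_def minus_add)
    then show "cnorm A (\<ominus> (i n) \<ominus> x) \<le> inverse (real (Suc n))"
      using i[of n] x by simp
  qed (use i in simp)
  then show "x \<in> I"
    by (rule norm_closedD[rotated]) (use closed_ideal i(1) in \<open>auto simp: closed_ideal_def\<close>)
next
  assume "x \<in> I"
  then have "qnorm x = qnorm \<zero>" by (intro qnorm_cong) (auto simp: a_minus_def)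
  also have "\<dots> = 0" using qnorm_le_cnorm[of \<zero>] qnorm_nonneg[of \<zero>] by simp
  finally show "qnorm x = 0" .
qed

lemma qnorm_cscale: assumes x: "x \<in> carrier A" shows "qnorm (cscale A c x) = cmod c * qnorm x"
proof -
  have le: "qnorm (cscale A c y) \<le> cmod c * qnorm y" if y: "y \<in> carrier A" and c: "c \<noteq> 0" for c y
  proof -
    have "qnorm (cscale A c y) / cmod c \<le> qnorm y"
    proof (rule qnorm_greatest)
      fix i assume i: "i \<in> I"
      have "qnorm (cscale A c y) \<le> cnorm A (cscale A c i \<oplus> cscale A c y)"
        by (rule qnorm_le) (use y i cscale_ideal in auto)
      also have "\<dots> = cmod c * cnorm A (i \<oplus> y)" using i y by (simp flip: cscale_add_right add: cnorm_cscale)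
      finally show "qnorm (cscale A c y) / cmod c \<le> cnorm A (i \<oplus> y)" using c by (simp add: field_simps)
    qed
    then show ?thesis using c by (simp add: field_simps)
  qed
  show ?thesis
  proof (cases "c = 0")
    case False
    \<comment> \<open>The reverse inequality is the first one for the scalar \<open>1/c\<close>
      applied to the scaled element.\<close>
    have "qnorm (cscale A (1/c) (cscale A c x)) \<le> cmod (1/c) * qnorm (cscale A c x)"
      using False x by (intro le) auto
    then have "cmod c * qnorm x \<le> qnorm (cscale A c x)"
      using False x by (simp add: cscale_cscale norm_divide field_simps)
    then show ?thesis using le[OF x False] by simp
  qed (use x qnorm_zero_iff[of \<zero>] in simp)
qed

lemma qnorm_triangle: assumes x: "x \<in> carrier A" and y: "y \<in> carrier A"
  shows "qnorm (x \<oplus> y) \<le> qnorm x + qnorm y"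
proof (rule field_le_epsilon)
  fix e :: real assume "e > 0"
  obtain i where i: "i \<in> I" "cnorm A (i \<oplus> x) < qnorm x + e/2" using qnorm_less[of x "qnorm x + e/2"] \<open>e > 0\<close> by auto
  obtain j where j: "j \<in> I" "cnorm A (j \<oplus> y) < qnorm y + e/2" using qnorm_less[of y "qnorm y + e/2"] \<open>e > 0\<close> by auto
  have "qnorm (x \<oplus> y) \<le> cnorm A ((i \<oplus> j) \<oplus> (x \<oplus> y))" by (rule qnorm_le) (use x y i j in auto)
  also have "(i \<oplus> j) \<oplus> (x \<oplus> y) = (i \<oplus> x) \<oplus> (j \<oplus> y)" using x y i j by (simp add: a_ac)
  also have "cnorm A \<dots> \<le> cnorm A (i \<oplus> x) + cnorm A (j \<oplus> y)" by (rule cnorm_triangle) (use x y i j in auto)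
  finally show "qnorm (x \<oplus> y) \<le> qnorm x + qnorm y + e" using i j by simp
qed

text \<open>The product of representatives \<open>i + x\<close> and \<open>j + y\<close> represents
  the product of the cosets. Both factors carry an error \<open>e\<close>, so the estimate is taken
  to the limit \<open>e \<rightarrow> 0\<close> from the right.\<close>

lemma qnorm_mult: assumes x: "x \<in> carrier A" and y: "y \<in> carrier A"
  shows "qnorm (x \<otimes> y) \<le> qnorm x * qnorm y"
proof (rule tendsto_lowerbound)
  show "((\<lambda>e. (qnorm x + e) * (qnorm y + e)) \<longlongrightarrow> qnorm x * qnorm y) (at_right 0)"
    by (rule tendsto_eq_intros | simp)+
  show "\<forall>\<^sub>F e in at_right 0. qnorm (x \<otimes> y) \<le> (qnorm x + e) * (qnorm y + e)"
    unfolding eventually_at_right[OF zero_less_one]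
  proof (intro exI[of _ 1] conjI allI impI)
    fix e :: real assume "e > 0"
    obtain i where i: "i \<in> I" "cnorm A (i \<oplus> x) < qnorm x + e" using qnorm_less[of x "qnorm x + e"] \<open>e > 0\<close> by auto
    obtain j where j: "j \<in> I" "cnorm A (j \<oplus> y) < qnorm y + e" using qnorm_less[of y "qnorm y + e"] \<open>e > 0\<close> by auto
    have "qnorm (x \<otimes> y) \<le> cnorm A ((i \<otimes> (j \<oplus> y) \<oplus> x \<otimes> j) \<oplus> x \<otimes> y)"
      by (rule qnorm_le) (use x y i j I_l_closed I_r_closed in auto)
    also have "(i \<otimes> (j \<oplus> y) \<oplus> x \<otimes> j) \<oplus> x \<otimes> y = (i \<oplus> x) \<otimes> (j \<oplus> y)"
      using x y i j by (simp add: l_distr r_distr a_ac)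
    also have "cnorm A \<dots> \<le> cnorm A (i \<oplus> x) * cnorm A (j \<oplus> y)" by (rule cnorm_mult) (use x y i j in auto)
    also have "\<dots> \<le> (qnorm x + e) * (qnorm y + e)"
      using i j x y \<open>e > 0\<close> qnorm_nonneg[OF x] cnorm_nonneg[of "j \<oplus> y"]
      by (intro mult_mono) (auto intro: less_imp_le)
    finally show "qnorm (x \<otimes> y) \<le> (qnorm x + e) * (qnorm y + e)" .
  qed simp
qed simp

text \<open>An approximate unit \<open>1 - e\<close> of the ideal absorbs any \<open>i\<close>, so \<open>\<parallel>x e\<parallel>\<close> is almost the
  quotient norm, and the C*-identity passes to the quotient.\<close>

lemma qnorm_cstar: assumes x: "x \<in> carrier A"
  shows "qnorm (star A x \<otimes> x) = (qnorm x)\<^sup>2"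
proof (rule antisym)
  show "qnorm (star A x \<otimes> x) \<le> (qnorm x)\<^sup>2"
    using qnorm_mult[of "star A x" x] x qnorm_star[OF x] by (simp add: power2_eq_square)
  show "(qnorm x)\<^sup>2 \<le> qnorm (star A x \<otimes> x)"
  proof (rule qnorm_greatest)
    fix i assume i: "i \<in> I"
    let ?y = "star A x \<otimes> x" and ?k = "star A i \<otimes> i"
    have ic: "i \<in> carrier A" using i by simp
    show "(qnorm x)\<^sup>2 \<le> cnorm A (i \<oplus> ?y)"
    proof (rule field_le_epsilon)
      fix d :: real assume "d > 0"
      have k: "?k \<in> carrier A" "star A ?k = ?k" "?k \<in> I" using i ic I_l_closed by (simp_all add: star_mult)
      obtain e where e: "e \<in> carrier A" "star A e = e" "cnorm A e \<le> 1" "cnorm A (e \<otimes> ?k \<otimes> e) < d\<^sup>2" "\<one> \<ominus> e \<in> I"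
        using approximate_unit[OF k(1,2), of "d\<^sup>2"] k(3) ideal_axioms \<open>d > 0\<close> by fastforce
      have "(cnorm A (i \<otimes> e))\<^sup>2 = cnorm A (e \<otimes> ?k \<otimes> e)"
        using cstar_identity[of "i \<otimes> e"] e(1,2) ic by (simp add: star_mult m_assoc)
      then have ie: "cnorm A (i \<otimes> e) < d"
        using power_less_imp_less_base[of "cnorm A (i \<otimes> e)" 2 d] e(4) \<open>d > 0\<close> by simp
      \<comment> \<open>Since \<open>1 - e\<close> lies in the ideal, the product of
        \<open>x\<close> with \<open>e\<close> represents the coset of \<open>x\<close>.\<close>
      have "qnorm x \<le> cnorm A (\<ominus> (x \<otimes> (\<one> \<ominus> e)) \<oplus> x)"
        by (rule qnorm_le) (use x e I_l_closed in auto)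
      also have "\<ominus> (x \<otimes> (\<one> \<ominus> e)) \<oplus> x = x \<otimes> e"
        using x e(1) by (simp add: r_diff_distr) (simp add: a_minus_def minus_add a_ac r_neg1 r_neg2)
      finally have "(qnorm x)\<^sup>2 \<le> (cnorm A (x \<otimes> e))\<^sup>2" using qnorm_nonneg[OF x] by (simp add: power_mono)
      also have "\<dots> = cnorm A (e \<otimes> (?y \<otimes> e))"
        using cstar_identity[of "x \<otimes> e"] e(1,2) x by (simp add: star_mult m_assoc)
      also have "\<dots> \<le> cnorm A e * cnorm A (?y \<otimes> e)" by (rule cnorm_mult) (use x e in auto)
      also have "\<dots> \<le> cnorm A (?y \<otimes> e)"
        using e cnorm_nonneg[of e] cnorm_nonneg[of "?y \<otimes> e"] x by (intro mult_left_le_one_le) auto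
      also have "?y \<otimes> e = (i \<oplus> ?y) \<otimes> e \<ominus> i \<otimes> e"
        using x e(1) ic by (simp add: l_distr a_minus_def a_ac r_neg1 r_neg2 r_neg)
      also have "cnorm A \<dots> \<le> cnorm A ((i \<oplus> ?y) \<otimes> e) + cnorm A (i \<otimes> e)"
        by (rule cnorm_diff_triangle) (use x e ic in auto)
      also have "cnorm A ((i \<oplus> ?y) \<otimes> e) \<le> cnorm A (i \<oplus> ?y) * cnorm A e" by (rule cnorm_mult) (use x e ic in auto)
      also have "\<dots> \<le> cnorm A (i \<oplus> ?y)"
        using e cnorm_nonneg[of e] cnorm_nonneg[of "i \<oplus> ?y"] x ic by (intro mult_right_le_one_le) auto
      finally show "(qnorm x)\<^sup>2 \<le> cnorm A (i \<oplus> ?y) + d" using ie by simp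
    qed
  qed
qed

text \<open>A coset close to that of \<open>y\<close> has a representative close to \<open>y\<close>
  itself. This lifts a sequence of cosets term by term while keeping its increments small.\<close>

lemma quotient_lift:
  assumes y: "y \<in> carrier A" and X: "X \<in> carrier (cstar_quotient A I)"
    and lt: "cnorm (cstar_quotient A I) (X \<ominus>\<^bsub>cstar_quotient A I\<^esub> (I +> y)) < r"
  shows "\<exists>x\<in>carrier A. I +> x = X \<and> cnorm A (x \<ominus> y) < r"
proof -
  obtain x where x: "x \<in> carrier A" "X = I +> x" using X rcos_cases by blast
  have "qnorm (x \<ominus> y) < r" using lt x y by (simp add: rcos_minus qnorm_def)
  then obtain i where i: "i \<in> I" "cnorm A (i \<oplus> (x \<ominus> y)) < r" using qnorm_less by blast
  have "i \<oplus> x \<ominus> x = i" "i \<oplus> x \<ominus> y = i \<oplus> (x \<ominus> y)"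
    using i x y by (simp_all add: a_minus_def a_assoc r_neg)
  then show ?thesis using i x y by (intro bexI[of _ "i \<oplus> x"]) (simp_all add: rcos_eq_iff)
qed

text \<open>A subsequence with increments below powers of 1/2 lifts to a Cauchy sequence in
  \<open>A\<close>; the coset of the limit attracts the subsequence and hence the whole Cauchy
  sequence.\<close>

lemma quotient_complete:
  assumes X: "\<And>n::nat. X n \<in> carrier (cstar_quotient A I)"
    and cauchy: "\<And>e. e > 0 \<Longrightarrow> \<exists>N. \<forall>m\<ge>N. \<forall>n\<ge>N. cnorm (cstar_quotient A I) (X m \<ominus>\<^bsub>cstar_quotient A I\<^esub> X n) < e"
  shows "\<exists>x\<in>carrier (cstar_quotient A I). (\<lambda>n. cnorm (cstar_quotient A I) (X n \<ominus>\<^bsub>cstar_quotient A I\<^esub> x)) \<longlonglongrightarrow> 0"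
proof -
  let ?Q = "cstar_quotient A I"
  have "\<exists>N. \<forall>k. \<forall>m\<ge>N k. \<forall>n\<ge>N k. cnorm ?Q (X m \<ominus>\<^bsub>?Q\<^esub> X n) < (1/2)^k"
    using cauchy[of "(1/2)^_"] by (intro choice) auto
  then obtain N where N: "\<And>k m n. m \<ge> N k \<Longrightarrow> n \<ge> N k \<Longrightarrow> cnorm ?Q (X m \<ominus>\<^bsub>?Q\<^esub> X n) < (1/2)^k" by blast
  \<comment> \<open>Summation makes the indices monotone while keeping them above the thresholds
    \<open>N\<close>.\<close>
  define M where "M k = (\<Sum>j\<le>k. N j)" for k
  have MN: "N k \<le> M k" and Mmono: "M k \<le> M (Suc k)" for k
    unfolding M_def by (auto intro: member_le_sum)
  have "\<exists>y. \<forall>k. (y k \<in> carrier A \<and> I +> y k = X (M k)) \<and> cnorm A (y (Suc k) \<ominus> y k) < (1/2)^k"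
  proof (rule dependent_nat_choice)
    show "\<exists>x. x \<in> carrier A \<and> I +> x = X (M 0)" using X[of "M 0"] rcos_cases by metis
    fix x k assume x: "x \<in> carrier A \<and> I +> x = X (M k)"
    have "cnorm ?Q (X (M (Suc k)) \<ominus>\<^bsub>?Q\<^esub> X (M k)) < (1/2)^k"
      using N[of k] MN[of k] Mmono[of k] by simp
    then show "\<exists>y. (y \<in> carrier A \<and> I +> y = X (M (Suc k))) \<and> cnorm A (y \<ominus> x) < (1/2)^k"
      using quotient_lift[of x "X (M (Suc k))" "(1/2)^k"] x X by auto
  qed
  then obtain y where y: "\<And>k. y k \<in> carrier A" "\<And>k. I +> y k = X (M k)"
    "\<And>k. cnorm A (y (Suc k) \<ominus> y k) < (1/2)^k" by blast
  \<comment> \<open>The bound is the exact partial sum of the geometric series, so that the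
    induction closes; dropping the last factor then gives a bound uniform in
    \<open>k\<close>.\<close>
  have tail: "cnorm A (y (n + k) \<ominus> y n) \<le> 2 * (1/2)^n * (1 - (1/2)^k)" for n k
  proof (induction k)
    case 0
    then show ?case using y by simp
  next
    case (Suc k)
    have "cnorm A (y (n + Suc k) \<ominus> y n) \<le> cnorm A (y (Suc (n + k)) \<ominus> y (n + k)) + cnorm A (y (n + k) \<ominus> y n)"
      using cnorm_diff_trans[of "y (Suc (n + k))" "y (n + k)" "y n"] y(1) by simp
    also have "\<dots> \<le> (1/2)^(n + k) + 2 * (1/2)^n * (1 - (1/2)^k)"
      using Suc y(3)[of "n + k"] by simp
    also have "\<dots> = 2 * (1/2)^n * (1 - (1/2)^Suc k)" by (simp add: power_add algebra_simps)
    finally show ?case .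
  qed
  have tail': "cnorm A (y m \<ominus> y n) \<le> 2 * (1/2)^n" if "m \<ge> n" for m n
  proof -
    have "cnorm A (y m \<ominus> y n) \<le> 2 * (1/2)^n * (1 - (1/2)^(m - n))" using tail[of n "m - n"] that by simp
    also have "\<dots> \<le> 2 * (1/2)^n * 1" by (rule mult_left_mono) auto
    finally show ?thesis by simp
  qed
  have "\<exists>z. nlim y z"
  proof (rule nlim_exists)
    fix e :: real assume e: "e > 0"
    obtain K where K: "(1/2)^K < e/2" using real_arch_pow_inv[of "e/2" "1/2"] e by auto
    have le: "cnorm A (y m \<ominus> y n) < e" if "n \<ge> K" "m \<ge> n" for m n
    proof -
      have "(1/2::real)^n \<le> (1/2)^K" using that by (intro power_decreasing) auto
      then show ?thesis using tail'[OF that(2)] K by linarith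
    qed
    have "cnorm A (y m \<ominus> y n) < e" if "n \<ge> K" "m \<ge> K" for m n
      using le[of n m] le[of m n] that cnorm_diff_commute[of "y m" "y n"] y(1) by (cases "m \<ge> n") auto
    then show "\<exists>N. \<forall>m\<ge>N. \<forall>n\<ge>N. cnorm A (y m \<ominus> y n) < e" by blast
  qed (rule y(1))
  then obtain z where z: "nlim y z" by blast
  note zc = nlimD(2)[OF z]
  have "(\<lambda>n. cnorm ?Q (X n \<ominus>\<^bsub>?Q\<^esub> (I +> z))) \<longlonglongrightarrow> 0"
  proof (rule LIMSEQ_I)
    fix e :: real assume e: "e > 0"
    obtain k1 where k1: "\<And>k. k \<ge> k1 \<Longrightarrow> cnorm A (y k \<ominus> z) < e/2"
      using order_tendstoD(2)[OF nlimD(3)[OF z], of "e/2"] e unfolding eventually_sequentially by auto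
    obtain k2 where k2: "(1/2)^k2 < e/2" using real_arch_pow_inv[of "e/2" "1/2"] e by auto
    define k where "k = max k1 k2"
    have "(1/2::real)^k \<le> (1/2)^k2" unfolding k_def by (rule power_decreasing) auto
    then have k: "(1/2)^k < e/2" using k2 by linarith
    have k': "cnorm A (y k \<ominus> z) < e/2" using k1[of k] by (simp add: k_def)
    have "norm (cnorm ?Q (X n \<ominus>\<^bsub>?Q\<^esub> (I +> z)) - 0) < e" if n: "n \<ge> M k" for n
    proof -
      obtain x where x: "x \<in> carrier A" "X n = I +> x" using X rcos_cases by metis
      have "qnorm (x \<ominus> y k) < (1/2)^k"
        using N[of k n "M k"] MN[of k] n x y(1) by (simp add: y(2)[symmetric] rcos_minus qnorm_def)
      moreover have "qnorm (x \<ominus> z) \<le> qnorm (x \<ominus> y k) + qnorm (y k \<ominus> z)"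
      proof -
        have "x \<ominus> z = (x \<ominus> y k) \<oplus> (y k \<ominus> z)" using x(1) y(1)[of k] zc by algebra
        then show ?thesis using qnorm_triangle x(1) y(1) zc by simp
      qed
      moreover have "qnorm (y k \<ominus> z) \<le> cnorm A (y k \<ominus> z)" using qnorm_le_cnorm y(1) zc by simp
      ultimately have "qnorm (x \<ominus> z) < e" using k k' by linarith
      then show ?thesis using x zc qnorm_nonneg[of "x \<ominus> z"] by (simp add: rcos_minus qnorm_def)
    qed
    then show "\<exists>no. \<forall>n\<ge>no. norm (cnorm ?Q (X n \<ominus>\<^bsub>?Q\<^esub> (I +> z)) - 0) < e" by blast
  qed
  then show ?thesis using zc by auto
qed

lemma quotient_cstar: "unital_cstar_algebra (cstar_quotient A I)"
proof (intro unital_cstar_algebra.intro quotient_ring unital_cstar_algebra_axioms.intro)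
  show "\<And>X. (\<And>n::nat. X n \<in> carrier (cstar_quotient A I)) \<Longrightarrow>
    (\<And>e. e > 0 \<Longrightarrow> \<exists>N. \<forall>m\<ge>N. \<forall>n\<ge>N. cnorm (cstar_quotient A I) (X m \<ominus>\<^bsub>cstar_quotient A I\<^esub> X n) < e) \<Longrightarrow>
    \<exists>x\<in>carrier (cstar_quotient A I). (\<lambda>n. cnorm (cstar_quotient A I) (X n \<ominus>\<^bsub>cstar_quotient A I\<^esub> x)) \<longlonglongrightarrow> 0"
    by (rule quotient_complete) auto
  show "cnorm (cstar_quotient A I) X = 0 \<longleftrightarrow> X = \<zero>\<^bsub>cstar_quotient A I\<^esub>"
    if "X \<in> carrier (cstar_quotient A I)" for X
    using that by (elim rcos_cases) (simp add: rcos_hom rcos_zero_iff qnorm_zero_iff flip: qnorm_def)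
qed (auto elim!: rcos_cases simp: rcos_hom cscale_add_right cscale_add_left cscale_cscale cscale_mult_left
    cscale_mult_right star_add star_mult star_cscale rcos_zero_iff qnorm_zero_iff
    qnorm_nonneg qnorm_cscale qnorm_triangle qnorm_mult qnorm_cstar simp flip: qnorm_def)

lemma rcos_unital_star_hom: "unital_star_hom A (cstar_quotient A I) ((+>) I)"
  unfolding unital_star_hom_def by (intro conjI star_homI) (simp_all add: rcos_hom)

lemma star_hom_factor:
  assumes D: "unital_cstar_algebra D" and f: "star_hom A D f" and fI: "\<And>i. i \<in> I \<Longrightarrow> f i = \<zero>\<^bsub>D\<^esub>"
  shows "\<exists>F. star_hom (cstar_quotient A I) D F \<and> (\<forall>x\<in>carrier A. F (I +> x) = f x)"
proof -
  interpret D: unital_cstar_algebra D by fact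
  note fD = star_homD[OF f]
  define F where "F X = f (SOME x. x \<in> carrier A \<and> X = I +> x)" for X
  have F: "F (I +> x) = f x" if x: "x \<in> carrier A" for x
  proof -
    define y where "y = (SOME y. y \<in> carrier A \<and> I +> x = I +> y)"
    have "y \<in> carrier A \<and> I +> x = I +> y" unfolding y_def by (rule someI[of _ x]) (use x in simp)
    then have y: "y \<in> carrier A" "x \<ominus> y \<in> I" using x rcos_eq_iff[of x y] by auto
    have "f x \<ominus>\<^bsub>D\<^esub> f y = \<zero>\<^bsub>D\<^esub>"
      using fI[OF y(2)] star_hom_diff[OF unital_cstar_algebra_axioms D f x y(1)] by simp
    then show ?thesis using D.diff_eq_zero fD(1) x y(1) by (simp add: F_def y_def)
  qed
  have "star_hom (cstar_quotient A I) D F"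
    by (rule star_homI) (auto elim!: rcos_cases simp: rcos_hom F fD)
  then show ?thesis using F by blast
qed

end

section \<open>Subalgebras\<close>

lemma cstar_subalgebraD:
  assumes "cstar_subalgebra A S"
  shows "S \<subseteq> carrier A" "\<zero>\<^bsub>A\<^esub> \<in> S" "x \<in> S \<Longrightarrow> y \<in> S \<Longrightarrow> x \<oplus>\<^bsub>A\<^esub> y \<in> S"
    "x \<in> S \<Longrightarrow> y \<in> S \<Longrightarrow> x \<otimes>\<^bsub>A\<^esub> y \<in> S" "x \<in> S \<Longrightarrow> cscale A c x \<in> S"
    "x \<in> S \<Longrightarrow> star A x \<in> S" "norm_closed A S"
  using assms by (auto simp: cstar_subalgebra_def)

lemma cstar_subalgebraI:
  assumes "S \<subseteq> carrier A" "\<zero>\<^bsub>A\<^esub> \<in> S" "\<And>x y. x \<in> S \<Longrightarrow> y \<in> S \<Longrightarrow> x \<oplus>\<^bsub>A\<^esub> y \<in> S"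
    "\<And>x y. x \<in> S \<Longrightarrow> y \<in> S \<Longrightarrow> x \<otimes>\<^bsub>A\<^esub> y \<in> S" "\<And>c x. x \<in> S \<Longrightarrow> cscale A c x \<in> S"
    "\<And>x. x \<in> S \<Longrightarrow> star A x \<in> S" "norm_closed A S"
  shows "cstar_subalgebra A S"
  using assms by (auto simp: cstar_subalgebra_def)

lemma cstar_generated_superset: "X \<subseteq> cstar_generated A X"
  by (auto simp: cstar_generated_def)

lemma cstar_generated_least: "cstar_subalgebra A S \<Longrightarrow> X \<subseteq> S \<Longrightarrow> cstar_generated A X \<subseteq> S"
  by (auto simp: cstar_generated_def)

context unital_cstar_algebra
begin

lemma cstar_subalgebra_carrier: "cstar_subalgebra A (carrier A)"
  by (rule cstar_subalgebraI) (auto simp: norm_closed_def)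

lemma cstar_subalgebra_generated:
  assumes "X \<subseteq> carrier A" shows "cstar_subalgebra A (cstar_generated A X)"
proof (rule cstar_subalgebraI)
  let ?F = "{S. cstar_subalgebra A S \<and> X \<subseteq> S}"
  have G: "cstar_generated A X = \<Inter>?F" by (simp add: cstar_generated_def)
  show sub: "cstar_generated A X \<subseteq> carrier A"
    by (rule cstar_generated_least[OF cstar_subalgebra_carrier assms])
  show "norm_closed A (cstar_generated A X)"
  proof (rule norm_closedI[OF _ sub])
    fix Y y assume Y: "nlim Y y" "\<And>n. Y n \<in> cstar_generated A X"
    show "y \<in> cstar_generated A X"
      unfolding G using Y norm_closedD[OF cstar_subalgebraD(7) Y(1)] by (auto simp: G)
  qed
qed (auto simp: cstar_generated_def cstar_subalgebraD)

lemma subalgebra_minus: "cstar_subalgebra A S \<Longrightarrow> x \<in> S \<Longrightarrow> \<ominus> x \<in> S"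
  using minus_eq_cscale cstar_subalgebraD(1,5) by (metis subsetD)

lemma subalgebra_diff: "cstar_subalgebra A S \<Longrightarrow> x \<in> S \<Longrightarrow> y \<in> S \<Longrightarrow> x \<ominus> y \<in> S"
  unfolding a_minus_def by (intro cstar_subalgebraD(3) subalgebra_minus)

lemma subalgebra_ring: assumes S: "cstar_subalgebra A S" "\<one> \<in> S" shows "ring (A\<lparr>carrier := S\<rparr>)"
proof -
  have c: "x \<in> S \<Longrightarrow> x \<in> carrier A" for x using cstar_subalgebraD(1)[OF S(1)] by blast
  show ?thesis
  proof (intro ringI abelian_groupI monoidI)
    fix x assume "x \<in> carrier (A\<lparr>carrier := S\<rparr>)"
    then show "\<exists>y\<in>carrier (A\<lparr>carrier := S\<rparr>). y \<oplus>\<^bsub>A\<lparr>carrier := S\<rparr>\<^esub> x = \<zero>\<^bsub>A\<lparr>carrier := S\<rparr>\<^esub>"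
      using subalgebra_minus[OF S(1), of x] c l_neg by auto
  qed (auto simp: S cstar_subalgebraD[OF S(1)] c m_assoc a_ac l_distr r_distr)
qed

lemma subalgebra_a_minus:
  assumes S: "cstar_subalgebra A S" "\<one> \<in> S" and xy: "x \<in> S" "y \<in> S"
  shows "x \<ominus>\<^bsub>A\<lparr>carrier := S\<rparr>\<^esub> y = x \<ominus> y"
proof -
  interpret R: ring "A\<lparr>carrier := S\<rparr>" by (rule subalgebra_ring[OF S])
  have "y \<in> carrier A" using xy cstar_subalgebraD(1)[OF S(1)] by blast
  then have "\<ominus> y \<oplus>\<^bsub>A\<lparr>carrier := S\<rparr>\<^esub> y = \<zero>\<^bsub>A\<lparr>carrier := S\<rparr>\<^esub>" by (simp add: l_neg)
  then have "\<ominus>\<^bsub>A\<lparr>carrier := S\<rparr>\<^esub> y = \<ominus> y"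
    using R.minus_equality[of "\<ominus> y" y] xy subalgebra_minus[OF S(1)] by simp
  then show ?thesis by (simp add: a_minus_def)
qed

lemma subalgebra_cstar: assumes S: "cstar_subalgebra A S" "\<one> \<in> S"
  shows "unital_cstar_algebra (A\<lparr>carrier := S\<rparr>)"
proof -
  have c: "x \<in> S \<Longrightarrow> x \<in> carrier A" for x using cstar_subalgebraD(1)[OF S(1)] by blast
  show ?thesis
  proof (intro unital_cstar_algebra.intro subalgebra_ring S unital_cstar_algebra_axioms.intro)
    fix X :: "nat \<Rightarrow> 'a"
    assume X: "\<And>n. X n \<in> carrier (A\<lparr>carrier := S\<rparr>)"
      and cauchy: "\<And>e. e > 0 \<Longrightarrow>
        \<exists>N. \<forall>m\<ge>N. \<forall>n\<ge>N. cnorm (A\<lparr>carrier := S\<rparr>) (X m \<ominus>\<^bsub>A\<lparr>carrier := S\<rparr>\<^esub> X n) < e"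
    have XS: "X n \<in> S" for n using X by simp
    have "\<exists>x. nlim X x"
      by (rule nlim_exists) (use XS c cauchy in \<open>simp_all add: subalgebra_a_minus[OF S]\<close>)
    then obtain x where x: "nlim X x" by blast
    then have "x \<in> S" by (rule norm_closedD[OF cstar_subalgebraD(7)[OF S(1)]]) (rule XS)
    then show "\<exists>x\<in>carrier (A\<lparr>carrier := S\<rparr>). (\<lambda>n. cnorm (A\<lparr>carrier := S\<rparr>) (X n \<ominus>\<^bsub>A\<lparr>carrier := S\<rparr>\<^esub> x)) \<longlonglongrightarrow> 0"
      using nlimD(3)[OF x] XS by (intro bexI[of _ x]) (simp_all add: subalgebra_a_minus[OF S])
  qed (simp_all add: cstar_subalgebraD[OF S(1)] c cscale_add_right cscale_add_left cscale_cscale cscale_mult_left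
      cscale_mult_right star_add star_cscale star_mult cnorm_nonneg cnorm_eq_0_iff cnorm_cscale cnorm_triangle
      cnorm_mult cstar_identity)
qed

text \<open>As \<open>S\<close> is itself closed, a limit in \<open>A\<close> of a sequence from
  \<open>T\<close> already lies in \<open>S\<close>, so both notions test the same limits.\<close>

lemma norm_closed_subalgebra:
  assumes S: "cstar_subalgebra A S" "\<one> \<in> S" and T: "T \<subseteq> S"
  shows "norm_closed (A\<lparr>carrier := S\<rparr>) T \<longleftrightarrow> norm_closed A T"
proof -
  have TS: "x \<in> S" if "\<And>n::nat. X n \<in> T" "x \<in> carrier A" "(\<lambda>n. cnorm A (X n \<ominus> x)) \<longlonglongrightarrow> 0" for X x
    using cstar_subalgebraD(7)[OF S(1)] that T unfolding norm_closed_def by blast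
  have eq: "X n \<ominus>\<^bsub>A\<lparr>carrier := S\<rparr>\<^esub> x = X n \<ominus> x" if "X n \<in> T" "x \<in> S" for X :: "nat \<Rightarrow> 'a" and n x
    using subalgebra_a_minus[OF S] that T by blast
  have "S \<subseteq> carrier A" using cstar_subalgebraD(1)[OF S(1)] .
  then show ?thesis
    unfolding norm_closed_def using TS eq by (simp cong: conj_cong) blast
qed

section \<open>Norm closures\<close>

definition ncl :: "'a set \<Rightarrow> 'a set" where "ncl S = {x. \<exists>X. nlim X x \<and> (\<forall>n. X n \<in> S)}"

lemma ncl_iff:
  assumes "S \<subseteq> carrier A"
  shows "x \<in> ncl S \<longleftrightarrow> x \<in> carrier A \<and> (\<forall>e>0. \<exists>y\<in>S. cnorm A (y \<ominus> x) < e)"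
proof safe
  assume "x \<in> ncl S"
  then obtain X where X: "nlim X x" "\<And>n. X n \<in> S" by (auto simp: ncl_def)
  show "x \<in> carrier A" using nlimD(2)[OF X(1)] .
  fix e :: real assume "e > 0"
  then have "\<forall>\<^sub>F n in sequentially. cnorm A (X n \<ominus> x) < e" using order_tendstoD(2)[OF nlimD(3)[OF X(1)]] by blast
  then obtain n where "cnorm A (X n \<ominus> x) < e" unfolding eventually_sequentially by blast
  then show "\<exists>y\<in>S. cnorm A (y \<ominus> x) < e" using X(2) by blast
next
  assume x: "x \<in> carrier A" and *: "\<forall>e>0. \<exists>y\<in>S. cnorm A (y \<ominus> x) < e"
  have "\<exists>y\<in>S. cnorm A (y \<ominus> x) < inverse (real (Suc n))" for n using * by simp
  then obtain X where X: "\<And>n. X n \<in> S" "\<And>n. cnorm A (X n \<ominus> x) < inverse (real (Suc n))" by metis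
  have "nlim X x"
    by (rule nlimI_bound[OF _ x _ LIMSEQ_inverse_real_of_nat]) (use X assms in \<open>auto intro: less_imp_le\<close>)
  then show "x \<in> ncl S" using X(1) by (auto simp: ncl_def)
qed

lemma subset_ncl: "S \<subseteq> carrier A \<Longrightarrow> S \<subseteq> ncl S"
  unfolding ncl_def using nlim_const by (intro subsetI CollectI exI[of _ "\<lambda>_. _"] conjI allI) blast+

lemma ncl_subset: "norm_closed A T \<Longrightarrow> S \<subseteq> T \<Longrightarrow> ncl S \<subseteq> T"
  unfolding ncl_def using norm_closedD by blast

lemma cstar_subalgebra_ncl:
  assumes S: "S \<subseteq> carrier A" "\<zero> \<in> S" "\<And>x y. x \<in> S \<Longrightarrow> y \<in> S \<Longrightarrow> x \<oplus> y \<in> S"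
    "\<And>x y. x \<in> S \<Longrightarrow> y \<in> S \<Longrightarrow> x \<otimes> y \<in> S" "\<And>c x. x \<in> S \<Longrightarrow> cscale A c x \<in> S"
    "\<And>x. x \<in> S \<Longrightarrow> star A x \<in> S"
  shows "cstar_subalgebra A (ncl S)"
proof (rule cstar_subalgebraI)
  show c: "ncl S \<subseteq> carrier A" unfolding ncl_def using nlimD(2) by blast
  show "\<zero> \<in> ncl S" using subset_ncl[OF S(1)] S(2) by blast
  show "norm_closed A (ncl S)"
  proof (rule norm_closedI[OF _ c])
    fix X x assume X: "nlim X x" "\<And>n. X n \<in> ncl S"
    show "x \<in> ncl S"
      unfolding ncl_iff[OF S(1)]
    proof (intro conjI allI impI)
      show xc: "x \<in> carrier A" using nlimD(2)[OF X(1)] .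
      fix e :: real assume e: "e > 0"
      then have "\<forall>\<^sub>F n in sequentially. cnorm A (X n \<ominus> x) < e/2" using order_tendstoD(2)[OF nlimD(3)[OF X(1)], of "e/2"] by simp
      then obtain n where n: "cnorm A (X n \<ominus> x) < e/2" unfolding eventually_sequentially by blast
      have "e/2 > 0" using e by simp
      then have "\<exists>y\<in>S. cnorm A (y \<ominus> X n) < e/2" using X(2)[of n] unfolding ncl_iff[OF S(1)] by blast
      then obtain y where y: "y \<in> S" "cnorm A (y \<ominus> X n) < e/2" by blast
      have "cnorm A (y \<ominus> x) \<le> cnorm A (y \<ominus> X n) + cnorm A (X n \<ominus> x)"
        by (rule cnorm_diff_trans) (use y S(1) nlimD(1)[OF X(1)] xc in auto)
      then show "\<exists>y\<in>S. cnorm A (y \<ominus> x) < e" using y n by (intro bexI[of _ y]) auto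
    qed
  qed
  fix x assume "x \<in> ncl S"
  then obtain X where X: "nlim X x" "\<And>n. X n \<in> S" by (auto simp: ncl_def)
  show "cscale A k x \<in> ncl S" for k
    unfolding ncl_def using nlim_cscale[OF X(1), of k] S(5)[OF X(2)] by blast
  show "star A x \<in> ncl S"
    unfolding ncl_def using nlim_star[OF X(1)] S(6)[OF X(2)] by blast
  fix y assume "y \<in> ncl S"
  then obtain Y where Y: "nlim Y y" "\<And>n. Y n \<in> S" by (auto simp: ncl_def)
  show "x \<oplus> y \<in> ncl S"
    unfolding ncl_def using nlim_add[OF X(1) Y(1)] S(3)[OF X(2) Y(2)] by blast
  show "x \<otimes> y \<in> ncl S"
    unfolding ncl_def using nlim_mult[OF X(1) Y(1)] S(4)[OF X(2) Y(2)] by blast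
qed

end

section \<open>Bounded operators\<close>

text \<open>The representing vector minimises \<open>\<parallel>x\<parallel>\<^sup>2 / 2 - f x\<close>; minimising sequences are Cauchy by the
  parallelogram law.\<close>

lemma riesz_representation:
  fixes f :: "'a::{real_inner, complete_space} \<Rightarrow> real"
  assumes "bounded_linear f"
  shows "\<exists>v. \<forall>x. f x = inner v x"
proof -
  interpret f: bounded_linear f by fact
  obtain K where K: "\<And>x. norm (f x) \<le> norm x * K" using f.bounded by blast
  define J where "J x = (norm x)\<^sup>2 / 2 - f x" for x
  have lower: "- K\<^sup>2 / 2 \<le> J x" for x
  proof -
    have "0 \<le> (norm x - K)\<^sup>2" by simp
    then show ?thesis using K[of x] by (simp add: J_def power2_eq_square algebra_simps)
  qed
  define m where "m = (INF x. J x)"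
  have bdd: "bdd_below (range J)" using lower by (auto intro!: bdd_belowI)
  have mle: "m \<le> J x" for x unfolding m_def by (rule cINF_lower[OF bdd]) simp
  have "\<exists>x. J x < m + inverse (real (Suc n))" for n
    using cINF_less_iff[OF _ bdd, of "m + inverse (real (Suc n))"] by (auto simp: m_def)
  then obtain X where X: "\<And>n. J (X n) < m + inverse (real (Suc n))" by metis
  have par: "(norm (x - y))\<^sup>2 / 4 = J x + J y - 2 * J ((1/2) *\<^sub>R (x + y))" for x y
    by (simp add: J_def power2_norm_eq_inner f.scaleR f.add inner_simps inner_commute field_simps)
  have dist: "(norm (X i - X j))\<^sup>2 \<le> 4 * (inverse (real (Suc i)) + inverse (real (Suc j)))" for i j
  proof -
    have "n \<le> 4 * (a + b)" if "n / 4 = p + q - 2 * r" "p < m + a" "q < m + b" "m \<le> r" for n a b p q r :: real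
      using that by simp
    from this[OF par X X mle] show ?thesis .
  qed
  have "Cauchy X"
  proof (rule CauchyI)
    fix e :: real assume e: "e > 0"
    then obtain N where N: "inverse (real (Suc N)) < e\<^sup>2 / 8" using reals_Archimedean[of "e\<^sup>2/8"] by auto
    have "norm (X i - X j) < e" if "i \<ge> N" "j \<ge> N" for i j
    proof -
      have "inverse (real (Suc i)) \<le> inverse (real (Suc N))" "inverse (real (Suc j)) \<le> inverse (real (Suc N))"
        using that by (simp_all add: le_imp_inverse_le)
      then have "(norm (X i - X j))\<^sup>2 < e\<^sup>2" using dist[of i j] N by argo
      then show ?thesis using e by (simp add: power_less_imp_less_base)
    qed
    then show "\<exists>M. \<forall>m\<ge>M. \<forall>n\<ge>M. norm (X m - X n) < e" by blast
  qed
  then obtain v where v: "X \<longlonglongrightarrow> v" using Cauchy_convergent convergent_def by blast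
  have "(\<lambda>n. J (X n)) \<longlonglongrightarrow> J v"
    unfolding J_def by (intro tendsto_intros v f.tendsto) simp
  moreover have "(\<lambda>n. m + inverse (real (Suc n))) \<longlonglongrightarrow> m + 0"
    by (intro tendsto_intros LIMSEQ_inverse_real_of_nat)
  ultimately have "J v \<le> m + 0" by (rule LIMSEQ_le) (use X in \<open>auto intro: less_imp_le\<close>)
  then have min: "J v \<le> J x" for x using mle[of x] by simp
  have "f x = inner v x" for x
  proof -
    define a where "a = inner v x - f x"
    define b where "b = (norm x)\<^sup>2 / 2"
    have b: "b \<ge> 0" by (simp add: b_def)
    have "0 \<le> t * a + t\<^sup>2 * b" for t
    proof -
      have "J (v + t *\<^sub>R x) - J v = t * a + t\<^sup>2 * b"
        unfolding J_def a_def b_def power2_norm_eq_inner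
        by (simp add: f.scaleR f.add inner_simps inner_commute power2_eq_square field_simps)
      then show ?thesis using min[of "v + t *\<^sub>R x"] by simp
    qed
    note quad = this
    \<comment> \<open>Nearly the minimiser of the quadratic \<open>t a + t^2 b\<close>; the shift by
      1 avoids division by zero for \<open>b = 0\<close>. Multiplied by the square of
      \<open>b + 1\<close>, the value at this \<open>t\<close> is minus the square of
      \<open>a\<close>.\<close>
    define t where "t = - a / (b + 1)"
    have "0 \<le> (b + 1)\<^sup>2 * (t * a + t\<^sup>2 * b)" by (rule mult_nonneg_nonneg[OF _ quad]) simp
    also have "\<dots> = (b + 1) * ((b + 1) * t) * a + ((b + 1) * t)\<^sup>2 * b"
      by (simp add: power2_eq_square algebra_simps)
    also have "(b + 1) * t = - a" using b by (simp add: t_def)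
    finally have "a\<^sup>2 \<le> 0" by (simp add: power2_eq_square algebra_simps)
    then have "a = 0" by simp
    then show ?thesis by (simp add: a_def)
  qed
  then show ?thesis by blast
qed

section \<open>The complex inner product and adjoints\<close>

lemma cinner_add_left: "cinner (x + y) z = cinner x z + cinner y z"
  by (metis cinner_add_right cinner_commute complex_cnj_add)

lemma cinner_scaleC_left: "cinner (scaleC c x) z = cnj c * cinner x z"
  by (metis cinner_scaleC_right cinner_commute complex_cnj_mult)

lemma scaleC_zero_right [simp]: "scaleC c (0::'h::complex_hilbert_space) = 0"
  using scaleC_add_right[of c "0::'h" 0] by simp

lemma scaleC_zero_left [simp]: "scaleC 0 (x::'h::complex_hilbert_space) = 0"
  using scaleC_add_left[of 0 0 x] by simp

lemma scaleC_minus_right: "scaleC c (- (x::'h::complex_hilbert_space)) = - scaleC c x"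
  by (metis add.right_inverse minus_unique scaleC_add_right scaleC_zero_right)

lemma cinner_zero_right [simp]: "cinner (x::'h::complex_hilbert_space) 0 = 0"
  using cinner_add_right[of x 0 0] by simp

text \<open>Recovers the complex inner product from the real one, so that the real Riesz
  representation yields complex adjoints.\<close>

lemma Im_cinner: "Im (cinner x y) = inner x (scaleC (-\<i>) y)"
  by (simp add: inner_eq_Re_cinner cinner_scaleC_right)

lemma cinner_eqI:
  fixes u v :: "'h::complex_hilbert_space"
  assumes "\<And>y. cinner u y = cinner v y" shows "u = v"
proof -
  have "inner u y = inner v y" for y by (simp add: inner_eq_Re_cinner assms)
  then show ?thesis by (metis inner_commute vector_eq_ldot)
qed

lemma norm_scaleC: "norm (scaleC c (x::'h::complex_hilbert_space)) = cmod c * norm x"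
proof -
  have "cinner (scaleC c x) (scaleC c x) = (cnj c * c) * cinner x x"
    by (simp only: cinner_scaleC_left cinner_scaleC_right mult_ac)
  then have "(norm (scaleC c x))\<^sup>2 = Re ((cnj c * c) * cinner x x)"
    by (simp only: power2_norm_eq_inner inner_eq_Re_cinner)
  also have "cnj c * c = complex_of_real ((cmod c)\<^sup>2)" by (metis complex_norm_square mult.commute of_real_power)
  also have "Re (\<dots> * cinner x x) = (cmod c * norm x)\<^sup>2"
    by (simp add: power_mult_distrib power2_norm_eq_inner inner_eq_Re_cinner flip: of_real_power)
  finally show ?thesis by (simp add: power2_eq_imp_eq)
qed

abbreviation BH :: "('h::complex_hilbert_space \<Rightarrow> 'h) cstar" where "BH \<equiv> bounded_operators"

abbreviation BH_mult (infixl "\<boxtimes>" 70) where "S \<boxtimes> T \<equiv> S \<otimes>\<^bsub>BH\<^esub> T"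
abbreviation BH_add (infixl "\<boxplus>" 65) where "S \<boxplus> T \<equiv> S \<oplus>\<^bsub>BH\<^esub> T"
abbreviation BH_diff (infixl "\<boxminus>" 65) where "S \<boxminus> T \<equiv> S \<ominus>\<^bsub>BH\<^esub> T"

lemma bounded_operators_simps:
  "carrier BH = {T. bounded_linear T \<and> (\<forall>c x. T (scaleC c x) = scaleC c (T x))}"
  "mult BH = (\<circ>)" "one BH = id" "zero BH = (\<lambda>x. 0)"
  "add BH = (\<lambda>S T x. S x + T x)" "cscale BH = (\<lambda>c T x. scaleC c (T x))"
  "star BH = adj" "cnorm BH = onorm"
  by (simp_all add: bounded_operators_def)

lemma BH_carrier_iff: "T \<in> carrier BH \<longleftrightarrow> bounded_linear T \<and> (\<forall>c x. T (scaleC c x) = scaleC c (T x))"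
  by (simp add: bounded_operators_simps)

lemma adj_eqI:
  fixes T S :: "'h::complex_hilbert_space \<Rightarrow> 'h"
  assumes "\<And>x y. cinner (S x) y = cinner x (T y)" shows "adj T = S"
  unfolding adj_def
proof (rule the_equality)
  fix R assume "\<forall>x y. cinner (R x) y = cinner x (T y)"
  then have "R x = S x" for x by (intro cinner_eqI) (simp add: assms)
  then show "R = S" by blast
qed (use assms in blast)

text \<open>Since \<open>adj\<close> is a definite description, an adjoint has to be produced first.
  The Riesz vector of the real functional sending \<open>y\<close> to the real inner product of
  \<open>x\<close> and \<open>T y\<close> gives the real part, and complex linearity of
  \<open>T\<close> gives the imaginary part.\<close>

lemma cinner_adj:
  fixes T :: "'h::complex_hilbert_space \<Rightarrow> 'h"
  assumes T: "T \<in> carrier BH"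
  shows "cinner (adj T x) y = cinner x (T y)"
proof -
  have bl: "bounded_linear T" and sc: "\<And>c x. T (scaleC c x) = scaleC c (T x)"
    using T by (auto simp: BH_carrier_iff)
  have "\<exists>v. \<forall>y. inner x (T y) = inner v y" for x
    by (rule riesz_representation) (rule bounded_linear_compose[OF bounded_linear_inner_right bl, unfolded o_def])
  then obtain S where S: "\<And>x y. inner x (T y) = inner (S x) y" by metis
  have "cinner (S x) y = cinner x (T y)" for x y
    by (rule complex_eqI) (simp_all add: Im_cinner S sc[symmetric] flip: inner_eq_Re_cinner)
  then show ?thesis using adj_eqI[of S T] by simp
qed

lemma inner_adj: "T \<in> carrier BH \<Longrightarrow> inner (adj T x) y = inner x (T y)"
  by (simp add: inner_eq_Re_cinner cinner_adj)

lemma onorm_bound_square: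
  assumes "\<And>x. (norm (T x))\<^sup>2 \<le> K * (norm x)\<^sup>2" "0 \<le> K"
  shows "onorm T \<le> sqrt K"
proof (rule onorm_bound)
  fix x
  have "norm (T x) = sqrt ((norm (T x))\<^sup>2)" by simp
  also have "\<dots> \<le> sqrt (K * (norm x)\<^sup>2)" using assms(1) by (simp del: real_sqrt_abs)
  finally show "norm (T x) \<le> sqrt K * norm x" by (simp add: real_sqrt_mult)
qed (simp add: assms)

lemma norm_le_onorm: "T \<in> carrier BH \<Longrightarrow> norm (T x) \<le> onorm T * norm x"
  by (simp add: BH_carrier_iff onorm)

lemma BH_onorm_nonneg: "T \<in> carrier BH \<Longrightarrow> 0 \<le> onorm T"
  by (simp add: BH_carrier_iff onorm_pos_le)

lemma adj_carrier_onorm: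
  assumes T: "T \<in> carrier BH"
  shows "adj T \<in> carrier BH" "onorm (adj T) \<le> onorm T"
proof -
  have le: "norm (adj T x) \<le> onorm T * norm x" for x
  proof (cases "adj T x = 0")
    case False
    have "norm (adj T x) * norm (adj T x) = inner x (T (adj T x))"
      by (simp add: inner_adj[OF T, symmetric] power2_norm_eq_inner flip: power2_eq_square)
    also have "\<dots> \<le> norm x * norm (T (adj T x))" by (rule norm_cauchy_schwarz)
    also have "\<dots> \<le> norm x * (onorm T * norm (adj T x))"
      by (rule mult_left_mono[OF norm_le_onorm[OF T]]) simp
    finally have "norm (adj T x) * norm (adj T x) \<le> (onorm T * norm x) * norm (adj T x)"
      by (simp add: mult_ac)
    then show ?thesis by (rule mult_right_le_imp_le) (use False in simp)
  qed (simp add: BH_onorm_nonneg[OF T])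
  have sc: "adj T (scaleC c x) = scaleC c (adj T x)" for c x
    by (rule cinner_eqI) (simp add: cinner_adj[OF T] cinner_scaleC_left)
  have "bounded_linear (adj T)"
  proof (rule bounded_linear_intro[where K="onorm T"])
    show "adj T (x + y) = adj T x + adj T y" for x y
      by (rule cinner_eqI) (simp add: cinner_adj[OF T] cinner_add_left)
    show "adj T (r *\<^sub>R x) = r *\<^sub>R adj T x" for r x by (simp add: scaleR_eq_scaleC sc)
    show "norm (adj T x) \<le> norm x * onorm T" for x using le by (simp add: mult.commute)
  qed
  then show "adj T \<in> carrier BH" using sc by (simp add: BH_carrier_iff)
  show "onorm (adj T) \<le> onorm T" by (rule onorm_bound[OF BH_onorm_nonneg[OF T] le])
qed

lemma cinner_adj_right: "T \<in> carrier BH \<Longrightarrow> cinner x (adj T y) = cinner (T x) y"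
  by (metis cinner_adj cinner_commute)

lemma adj_adj: "T \<in> carrier BH \<Longrightarrow> adj (adj T) = T"
  by (rule adj_eqI) (simp add: cinner_adj_right)

text \<open>The domination \<open>v* v \<le> v* v + w* w\<close>, which is immediate for operators, is needed for the ideals
  below and is not available in an abstract algebra without Kaplansky's theorem on \<open>v* v\<close>.\<close>

lemma onorm_square_le_sum:
  assumes v: "v \<in> carrier BH" and w: "w \<in> carrier BH"
  shows "(onorm v)\<^sup>2 \<le> onorm (\<lambda>x. adj v (v x) + adj w (w x))"
proof -
  let ?S = "\<lambda>x. adj v (v x) + adj w (w x)"
  have bl: "bounded_linear ?S"
    using v w adj_carrier_onorm(1)[OF v] adj_carrier_onorm(1)[OF w] unfolding BH_carrier_iff
    by (intro bounded_linear_add bounded_linear_compose[unfolded o_def, of "adj v" v] bounded_linear_compose[unfolded o_def, of "adj w" w]) auto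
  have "(norm (v x))\<^sup>2 \<le> onorm ?S * (norm x)\<^sup>2" for x
  proof -
    have "(norm (v x))\<^sup>2 \<le> (norm (v x))\<^sup>2 + (norm (w x))\<^sup>2" by simp
    also have "\<dots> = inner (?S x) x"
      using v w by (simp add: inner_add_left inner_adj power2_norm_eq_inner)
    also have "\<dots> \<le> norm (?S x) * norm x" by (rule norm_cauchy_schwarz)
    also have "\<dots> \<le> (onorm ?S * norm x) * norm x" by (rule mult_right_mono[OF onorm[OF bl]]) simp
    finally show ?thesis by (simp add: power2_eq_square mult.assoc)
  qed
  then have "onorm v \<le> sqrt (onorm ?S)" by (rule onorm_bound_square) (rule onorm_pos_le[OF bl])
  then have "(onorm v)\<^sup>2 \<le> (sqrt (onorm ?S))\<^sup>2" using BH_onorm_nonneg[OF v] by (rule power_mono)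
  then show ?thesis using onorm_pos_le[OF bl] by simp
qed

lemma BH_zero: "(\<lambda>x. 0) \<in> carrier BH"
  by (simp add: BH_carrier_iff)

lemma BH_ring: "ring (BH :: ('h::complex_hilbert_space \<Rightarrow> 'h) cstar)"
proof (intro ringI abelian_groupI monoidI)
  fix x :: "'h \<Rightarrow> 'h" assume x: "x \<in> carrier BH"
  then have "(\<lambda>y. - x y) \<in> carrier BH"
    by (auto simp: BH_carrier_iff bounded_linear_minus scaleC_minus_right)
  then show "\<exists>y\<in>carrier BH. y \<boxplus> x = \<zero>\<^bsub>BH\<^esub>"
    by (rule bexI[rotated]) (simp add: bounded_operators_simps)
next
  fix x y :: "'h \<Rightarrow> 'h" assume "x \<in> carrier BH" "y \<in> carrier BH"
  then show "x \<boxtimes> y \<in> carrier BH"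
    by (auto simp: bounded_operators_simps bounded_linear_compose[unfolded o_def] comp_def)
qed (auto simp: bounded_operators_simps bounded_linear_add bounded_linear_ident[unfolded id_def[symmetric]]
    scaleC_add_right fun_eq_iff linear_simps)

lemma BH_minus:
  assumes "S \<in> carrier BH" "T \<in> carrier BH"
  shows "S \<boxminus> T = (\<lambda>x. S x - T x)"
proof -
  interpret R: ring BH by (rule BH_ring)
  have "\<ominus>\<^bsub>BH\<^esub> T \<boxplus> T = \<zero>\<^bsub>BH\<^esub>" using assms by (simp add: R.l_neg)
  then have "(\<ominus>\<^bsub>BH\<^esub> T) x = - T x" for x
    unfolding bounded_operators_simps by (metis eq_neg_iff_add_eq_0)
  then show ?thesis by (simp add: a_minus_def bounded_operators_simps fun_eq_iff)
qed

instance complex_hilbert_space \<subseteq> banach ..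

text \<open>Completeness of the real bounded linear maps supplies the limit; complex linearity is
  inherited pointwise, as multiplication by a complex scalar is continuous.\<close>

lemma BH_complete:
  fixes X :: "nat \<Rightarrow> 'h::complex_hilbert_space \<Rightarrow> 'h"
  assumes X: "\<And>n. X n \<in> carrier BH"
    and cauchy: "\<And>e. e > 0 \<Longrightarrow> \<exists>N. \<forall>m\<ge>N. \<forall>n\<ge>N. onorm (\<lambda>x. X m x - X n x) < e"
  shows "\<exists>L\<in>carrier BH. (\<lambda>n. onorm (\<lambda>x. X n x - L x)) \<longlonglongrightarrow> 0"
proof -
  have bl: "bounded_linear (X n)" for n using X by (simp add: BH_carrier_iff)
  define Y where "Y n = Blinfun (X n)" for n
  have Y: "blinfun_apply (Y n) = X n" for n by (simp add: Y_def bounded_linear_Blinfun_apply bl)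
  have nY: "norm (Y m - Y n) = onorm (\<lambda>x. X m x - X n x)" for m n
    by (simp add: norm_blinfun.rep_eq minus_blinfun.rep_eq Y)
  have "Cauchy Y" unfolding Cauchy_iff nY using cauchy by blast
  then obtain L where L: "Y \<longlonglongrightarrow> L" using Cauchy_convergent convergent_def by blast
  have pt: "(\<lambda>n. X n x) \<longlonglongrightarrow> L x" for x
    using blinfun.tendsto[OF L tendsto_const[of x]] by (simp add: Y)
  have sc: "L (scaleC c x) = scaleC c (L x)" for c x
  proof (rule LIMSEQ_unique[OF pt])
    have "bounded_linear (scaleC c :: 'h \<Rightarrow> 'h)"
      by (rule bounded_linear_intro[where K="cmod c"])
        (simp_all add: scaleC_add_right scaleR_eq_scaleC scaleC_scaleC mult.commute norm_scaleC)
    then show "(\<lambda>n. X n (scaleC c x)) \<longlonglongrightarrow> scaleC c (L x)"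
      using bounded_linear.tendsto[OF _ pt] X by (simp add: BH_carrier_iff)
  qed
  have "(\<lambda>n. norm (Y n - L)) \<longlonglongrightarrow> 0" using L by (simp add: LIM_zero tendsto_norm_zero)
  then have "(\<lambda>n. onorm (\<lambda>x. X n x - L x)) \<longlonglongrightarrow> 0"
    by (simp add: norm_blinfun.rep_eq minus_blinfun.rep_eq Y)
  then show ?thesis using sc by (intro bexI[of _ "blinfun_apply L"]) (simp_all add: BH_carrier_iff blinfun.bounded_linear_right)
qed

lemma BH_cstar: "unital_cstar_algebra (BH :: ('h::complex_hilbert_space \<Rightarrow> 'h) cstar)"
proof (intro unital_cstar_algebra.intro BH_ring unital_cstar_algebra_axioms.intro)
  fix x y :: "'h \<Rightarrow> 'h" and c d :: complex
  assume x: "x \<in> carrier BH"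
  then have blx: "bounded_linear x" and scx: "\<And>c z. x (scaleC c z) = scaleC c (x z)" by (auto simp: BH_carrier_iff)
  note ax = adj_carrier_onorm[OF x]
  have blc: "bounded_linear (scaleC c :: 'h \<Rightarrow> 'h)" for c
    by (rule bounded_linear_intro[where K="cmod c"])
      (simp_all add: scaleC_add_right scaleR_eq_scaleC scaleC_scaleC mult.commute norm_scaleC)
  show "cscale BH c x \<in> carrier BH"
    using bounded_linear_compose[OF blc blx]
    by (simp add: bounded_operators_simps scx scaleC_scaleC mult.commute)
  show "cscale BH (c + d) x = cscale BH c x \<boxplus> cscale BH d x"
    by (simp add: bounded_operators_simps scaleC_add_left)
  show "cscale BH c (cscale BH d x) = cscale BH (c * d) x"
    by (simp add: bounded_operators_simps scaleC_scaleC)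
  show "cscale BH 1 x = x" by (simp add: bounded_operators_simps scaleC_one)
  show "star BH x \<in> carrier BH" by (simp add: bounded_operators_simps(7) ax)
  show "star BH (star BH x) = x" by (simp add: bounded_operators_simps(7) adj_adj x)
  show "star BH (cscale BH c x) = cscale BH (cnj c) (star BH x)"
    unfolding bounded_operators_simps
    by (rule adj_eqI) (simp add: cinner_scaleC_left cinner_scaleC_right cinner_adj[OF x])
  show "0 \<le> cnorm BH x" by (simp add: bounded_operators_simps onorm_pos_le blx)
  show "cnorm BH x = 0 \<longleftrightarrow> x = \<zero>\<^bsub>BH\<^esub>"
    by (auto simp: bounded_operators_simps onorm_eq_0[OF blx])
  show "cnorm BH (cscale BH c x) = cmod c * cnorm BH x"
  proof -
    have le: "onorm (\<lambda>z. scaleC c (x z)) \<le> cmod c * onorm x" if "bounded_linear x" for c and x :: "'h \<Rightarrow> 'h"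
      by (rule onorm_bound) (simp_all add: norm_scaleC onorm_pos_le that mult.assoc mult_left_mono onorm[OF that])
    show ?thesis
    proof (cases "c = 0")
      case False
      have "onorm (\<lambda>z. scaleC (1/c) (scaleC c (x z))) \<le> cmod (1/c) * onorm (\<lambda>z. scaleC c (x z))"
        by (rule le[OF bounded_linear_compose[OF blc blx]])
      then have "onorm x \<le> onorm (\<lambda>z. scaleC c (x z)) / cmod c"
        using False by (simp add: scaleC_scaleC scaleC_one norm_divide)
      then have "cmod c * onorm x \<le> onorm (\<lambda>z. scaleC c (x z))" using False by (simp add: field_simps)
      then show ?thesis using le[OF blx, of c] by (simp add: bounded_operators_simps)
    qed (simp add: bounded_operators_simps onorm_zero)
  qed
  show "cnorm BH (star BH x \<boxtimes> x) = (cnorm BH x)\<^sup>2"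
  proof (rule antisym)
    have bla: "bounded_linear (adj x)" using ax(1) by (simp add: BH_carrier_iff)
    have "onorm (adj x \<circ> x) \<le> onorm (adj x) * onorm x" by (rule onorm_compose[OF bla blx])
    also have "\<dots> \<le> onorm x * onorm x" by (rule mult_right_mono[OF ax(2) onorm_pos_le[OF blx]])
    finally show "cnorm BH (star BH x \<boxtimes> x) \<le> (cnorm BH x)\<^sup>2"
      by (simp add: bounded_operators_simps power2_eq_square)
    \<comment> \<open>The other half of the C*-identity is the sum-of-squares estimate with second
      operator zero.\<close>
    have "adj (\<lambda>x. 0::'h) = (\<lambda>x. 0)" by (rule adj_eqI) (simp add: cinner_commute[of 0])
    then show "(cnorm BH x)\<^sup>2 \<le> cnorm BH (star BH x \<boxtimes> x)"
      using onorm_square_le_sum[OF x BH_zero] by (simp add: bounded_operators_simps comp_def)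
  qed
  assume y: "y \<in> carrier BH"
  then have bly: "bounded_linear y" by (auto simp: BH_carrier_iff)
  show "cscale BH c (x \<boxplus> y) = cscale BH c x \<boxplus> cscale BH c y"
    by (simp add: bounded_operators_simps scaleC_add_right)
  show "cscale BH c x \<boxtimes> y = cscale BH c (x \<boxtimes> y)"
    by (simp add: bounded_operators_simps comp_def)
  show "x \<boxtimes> cscale BH c y = cscale BH c (x \<boxtimes> y)"
    by (simp add: bounded_operators_simps comp_def scx)
  show "star BH (x \<boxplus> y) = star BH x \<boxplus> star BH y"
    unfolding bounded_operators_simps
    by (rule adj_eqI) (simp add: cinner_add_left cinner_add_right cinner_adj x y)
  show "star BH (x \<boxtimes> y) = star BH y \<boxtimes> star BH x"
    unfolding bounded_operators_simps
    by (rule adj_eqI) (simp add: cinner_adj x y)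
  show "cnorm BH (x \<boxplus> y) \<le> cnorm BH x + cnorm BH y"
    by (simp add: bounded_operators_simps onorm_triangle blx bly)
  show "cnorm BH (x \<boxtimes> y) \<le> cnorm BH x * cnorm BH y"
    by (simp add: bounded_operators_simps onorm_compose blx bly)
next
  fix X :: "nat \<Rightarrow> 'h \<Rightarrow> 'h"
  assume X: "\<And>n. X n \<in> carrier BH"
    and "\<And>e. e > 0 \<Longrightarrow> \<exists>N. \<forall>m\<ge>N. \<forall>n\<ge>N. cnorm BH (X m \<boxminus> X n) < e"
  then have "\<exists>L\<in>carrier BH. (\<lambda>n. onorm (\<lambda>x. X n x - L x)) \<longlonglongrightarrow> 0"
    by (intro BH_complete) (simp_all add: BH_minus bounded_operators_simps(8))
  then obtain L where L: "L \<in> carrier BH" "(\<lambda>n. onorm (\<lambda>x. X n x - L x)) \<longlonglongrightarrow> 0" by blast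
  then show "\<exists>x\<in>carrier BH. (\<lambda>n. cnorm BH (X n \<boxminus> x)) \<longlonglongrightarrow> 0"
    using X by (intro bexI[of _ L]) (simp_all add: BH_minus bounded_operators_simps(8))
qed

section \<open>Words in the isometry and the coefficient algebra\<close>

text \<open>A word \<open>[(k\<^sub>1, a\<^sub>1), \<dots>]\<close> stands for the sum of the monomials \<open>a J\<^sup>k\<close> for \<open>k \<ge> 0\<close> and
  \<open>J*\<^sup>-\<^sup>k a\<close> for \<open>k < 0\<close>. As words can be evaluated in every covariant representation,
  identities between them transfer from one representation to another.\<close>

type_synonym 'h word = "(int \<times> ('h \<Rightarrow> 'h)) list"

definition alphan :: "('h::complex_hilbert_space \<Rightarrow> 'h) \<Rightarrow> nat \<Rightarrow> ('h \<Rightarrow> 'h) \<Rightarrow> 'h \<Rightarrow> 'h" where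
  "alphan J n = (alpha J ^^ n)"

definition betan :: "('h::complex_hilbert_space \<Rightarrow> 'h) \<Rightarrow> nat \<Rightarrow> ('h \<Rightarrow> 'h) \<Rightarrow> 'h \<Rightarrow> 'h" where
  "betan J n = (beta J ^^ n)"

text \<open>The coefficient of the product of monomials of degrees \<open>k\<close> and
  \<open>l\<close>. Moving a coefficient past a power of \<open>J\<close> or of its adjoint applies
  \<open>alphan\<close>; the range projection of the \<open>m\<close>-th power of \<open>J\<close>
  is \<open>alphan J m id\<close>; and an expression enclosed by equal powers of the adjoint on the
  left and of \<open>J\<close> on the right compresses to \<open>betan\<close>.\<close>

definition wmul :: "('h::complex_hilbert_space \<Rightarrow> 'h) \<Rightarrow> int \<Rightarrow> ('h \<Rightarrow> 'h) \<Rightarrow> int \<Rightarrow> ('h \<Rightarrow> 'h) \<Rightarrow> 'h \<Rightarrow> 'h" where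
  "wmul J k a l b =
    (if k \<ge> 0 then
       if l \<ge> 0 then a \<circ> alphan J (nat k) b
       else if k + l \<ge> 0 then a \<circ> alphan J (nat (k + l)) (alphan J (nat (-l)) id \<circ> b)
       else alphan J (nat (-(k + l))) (a \<circ> alphan J (nat k) id) \<circ> b
     else
       if l < 0 then alphan J (nat (-l)) a \<circ> b
       else if k + l \<ge> 0 then betan J (nat (-k)) (a \<circ> b)
       else betan J (nat l) (a \<circ> b))"

definition wtimes :: "('h::complex_hilbert_space \<Rightarrow> 'h) \<Rightarrow> 'h word \<Rightarrow> 'h word \<Rightarrow> 'h word" where
  "wtimes J xs ys = concat (map (\<lambda>(k, a). map (\<lambda>(l, b). (k + l, wmul J k a l b)) ys) xs)"

definition wstar :: "'h::complex_hilbert_space word \<Rightarrow> 'h word" where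
  "wstar = map (\<lambda>(k, a). (-k, adj a))"

definition wscale :: "complex \<Rightarrow> 'h::complex_hilbert_space word \<Rightarrow> 'h word" where
  "wscale c = map (\<lambda>(k, a). (k, \<lambda>x. scaleC c (a x)))"

definition words :: "('h \<Rightarrow> 'h) set \<Rightarrow> 'h word set" where
  "words S = {xs. \<forall>(k, a)\<in>set xs. a \<in> S}"

definition deg_le :: "nat \<Rightarrow> 'h word \<Rightarrow> bool" where
  "deg_le d xs \<longleftrightarrow> (\<forall>(k, a)\<in>set xs. \<bar>k\<bar> \<le> int d)"

fun coef0 :: "'h::complex_hilbert_space word \<Rightarrow> 'h \<Rightarrow> 'h" where
  "coef0 [] = (\<lambda>v. 0)"
| "coef0 ((k, a) # xs) = (if k = 0 then (\<lambda>v. a v + coef0 xs v) else coef0 xs)"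

lemma words_simps [simp]: "[] \<in> words S" "(k, a) # xs \<in> words S \<longleftrightarrow> a \<in> S \<and> xs \<in> words S"
  "xs @ ys \<in> words S \<longleftrightarrow> xs \<in> words S \<and> ys \<in> words S"
  by (auto simp: words_def)

lemma words_mono: "S \<subseteq> T \<Longrightarrow> words S \<subseteq> words T"
  by (auto simp: words_def)

lemma words_wtimes:
  assumes "\<And>k a l b. a \<in> S \<Longrightarrow> b \<in> T \<Longrightarrow> wmul J k a l b \<in> R"
  shows "xs \<in> words S \<Longrightarrow> ys \<in> words T \<Longrightarrow> wtimes J xs ys \<in> words R"
  using assms by (fastforce simp: words_def wtimes_def)

lemma deg_le_wtimes: "deg_le d xs \<Longrightarrow> deg_le e ys \<Longrightarrow> deg_le (d + e) (wtimes J xs ys)"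
  by (fastforce simp: deg_le_def wtimes_def)

lemma deg_le_wstar: "deg_le d xs \<Longrightarrow> deg_le d (wstar xs)"
  by (fastforce simp: deg_le_def wstar_def)

lemma deg_le_exists: "\<exists>d. deg_le d xs"
proof (induction xs)
  case (Cons p xs)
  then obtain d where "deg_le d xs" by blast
  then have "deg_le (max d (nat \<bar>fst p\<bar>)) (p # xs)"
    by (auto simp: deg_le_def)
  then show ?case by blast
qed (simp add: deg_le_def)

lemma coef0_append: "coef0 (xs @ ys) = (\<lambda>v. coef0 xs v + coef0 ys v)"
  by (induction xs rule: coef0.induct) (auto simp: add.assoc)

locale isometry_setting =
  fixes J :: "'h::complex_hilbert_space \<Rightarrow> 'h" and B :: "('h \<Rightarrow> 'h) set"
  assumes J_isometry: "isometry_in BH J"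
    and B_subalgebra: "cstar_subalgebra BH B" and id_B: "id \<in> B"
    and alpha_B: "a \<in> B \<Longrightarrow> alpha J a \<in> B" and beta_B: "a \<in> B \<Longrightarrow> beta J a \<in> B"
begin

lemma J_carrier: "J \<in> carrier BH" and adj_J_J: "adj J \<circ> J = id"
  using J_isometry by (simp_all add: isometry_in_def bounded_operators_simps)

lemma B_closed:
  "a \<in> B \<Longrightarrow> b \<in> B \<Longrightarrow> a \<circ> b \<in> B" "a \<in> B \<Longrightarrow> b \<in> B \<Longrightarrow> (\<lambda>x. a x + b x) \<in> B"
  "a \<in> B \<Longrightarrow> (\<lambda>x. scaleC c (a x)) \<in> B" "a \<in> B \<Longrightarrow> adj a \<in> B" "(\<lambda>x. 0) \<in> B"
  by (simp_all add: cstar_subalgebraD(2-6)[OF B_subalgebra, unfolded bounded_operators_simps])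

lemma B_carrier: "a \<in> B \<Longrightarrow> a \<in> carrier BH"
  using cstar_subalgebraD(1)[OF B_subalgebra] by blast

lemma alphan_B: "a \<in> B \<Longrightarrow> alphan J n a \<in> B" and betan_B: "a \<in> B \<Longrightarrow> betan J n a \<in> B"
  unfolding alphan_def betan_def by (induction n) (auto intro: alpha_B beta_B)

lemma wmul_B: "a \<in> B \<Longrightarrow> b \<in> B \<Longrightarrow> wmul J k a l b \<in> B"
  unfolding wmul_def by (auto intro!: B_closed alphan_B betan_B id_B)

lemma coef0_B: "xs \<in> words B \<Longrightarrow> coef0 xs \<in> B"
  by (induction xs rule: coef0.induct) (auto intro: B_closed)

lemma wtimes_B: "xs \<in> words B \<Longrightarrow> ys \<in> words B \<Longrightarrow> wtimes J xs ys \<in> words B"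
  by (rule words_wtimes[OF wmul_B])

lemma wstar_words: "(\<And>a. a \<in> S \<Longrightarrow> adj a \<in> S) \<Longrightarrow> xs \<in> words S \<Longrightarrow> wstar xs \<in> words S"
  by (fastforce simp: words_def wstar_def)

lemma wscale_words: "(\<And>a. a \<in> S \<Longrightarrow> (\<lambda>x. scaleC c (a x)) \<in> S) \<Longrightarrow> xs \<in> words S \<Longrightarrow> wscale c xs \<in> words S"
  by (fastforce simp: words_def wscale_def)

lemma subalg_cstar: "unital_cstar_algebra (subalg B)"
proof -
  interpret BH: unital_cstar_algebra BH by (rule BH_cstar)
  show ?thesis by (rule BH.subalgebra_cstar[OF B_subalgebra]) (simp add: bounded_operators_simps id_B)
qed

end

text \<open>Here \<open>\<rho>\<close> is defined on \<open>B\<close> rather than on a quotient of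
  it. Thus one word calculus serves both the operators themselves, with \<open>\<rho>\<close> the
  inclusion, and an arbitrary covariant pair of the quotient composed with the quotient map.\<close>

locale cov_rep = isometry_setting J B + unital_cstar_algebra E
  for J :: "'h::complex_hilbert_space \<Rightarrow> 'h" and B and E :: "'e cstar" (structure) +
  fixes \<rho> :: "('h \<Rightarrow> 'h) \<Rightarrow> 'e" and V :: 'e
  assumes rho: "unital_star_hom (subalg B) E \<rho>"
    and V_isometry: "isometry_in E V"
    and cov: "b \<in> B \<Longrightarrow> V \<otimes> \<rho> b \<otimes> star E V = \<rho> (alpha J b)"
begin

abbreviation W :: 'e where "W \<equiv> star E V"

lemma V_closed [simp]: "V \<in> carrier E" and W_V: "W \<otimes> V = \<one>"
  using V_isometry by (simp_all add: isometry_in_def)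

lemma rho_simps:
  "a \<in> B \<Longrightarrow> \<rho> a \<in> carrier E"
  "a \<in> B \<Longrightarrow> b \<in> B \<Longrightarrow> \<rho> (a \<circ> b) = \<rho> a \<otimes> \<rho> b"
  "a \<in> B \<Longrightarrow> b \<in> B \<Longrightarrow> \<rho> (\<lambda>x. a x + b x) = \<rho> a \<oplus> \<rho> b"
  "a \<in> B \<Longrightarrow> \<rho> (\<lambda>x. scaleC c (a x)) = cscale E c (\<rho> a)"
  "a \<in> B \<Longrightarrow> \<rho> (adj a) = star E (\<rho> a)"
  "\<rho> id = \<one>"
  using star_homD[of "subalg B" E \<rho> a] star_homD(2,3)[of "subalg B" E \<rho> a b] rho
  by (simp_all add: unital_star_hom_def bounded_operators_simps)

lemma rho_ident: "\<rho> (\<lambda>x. x) = \<one>"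
  using rho_simps(6) by (simp add: id_def)

declare pow_nat [simp del]

lemma rho_zero: "\<rho> (\<lambda>x. 0) = \<zero>"
  using rho_simps(4)[OF id_B, of 0] rho_simps(1)[OF id_B] by simp

lemma V_rho: assumes b: "b \<in> B" shows "V \<otimes> \<rho> b = \<rho> (alpha J b) \<otimes> V"
proof -
  have "\<rho> (alpha J b) \<otimes> V = (V \<otimes> \<rho> b) \<otimes> (W \<otimes> V)"
    unfolding cov[OF b, symmetric] using rho_simps(1)[OF b] by (simp add: m_assoc)
  then show ?thesis using rho_simps(1)[OF b] by (simp add: W_V)
qed

lemma rho_W: assumes b: "b \<in> B" shows "\<rho> b \<otimes> W = W \<otimes> \<rho> (alpha J b)"
proof -
  have "W \<otimes> \<rho> (alpha J b) = (W \<otimes> V) \<otimes> (\<rho> b \<otimes> W)"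
    unfolding cov[OF b, symmetric] using rho_simps(1)[OF b] by (simp add: m_assoc)
  then show ?thesis using rho_simps(1)[OF b] by (simp add: W_V)
qed

lemma alphan_Suc: "alphan J (Suc n) b = alpha J (alphan J n b)" "alphan J (Suc n) b = alphan J n (alpha J b)"
  by (simp_all add: alphan_def funpow_swap1)

lemma betan_Suc: "betan J (Suc n) b = betan J n (beta J b)"
  by (simp add: betan_def funpow_swap1)

lemma Vn_rho: "b \<in> B \<Longrightarrow> V [^] n \<otimes> \<rho> b = \<rho> (alphan J n b) \<otimes> V [^] n"
proof (induction n arbitrary: b)
  case 0
  then show ?case by (simp add: alphan_def rho_simps rho_ident)
next
  case (Suc n)
  note c = rho_simps(1)[OF Suc.prems] rho_simps(1)[OF alpha_B[OF Suc.prems]] rho_simps(1)[OF alphan_B[OF alpha_B[OF Suc.prems]]]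
  have "V [^] Suc n \<otimes> \<rho> b = V [^] n \<otimes> (V \<otimes> \<rho> b)" using c by (simp add: m_assoc)
  also have "\<dots> = (V [^] n \<otimes> \<rho> (alpha J b)) \<otimes> V" unfolding V_rho[OF Suc.prems] using c by (simp add: m_assoc)
  also have "\<dots> = \<rho> (alphan J (Suc n) b) \<otimes> V [^] Suc n"
    unfolding Suc.IH[OF alpha_B[OF Suc.prems]] alphan_Suc(2) using c by (simp add: m_assoc)
  finally show ?case .
qed

lemma rho_Wn: "b \<in> B \<Longrightarrow> \<rho> b \<otimes> W [^] n = W [^] n \<otimes> \<rho> (alphan J n b)"
proof (induction n)
  case 0
  then show ?case by (simp add: alphan_def rho_simps rho_ident)
next
  case (Suc n)
  note c = rho_simps(1)[OF Suc.prems] rho_simps(1)[OF alphan_B[OF Suc.prems]] rho_simps(1)[OF alpha_B[OF alphan_B[OF Suc.prems]]]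
  have "\<rho> b \<otimes> W [^] Suc n = (\<rho> b \<otimes> W [^] n) \<otimes> W" using c by (simp add: m_assoc)
  also have "\<dots> = W [^] n \<otimes> (\<rho> (alphan J n b) \<otimes> W)" unfolding Suc.IH[OF Suc.prems] using c by (simp add: m_assoc)
  also have "\<dots> = W [^] Suc n \<otimes> \<rho> (alphan J (Suc n) b)"
    unfolding rho_W[OF alphan_B[OF Suc.prems]] alphan_Suc(1) using c by (simp add: m_assoc)
  finally show ?case .
qed

lemma V_W: "V \<otimes> W = \<rho> (alpha J id)"
  using cov[OF id_B] by (simp add: rho_simps)

text \<open>Covariance prescribes only \<open>alpha\<close>. But \<open>alpha J (beta J b)\<close>
  is \<open>b\<close> cut down by the projection \<open>alpha J id\<close>, whose image under
  \<open>\<rho>\<close> is the range projection of \<open>V\<close>; compressing by \<open>V\<close>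
  removes both projections and leaves \<open>beta\<close>.\<close>

lemma W_rho_V: assumes b: "b \<in> B" shows "W \<otimes> \<rho> b \<otimes> V = \<rho> (beta J b)"
proof -
  note c = rho_simps(1)[OF b] rho_simps(1)[OF beta_B[OF b]] rho_simps(1)[OF alpha_B[OF id_B]]
  have "alpha J (beta J b) = alpha J id \<circ> b \<circ> alpha J id"
    by (simp add: alpha_def beta_def o_assoc)
  then have "V \<otimes> \<rho> (beta J b) \<otimes> W = (V \<otimes> W) \<otimes> \<rho> b \<otimes> (V \<otimes> W)"
    unfolding cov[OF beta_B[OF b]] V_W using b by (simp add: rho_simps alpha_B id_B B_closed)
  then have "W \<otimes> (V \<otimes> \<rho> (beta J b) \<otimes> W) \<otimes> V = W \<otimes> ((V \<otimes> W) \<otimes> \<rho> b \<otimes> (V \<otimes> W)) \<otimes> V" by simp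
  then have "(W \<otimes> V) \<otimes> \<rho> (beta J b) \<otimes> (W \<otimes> V) = (W \<otimes> V) \<otimes> W \<otimes> \<rho> b \<otimes> V \<otimes> (W \<otimes> V)"
    using c by (simp add: m_assoc)
  then show ?thesis using c by (simp add: W_V)
qed

lemma Wn_rho_Vn: "b \<in> B \<Longrightarrow> W [^] n \<otimes> \<rho> b \<otimes> V [^] n = \<rho> (betan J n b)"
proof (induction n arbitrary: b)
  case 0
  then show ?case by (simp add: betan_def rho_simps)
next
  case (Suc n)
  note c = rho_simps(1)[OF Suc.prems]
  have "W [^] Suc n \<otimes> \<rho> b \<otimes> V [^] Suc n = W [^] n \<otimes> (W \<otimes> \<rho> b \<otimes> V) \<otimes> V [^] n"
    using c by (subst nat_pow_Suc2[of V]) (simp_all add: m_assoc)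
  then show ?case unfolding W_rho_V[OF Suc.prems] Suc.IH[OF beta_B[OF Suc.prems]] betan_Suc .
qed

lemma Vn_Wn: "V [^] n \<otimes> W [^] n = \<rho> (alphan J n id)"
proof (induction n)
  case 0
  then show ?case by (simp add: alphan_def rho_simps rho_ident)
next
  case (Suc n)
  have "V [^] Suc n \<otimes> W [^] Suc n = V \<otimes> (V [^] n \<otimes> W [^] n) \<otimes> W"
    by (subst nat_pow_Suc2[of V]) (simp_all add: m_assoc)
  then show ?case unfolding Suc alphan_Suc(1) using cov[OF alphan_B[OF id_B]] by simp
qed

lemma star_nat_pow: "x \<in> carrier E \<Longrightarrow> star E (x [^] (n::nat)) = star E x [^] n"
  by (induction n) (simp_all add: star_mult nat_pow_Suc2[symmetric])

section \<open>Monomials and the evaluation of words\<close>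

definition wmono :: "int \<Rightarrow> ('h \<Rightarrow> 'h) \<Rightarrow> 'e" where
  "wmono k a = (if k \<ge> 0 then \<rho> a \<otimes> V [^] nat k else W [^] nat (-k) \<otimes> \<rho> a)"

lemma wmono_closed [simp]: "a \<in> B \<Longrightarrow> wmono k a \<in> carrier E"
  by (simp add: wmono_def rho_simps)

lemma pow_split: "x \<in> carrier E \<Longrightarrow> n = m + k \<Longrightarrow> x [^] (n::nat) = x [^] (m::nat) \<otimes> x [^] (k::nat)"
  by (simp add: nat_pow_mult)

text \<open>Adjacent powers of \<open>V\<close> and \<open>W\<close> are collected with equal
  exponents, according to which of the two degrees outweighs the other. The resulting coefficient is
  computed in \<open>B\<close> alone, so it is the same in every representation.\<close>

lemma wmono_mult: assumes a: "a \<in> B" and b: "b \<in> B"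
  shows "wmono k a \<otimes> wmono l b = wmono (k + l) (wmul J k a l b)"
proof -
  note c = rho_simps(1)[OF a] rho_simps(1)[OF b]
  note cl = a b alphan_B betan_B id_B B_closed(1)
  consider (pp) "k \<ge> 0" "l \<ge> 0" | (pn1) "k \<ge> 0" "l < 0" "k + l \<ge> 0" | (pn2) "k \<ge> 0" "l < 0" "k + l < 0"
    | (nn) "k < 0" "l < 0" | (np1) "k < 0" "l \<ge> 0" "k + l \<ge> 0" | (np2) "k < 0" "l \<ge> 0" "k + l < 0" by linarith
  then show ?thesis
  proof cases
    case pp
    have "wmono k a \<otimes> wmono l b = \<rho> a \<otimes> (V [^] nat k \<otimes> \<rho> b) \<otimes> V [^] nat l"
      using pp c by (simp add: wmono_def m_assoc)
    also have "\<dots> = \<rho> a \<otimes> \<rho> (alphan J (nat k) b) \<otimes> V [^] (nat k + nat l)"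
      unfolding Vn_rho[OF b] using c cl by (simp add: m_assoc rho_simps nat_pow_mult)
    also have "\<dots> = wmono (k + l) (wmul J k a l b)"
      using pp cl by (simp add: wmono_def wmul_def rho_simps nat_add_distrib)
    finally show ?thesis .
  next
    case pn1
    have s: "V [^] nat k = V [^] nat (k + l) \<otimes> V [^] nat (-l)" by (rule pow_split) (use pn1 in auto)
    have "wmono k a \<otimes> wmono l b = \<rho> a \<otimes> (V [^] nat (k + l) \<otimes> ((V [^] nat (-l) \<otimes> W [^] nat (-l)) \<otimes> \<rho> b))"
      using pn1 c by (simp add: wmono_def s m_assoc)
    also have "\<dots> = \<rho> a \<otimes> (V [^] nat (k + l) \<otimes> \<rho> (alphan J (nat (-l)) id \<circ> b))"
      unfolding Vn_Wn using cl by (simp add: rho_simps)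
    also have "\<dots> = \<rho> a \<otimes> \<rho> (alphan J (nat (k + l)) (alphan J (nat (-l)) id \<circ> b)) \<otimes> V [^] nat (k + l)"
      using Vn_rho[OF B_closed(1)[OF alphan_B[OF id_B] b]] c rho_simps(1)[OF alphan_B[OF B_closed(1)[OF alphan_B[OF id_B] b]]]
      by (simp add: m_assoc)
    also have "\<dots> = wmono (k + l) (wmul J k a l b)"
      using pn1 cl by (simp add: wmono_def wmul_def rho_simps)
    finally show ?thesis .
  next
    case pn2
    have s: "W [^] nat (-l) = W [^] nat k \<otimes> W [^] nat (-(k + l))" by (rule pow_split) (use pn2 in auto)
    have "wmono k a \<otimes> wmono l b = (\<rho> a \<otimes> (V [^] nat k \<otimes> W [^] nat k) \<otimes> W [^] nat (-(k + l))) \<otimes> \<rho> b"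
      using pn2 c by (simp add: wmono_def s m_assoc)
    also have "\<dots> = (\<rho> (a \<circ> alphan J (nat k) id) \<otimes> W [^] nat (-(k + l))) \<otimes> \<rho> b"
      unfolding Vn_Wn using cl by (simp add: rho_simps)
    also have "\<dots> = W [^] nat (-(k + l)) \<otimes> (\<rho> (alphan J (nat (-(k + l))) (a \<circ> alphan J (nat k) id)) \<otimes> \<rho> b)"
      using rho_Wn[OF B_closed(1)[OF a alphan_B[OF id_B]]] c rho_simps(1)[OF alphan_B[OF B_closed(1)[OF a alphan_B[OF id_B]]]]
      by (simp add: m_assoc)
    also have "\<dots> = wmono (k + l) (wmul J k a l b)"
      using pn2 cl by (simp add: wmono_def wmul_def rho_simps)
    finally show ?thesis .
  next
    case nn
    have "wmono k a \<otimes> wmono l b = W [^] nat (-k) \<otimes> (\<rho> a \<otimes> W [^] nat (-l)) \<otimes> \<rho> b"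
      using nn c by (simp add: wmono_def m_assoc)
    also have "\<dots> = W [^] (nat (-k) + nat (-l)) \<otimes> \<rho> (alphan J (nat (-l)) a \<circ> b)"
      unfolding rho_Wn[OF a] using cl by (simp add: rho_simps m_assoc nat_pow_mult[symmetric])
    also have "nat (-k) + nat (-l) = nat (-(k + l))" using nn by simp
    also have "W [^] nat (-(k + l)) \<otimes> \<rho> (alphan J (nat (-l)) a \<circ> b) = wmono (k + l) (wmul J k a l b)"
      using nn by (simp add: wmono_def wmul_def)
    finally show ?thesis .
  next
    case np1
    have s: "V [^] nat l = V [^] nat (-k) \<otimes> V [^] nat (k + l)" by (rule pow_split) (use np1 in auto)
    have "wmono k a \<otimes> wmono l b = (W [^] nat (-k) \<otimes> \<rho> (a \<circ> b) \<otimes> V [^] nat (-k)) \<otimes> V [^] nat (k + l)"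
      using np1 c a b by (simp add: wmono_def s m_assoc rho_simps)
    then show ?thesis using np1 cl by (simp add: Wn_rho_Vn wmono_def wmul_def)
  next
    case np2
    have s: "W [^] nat (-k) = W [^] nat (-(k + l)) \<otimes> W [^] nat l" by (rule pow_split) (use np2 in auto)
    have "wmono k a \<otimes> wmono l b = W [^] nat (-(k + l)) \<otimes> (W [^] nat l \<otimes> \<rho> (a \<circ> b) \<otimes> V [^] nat l)"
      using np2 c a b by (simp add: wmono_def s m_assoc rho_simps)
    then show ?thesis using np2 cl by (simp add: Wn_rho_Vn wmono_def wmul_def)
  qed
qed

lemma wmono_star: assumes a: "a \<in> B" shows "star E (wmono k a) = wmono (-k) (adj a)"
proof (cases "k = 0")
  case False
  then show ?thesis
    using a rho_simps(1)[OF a] by (cases "k > 0") (simp_all add: wmono_def star_mult rho_simps star_nat_pow)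
qed (use a in \<open>simp add: wmono_def rho_simps\<close>)

lemma wmono_scale: "a \<in> B \<Longrightarrow> wmono k (\<lambda>x. scaleC c (a x)) = cscale E c (wmono k a)"
  by (simp add: wmono_def rho_simps cscale_mult_left cscale_mult_right)

text \<open>The parameter \<open>z\<close> is a gauge twist: for \<open>z\<close> on the unit circle
  this is the evaluation at the covariant pair with isometry \<open>z V\<close>, so twisting needs
  no automorphism of \<open>E\<close>.\<close>

definition ev :: "complex \<Rightarrow> 'h word \<Rightarrow> 'e" where
  "ev z xs = foldr (\<lambda>(k, a) y. cscale E (z powi k) (wmono k a) \<oplus> y) xs \<zero>"

lemma ev_Nil [simp]: "ev z [] = \<zero>"
  and ev_Cons [simp]: "ev z ((k, a) # xs) = cscale E (z powi k) (wmono k a) \<oplus> ev z xs"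
  by (simp_all add: ev_def)

lemma ev_closed [simp]: "xs \<in> words B \<Longrightarrow> ev z xs \<in> carrier E"
  by (induction xs) (auto)

lemma ev_append: "xs \<in> words B \<Longrightarrow> ys \<in> words B \<Longrightarrow> ev z (xs @ ys) = ev z xs \<oplus> ev z ys"
  by (induction xs) (auto simp: a_assoc)

lemma ev_scale: "xs \<in> words B \<Longrightarrow> ev z (wscale c xs) = cscale E c (ev z xs)"
  by (induction xs) (auto simp: wscale_def wmono_scale cscale_cscale cscale_add_right mult.commute)

lemma ev_star: assumes z: "cmod z = 1" shows "xs \<in> words B \<Longrightarrow> ev z (wstar xs) = star E (ev z xs)"
proof (induction xs)
  case (Cons p xs)
  obtain k a where p: "p = (k, a)" by fastforce
  \<comment> \<open>On the unit circle inversion is conjugation, so the twist is compatible with the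
    change of sign of the degree under the adjoint.\<close>
  have "z * cnj z = 1" using z by (simp add: complex_norm_square[symmetric])
  then have "inverse z = cnj z" by (metis inverse_unique)
  then have "z powi (-k) = cnj (z powi k)"
    by (simp add: power_int_minus power_int_inverse[symmetric] complex_cnj_power_int)
  then show ?case using Cons p by (auto simp: wstar_def star_add star_cscale wmono_star)
qed (simp add: wstar_def)

lemma ev_mult:
  assumes z: "z \<noteq> 0" and ys: "ys \<in> words B"
  shows "xs \<in> words B \<Longrightarrow> ev z (wtimes J xs ys) = ev z xs \<otimes> ev z ys"
proof (induction xs)
  case Nil
  then show ?case using ys by (simp add: wtimes_def)
next
  case (Cons p xs)
  obtain k a where p: "p = (k, a)" by fastforce
  have a: "a \<in> B" and xs: "xs \<in> words B" using Cons.prems p by auto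
  have mem: "map (\<lambda>(l, b). (k + l, wmul J k a l b)) ys' \<in> words B" if "ys' \<in> words B" for ys'
    using that a wmul_B by (fastforce simp: words_def)
  have single: "ev z (map (\<lambda>(l, b). (k + l, wmul J k a l b)) ys') = cscale E (z powi k) (wmono k a) \<otimes> ev z ys'"
    if "ys' \<in> words B" for ys'
    using that
  proof (induction ys')
    case (Cons q ys')
    obtain l b where q: "q = (l, b)" by fastforce
    have b: "b \<in> B" and ys': "ys' \<in> words B" using Cons.prems q by auto
    have "cscale E (z powi (k + l)) (wmono (k + l) (wmul J k a l b)) =
        cscale E (z powi k) (wmono k a) \<otimes> cscale E (z powi l) (wmono l b)"
      unfolding wmono_mult[OF a b, symmetric]
      using a b z by (simp add: cscale_mult_left cscale_mult_right cscale_cscale power_int_add mult.commute)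
    then show ?case using Cons.IH ys' a b q by (simp add: r_distr)
  qed (use a in simp)
  have "ev z (wtimes J (p # xs) ys) =
      ev z (map (\<lambda>(l, b). (k + l, wmul J k a l b)) ys) \<oplus> ev z (wtimes J xs ys)"
    using ev_append[OF mem[OF ys] wtimes_B[OF xs ys]] p by (simp add: wtimes_def)
  also have "\<dots> = ev z (p # xs) \<otimes> ev z ys"
    unfolding single[OF ys] Cons.IH[OF xs] using a xs ys p by (simp add: l_distr)
  finally show ?case .
qed

section \<open>Averages over roots of unity\<close>

lemma finsum_cscale: "m \<in> carrier E \<Longrightarrow> (\<Oplus>j\<in>{..<N::nat}. cscale E (c j) m) = cscale E (\<Sum>j<N. c j) m"
  by (induction N) (simp_all add: lessThan_Suc finsum_insert Pi_iff cscale_add_left)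

text \<open>A geometric sum whose ratio is an \<open>N\<close>-th root of unity; the bound on
  \<open>k\<close> excludes nonzero multiples of \<open>N\<close>, so the ratio is 1 for
  \<open>k = 0\<close> only.\<close>

lemma sum_root_unity:
  assumes "\<bar>k\<bar> < int N"
  shows "(\<Sum>j<N. (cis (2 * pi / N) ^ j) powi k) = (if k = 0 then of_nat N else 0)"
proof (cases "k = 0")
  case False
  define x where "x = cis (2 * pi * k / N)"
  have N: "N > 0" using assms by simp
  have "(cis (2 * pi / N) ^ j) powi k = x ^ j" for j
  proof -
    have "(cis (2 * pi / N) ^ j) powi k = cis (of_int k * (real j * (2 * pi / N)))"
      by (simp only: Complex.DeMoivre cis_power_int)
    also have "\<dots> = cis (real j * (2 * pi * k / N))" by (simp add: mult_ac)
    also have "\<dots> = x ^ j" by (simp only: x_def Complex.DeMoivre)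
    finally show ?thesis .
  qed
  then have "(\<Sum>j<N. (cis (2 * pi / N) ^ j) powi k) = (\<Sum>j<N. x ^ j)" by simp
  also have "\<dots> = 0"
  proof -
    have "x \<noteq> 1"
    proof
      assume "x = 1"
      then have "exp (\<i> * complex_of_real (2 * pi * k / N)) = 1" by (simp add: x_def cis_conv_exp)
      then obtain n :: int where "2 * pi * k / N = of_int (2 * n) * pi" by (auto simp: exp_eq_1)
      then have "of_int k = (of_int (n * int N) :: real)" using N by (simp add: field_simps)
      then have "k = n * int N" by (simp only: of_int_eq_iff)
      then show False using assms False by (auto simp: abs_mult)
    qed
    moreover have "x ^ N = 1"
    proof -
      have "x ^ N = cis (2 * pi * of_int k)" using N by (simp add: x_def Complex.DeMoivre)
      also have "\<dots> = 1" by (rule cis_multiple_2pi) simp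
      finally show ?thesis .
    qed
    ultimately show ?thesis by (simp add: sum_gp_strict)
  qed
  finally show ?thesis using False by simp
qed simp

text \<open>All degrees in the word have modulus below \<open>N\<close>, so only degree 0 survives
  the summation over the \<open>N\<close>-th roots of unity.\<close>

lemma average_ev:
  assumes xs: "xs \<in> words B" "deg_le d xs" and N: "d < N"
  shows "(\<Oplus>j\<in>{..<N}. ev (cis (2 * pi / N) ^ j) xs) = cscale E (of_nat N) (\<rho> (coef0 xs))"
  using xs
proof (induction xs)
  case (Cons p xs)
  obtain k a where p: "p = (k, a)" by fastforce
  have a: "a \<in> B" and xs: "xs \<in> words B" and d: "deg_le d xs" and k: "\<bar>k\<bar> < int N"
    using Cons.prems p N by (auto simp: deg_le_def)
  have "(\<Oplus>j\<in>{..<N}. ev (cis (2 * pi / N) ^ j) (p # xs)) =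
      (\<Oplus>j\<in>{..<N}. cscale E ((cis (2 * pi / N) ^ j) powi k) (wmono k a)) \<oplus> (\<Oplus>j\<in>{..<N}. ev (cis (2 * pi / N) ^ j) xs)"
    unfolding p ev_Cons by (rule finsum_addf) (use a xs in auto)
  also have "\<dots> = cscale E (if k = 0 then of_nat N else 0) (wmono k a) \<oplus> cscale E (of_nat N) (\<rho> (coef0 xs))"
    unfolding Cons.IH[OF xs d] finsum_cscale[OF wmono_closed[OF a]] sum_root_unity[OF k] ..
  also have "\<dots> = cscale E (of_nat N) (\<rho> (coef0 (p # xs)))"
    using a coef0_B[OF xs] p by (auto simp: wmono_def rho_simps cscale_add_right)
  finally show ?case .
qed (simp add: rho_zero)

lemma pos_finsum: "(\<And>j. j < n \<Longrightarrow> pos (f j)) \<Longrightarrow> pos (\<Oplus>j\<in>{..<n::nat}. f j)"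
proof (induction n)
  case 0
  then show ?case using pos_square[of \<zero>] by simp
next
  case (Suc n)
  then have "(\<Oplus>j\<in>{..<Suc n}. f j) = f n \<oplus> (\<Oplus>j\<in>{..<n}. f j)"
    by (simp add: lessThan_Suc finsum_insert Pi_iff)
  then show ?case using Suc by (simp add: pos_add)
qed

text \<open>Squares of self-adjoint words are positive at all points of the circle, so the value at \<open>1\<close> is
  dominated by the sum over the \<open>N\<close>-th roots of unity, which is \<open>N\<close> times the zeroth coefficient.\<close>

lemma cnorm_ev_square_le:
  assumes xs: "xs \<in> words B" "deg_le d xs" and sa: "\<And>z. cmod z = 1 \<Longrightarrow> star E (ev z xs) = ev z xs"
  shows "cnorm E (ev 1 (wtimes J xs xs)) \<le> real (2 * d + 1) * cnorm E (\<rho> (coef0 (wtimes J xs xs)))"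
proof -
  \<comment> \<open>The square has degree at most \<open>2 * d\<close>, and \<open>2 * d + 1\<close>
    is the least number of roots for which the average isolates degree 0.\<close>
  let ?y = "wtimes J xs xs" and ?w = "cis (2 * pi / real (2 * d + 1))"
  have y: "?y \<in> words B" "deg_le (2 * d) ?y"
    using wtimes_B[OF xs(1) xs(1)] deg_le_wtimes[OF xs(2) xs(2)] by (simp_all add: mult_2)
  have w: "cmod (?w ^ j) = 1" for j by (simp add: norm_power)
  have p: "pos (ev (?w ^ j) ?y)" for j
  proof -
    have "ev (?w ^ j) ?y = ev (?w ^ j) xs \<otimes> ev (?w ^ j) xs" by (rule ev_mult) (simp_all add: xs)
    then show ?thesis using pos_square[OF ev_closed[OF xs(1)] sa[OF w]] by simp
  qed
  \<comment> \<open>The index 0 belongs to the root 1, whose term is the one to be bounded.\<close>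
  have "{..<2 * d + 1} = insert 0 (Suc ` {..<2 * d})" using lessThan_Suc_eq_insert_0[of "2 * d"] by simp
  then have "(\<Oplus>j\<in>{..<2 * d + 1}. ev (?w ^ j) ?y) = ev (?w ^ 0) ?y \<oplus> (\<Oplus>j\<in>Suc ` {..<2 * d}. ev (?w ^ j) ?y)"
    using y by (simp add: finsum_insert Pi_iff)
  also have "(\<Oplus>j\<in>Suc ` {..<2 * d}. ev (?w ^ j) ?y) = (\<Oplus>j\<in>{..<2 * d}. ev (?w ^ Suc j) ?y)"
    using y by (intro finsum_reindex) (auto simp: Pi_iff)
  finally have split: "(\<Oplus>j\<in>{..<2 * d + 1}. ev (?w ^ j) ?y) = ev 1 ?y \<oplus> (\<Oplus>j\<in>{..<2 * d}. ev (?w ^ Suc j) ?y)"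
    by simp
  have "cnorm E (ev 1 ?y) \<le> cnorm E (\<Oplus>j\<in>{..<2 * d + 1}. ev (?w ^ j) ?y)"
    unfolding split by (rule cnorm_pos_mono[OF _ pos_finsum[OF p]]) (use p[of 0] in simp)
  also have "\<dots> = cnorm E (cscale E (of_nat (2 * d + 1)) (\<rho> (coef0 ?y)))"
    using average_ev[OF y, of "2 * d + 1"] by simp
  also have "\<dots> = real (2 * d + 1) * cnorm E (\<rho> (coef0 ?y))"
    using rho_simps(1)[OF coef0_B[OF y(1)]] by (simp only: cnorm_cscale norm_of_nat)
  finally show ?thesis .
qed

end

section \<open>The gauge action\<close>

lemma (in unital_cstar_algebra) cnorm_finsum_le:
  "(\<And>j. j < n \<Longrightarrow> f j \<in> carrier A) \<Longrightarrow> (\<And>j. j < n \<Longrightarrow> cnorm A (f j) \<le> r) \<Longrightarrow>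
    cnorm A (\<Oplus>j\<in>{..<n::nat}. f j) \<le> real n * r"
proof (induction n)
  case (Suc n)
  have "(\<Oplus>j\<in>{..<Suc n}. f j) = f n \<oplus> (\<Oplus>j\<in>{..<n}. f j)"
    using Suc.prems(1) by (simp add: lessThan_Suc finsum_insert Pi_iff)
  then have "cnorm A (\<Oplus>j\<in>{..<Suc n}. f j) \<le> cnorm A (f n) + cnorm A (\<Oplus>j\<in>{..<n}. f j)"
    using Suc.prems(1) by (simp add: cnorm_triangle Pi_iff)
  also have "\<dots> \<le> r + real n * r" using Suc by (intro add_mono) auto
  finally show ?case by (simp add: algebra_simps)
qed simp

text \<open>The inclusion of \<open>B\<close> with \<open>J\<close> itself is a covariant pair, so
  all facts about words are available for operators under the prefix \<open>BH\<close>.\<close>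

sublocale isometry_setting \<subseteq> BH: cov_rep J B BH "\<lambda>x. x" J
proof (intro cov_rep.intro isometry_setting_axioms BH_cstar cov_rep_axioms.intro J_isometry)
  show "unital_star_hom (subalg B) BH (\<lambda>x. x)"
    unfolding unital_star_hom_def by (intro conjI star_homI) (simp_all add: B_carrier)
  show "J \<boxtimes> b \<boxtimes> star BH J = alpha J b" for b
    by (simp add: bounded_operators_simps alpha_def)
qed

locale gauge_setting = isometry_setting J B
  for J :: "'h::complex_hilbert_space \<Rightarrow> 'h" and B +
  fixes I :: "('h \<Rightarrow> 'h) set" and U :: "real \<Rightarrow> 'h \<Rightarrow> 'h"
  assumes I_ideal: "closed_ideal (subalg B) I"
    and alpha_I: "a \<in> I \<Longrightarrow> alpha J a \<in> I" and beta_I: "a \<in> I \<Longrightarrow> beta J a \<in> I"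
    and U_unitary: "unitary_in BH (U \<theta>)"
    and U_B: "a \<in> B \<Longrightarrow> U \<theta> \<circ> a = a \<circ> U \<theta>"
    and U_J: "U \<theta> \<circ> J = cscale BH (cis (2 * pi * \<theta>)) (J \<circ> U \<theta>)"
begin

sublocale BI: cstar_ideal "subalg B" I
  by (intro cstar_ideal.intro cstar_ideal_axioms.intro subalg_cstar I_ideal)

lemma U_simps:
  "U \<theta> \<in> carrier BH"
  "star BH (U \<theta>) \<boxtimes> U \<theta> = \<one>\<^bsub>BH\<^esub>"
  "U \<theta> \<boxtimes> star BH (U \<theta>) = \<one>\<^bsub>BH\<^esub>"
  "a \<in> B \<Longrightarrow> U \<theta> \<boxtimes> a = a \<boxtimes> U \<theta>"
  "U \<theta> \<boxtimes> J = cscale BH (cis (2 * pi * \<theta>)) (J \<boxtimes> U \<theta>)"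
  using U_unitary[of \<theta>] U_B[of a \<theta>] U_J[of \<theta>]
  unfolding unitary_in_def isometry_in_def by (auto simp only: bounded_operators_simps(2))

lemma U_adj_J:
  "U \<theta> \<boxtimes> BH.W = cscale BH (cnj (cis (2 * pi * \<theta>))) (BH.W \<boxtimes> U \<theta>)"
proof -
  let ?U = "U \<theta>" and ?S = "star BH (U \<theta>)" and ?z = "cis (2 * pi * \<theta>)"
  note c = U_simps(1)[of \<theta>] BH.star_closed[OF U_simps(1)[of \<theta>]] BH.star_closed[OF J_carrier] J_carrier
  have "BH.W \<boxtimes> ?S = cscale BH (cnj ?z) (?S \<boxtimes> BH.W)"
    using arg_cong[OF U_simps(5)[of \<theta>], of "star BH"] c by (simp add: BH.star_mult BH.star_cscale)
  then have "?U \<boxtimes> (BH.W \<boxtimes> ?S) \<boxtimes> ?U =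
      ?U \<boxtimes> cscale BH (cnj ?z) (?S \<boxtimes> BH.W) \<boxtimes> ?U"
    by simp
  moreover have "?U \<boxtimes> (BH.W \<boxtimes> ?S) \<boxtimes> ?U =
      ?U \<boxtimes> BH.W \<boxtimes> (?S \<boxtimes> ?U)"
    using c by (simp add: BH.m_assoc)
  moreover have "?U \<boxtimes> cscale BH (cnj ?z) (?S \<boxtimes> BH.W) \<boxtimes> ?U
      = cscale BH (cnj ?z) ((?U \<boxtimes> ?S) \<boxtimes> (BH.W \<boxtimes> ?U))"
    using c by (simp add: BH.m_assoc BH.cscale_mult_left BH.cscale_mult_right)
  ultimately show ?thesis using c by (simp add: U_simps)
qed

lemma twist_pow:
  fixes x u :: "'h \<Rightarrow> 'h"
  assumes x: "x \<in> carrier BH" and u: "u \<in> carrier BH"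
    and ux: "u \<boxtimes> x = cscale BH z (x \<boxtimes> u)"
  shows "u \<boxtimes> x [^]\<^bsub>BH\<^esub> (n::nat) =
    cscale BH (z ^ n) (x [^]\<^bsub>BH\<^esub> n \<boxtimes> u)"
proof (induction n)
  case (Suc n)
  have "u \<boxtimes> x [^]\<^bsub>BH\<^esub> Suc n =
      (u \<boxtimes> x [^]\<^bsub>BH\<^esub> n) \<boxtimes> x"
    using x u by (simp add: BH.m_assoc)
  also have "\<dots> = cscale BH (z ^ n) (x [^]\<^bsub>BH\<^esub> n \<boxtimes> (u \<boxtimes> x))"
    unfolding Suc using x u by (simp add: BH.m_assoc BH.cscale_mult_left)
  also have "\<dots> = cscale BH (z ^ Suc n) (x [^]\<^bsub>BH\<^esub> Suc n \<boxtimes> u)"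
    unfolding ux using x u by (simp add: BH.m_assoc BH.cscale_mult_right BH.cscale_cscale mult.commute)
  finally show ?case .
qed (use u in simp)

lemma U_wmono: assumes a: "a \<in> B"
  shows "U \<theta> \<boxtimes> BH.wmono k a =
    cscale BH (cis (2 * pi * \<theta>) powi k) (BH.wmono k a \<boxtimes> U \<theta>)"
proof (cases "k \<ge> 0")
  case True
  note c = U_simps(1)[of \<theta>] J_carrier B_carrier[OF a]
  have "U \<theta> \<boxtimes> BH.wmono k a = a \<boxtimes> (U \<theta> \<boxtimes> J [^]\<^bsub>BH\<^esub> nat k)"
    using True c U_simps(4)[OF a, of \<theta>] by (simp add: BH.wmono_def BH.m_assoc[symmetric])
  then show ?thesis
    unfolding twist_pow[OF c(2,1) U_simps(5)] using True c
    by (simp add: BH.wmono_def BH.m_assoc BH.cscale_mult_right power_int_def)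
next
  case False
  note c = U_simps(1)[of \<theta>] BH.star_closed[OF J_carrier] B_carrier[OF a]
  have "U \<theta> \<boxtimes> BH.wmono k a = (U \<theta> \<boxtimes> BH.W [^]\<^bsub>BH\<^esub> nat (-k)) \<boxtimes> a"
    using False c by (simp add: BH.wmono_def BH.m_assoc)
  also have "\<dots> = cscale BH (cnj (cis (2 * pi * \<theta>)) ^ nat (-k))
      (BH.W [^]\<^bsub>BH\<^esub> nat (-k) \<boxtimes> (a \<boxtimes> U \<theta>))"
    unfolding twist_pow[OF c(2,1) U_adj_J] U_simps(4)[OF a, of \<theta>, symmetric] using c
    by (simp add: BH.m_assoc BH.cscale_mult_left)
  also have "cnj (cis (2 * pi * \<theta>)) ^ nat (-k) = cis (2 * pi * \<theta>) powi k"
    using False by (simp add: power_int_def cis_cnj)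
  finally show ?thesis using False c by (simp add: BH.wmono_def BH.m_assoc)
qed

lemma U_ev: "xs \<in> words B \<Longrightarrow>
    U \<theta> \<boxtimes> BH.ev 1 xs = BH.ev (cis (2 * pi * \<theta>)) xs \<boxtimes> U \<theta>"
proof (induction xs)
  case (Cons p xs)
  obtain k a where p: "p = (k, a)" by fastforce
  have a: "a \<in> B" and xs: "xs \<in> words B" using Cons.prems p by auto
  show ?case
    using Cons.IH[OF xs] U_wmono[OF a, of \<theta> k] a xs p U_simps(1)[of \<theta>]
    by (simp add: BH.r_distr BH.l_distr BH.cscale_mult_left)
qed (simp add: U_simps(1))

text \<open>Twisting a word by a point of the circle is conjugation by one of the unitaries, which
  does not increase norms. The family \<open>U\<close> enters the argument through this
  estimate.\<close>

lemma cnorm_ev_circle: assumes xs: "xs \<in> words B"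
  shows "cnorm BH (BH.ev (cis t) xs) \<le> cnorm BH (BH.ev 1 xs)"
proof -
  define \<theta> where "\<theta> = t / (2 * pi)"
  have t: "2 * pi * \<theta> = t" by (simp add: \<theta>_def)
  let ?U = "U \<theta>" and ?S = "star BH (U \<theta>)"
  note c = U_simps(1)[of \<theta>] BH.star_closed[OF U_simps(1)[of \<theta>]] BH.ev_closed[OF xs]
  have "(cnorm BH ?U)\<^sup>2 \<le> 1\<^sup>2"
    using BH.cstar_identity[OF c(1)] BH.cnorm_one_le by (simp add: U_simps)
  then have nU: "cnorm BH ?U \<le> 1" by (rule power2_le_imp_le) simp
  have eq: "BH.ev (cis t) xs = (BH.ev (cis t) xs \<boxtimes> ?U) \<boxtimes> ?S"
    using c by (simp add: BH.m_assoc U_simps)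
  have "cnorm BH (BH.ev (cis t) xs) = cnorm BH ((?U \<boxtimes> BH.ev 1 xs) \<boxtimes> ?S)"
    unfolding U_ev[OF xs, of \<theta>] t using eq by simp
  also have "\<dots> \<le> cnorm BH (?U \<boxtimes> BH.ev 1 xs) * cnorm BH ?S"
    using c by (intro BH.cnorm_mult) auto
  also have "\<dots> \<le> cnorm BH (?U \<boxtimes> BH.ev 1 xs)"
    using c nU BH.cnorm_nonneg by (intro mult_right_le_one_le) auto
  also have "\<dots> \<le> cnorm BH ?U * cnorm BH (BH.ev 1 xs)"
    using c by (intro BH.cnorm_mult) auto
  also have "\<dots> \<le> cnorm BH (BH.ev 1 xs)"
    using c nU BH.cnorm_nonneg by (intro mult_left_le_one_le) auto
  finally show ?thesis .
qed

lemma coef0_le: assumes xs: "xs \<in> words B"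
  shows "cnorm BH (coef0 xs) \<le> cnorm BH (BH.ev 1 xs)"
proof -
  obtain d where d: "deg_le d xs" using deg_le_exists by blast
  let ?N = "Suc d"
  have "real ?N * cnorm BH (coef0 xs) = cnorm BH (cscale BH (of_nat ?N) (coef0 xs))"
    using B_carrier[OF coef0_B[OF xs]] by (simp only: BH.cnorm_cscale norm_of_nat)
  also have "\<dots> = cnorm BH (\<Oplus>\<^bsub>BH\<^esub>j\<in>{..<?N}. BH.ev (cis (2 * pi / ?N) ^ j) xs)"
    using BH.average_ev[OF xs d, of ?N] by simp
  also have "\<dots> \<le> real ?N * cnorm BH (BH.ev 1 xs)"
    by (rule BH.cnorm_finsum_le) (simp_all only: BH.ev_closed[OF xs] Complex.DeMoivre cnorm_ev_circle[OF xs])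
  finally show ?thesis by simp
qed

section \<open>The algebras generated by words\<close>

text \<open>The coefficient set is a parameter so that the generated algebra, with coefficients in
  \<open>B\<close>, and the generated ideal, with coefficients in \<open>I\<close>, are treated
  alike.\<close>

definition span_closure :: "('h \<Rightarrow> 'h) set \<Rightarrow> ('h \<Rightarrow> 'h) set" where
  "span_closure S = BH.ncl (BH.ev 1 ` words S)"

lemma ev_words_carrier: "S \<subseteq> B \<Longrightarrow> BH.ev 1 ` words S \<subseteq> carrier BH"
  using words_mono BH.ev_closed by blast

lemma span_closureE:
  assumes "x \<in> span_closure S"
  obtains xs where "\<And>n. xs n \<in> words S" "BH.nlim (\<lambda>n. BH.ev 1 (xs n)) x"
proof -
  obtain X where X: "BH.nlim X x" "\<And>n. X n \<in> BH.ev 1 ` words S"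
    using assms by (auto simp: span_closure_def BH.ncl_def)
  then have "\<forall>n. \<exists>ys\<in>words S. X n = BH.ev 1 ys" by blast
  then obtain xs where xs: "\<And>n. xs n \<in> words S" "\<And>n. X n = BH.ev 1 (xs n)" by metis
  then have "X = (\<lambda>n. BH.ev 1 (xs n))" by blast
  then show ?thesis using that xs(1) X(1) by blast
qed

lemma span_closureI: "(\<And>n. xs n \<in> words S) \<Longrightarrow> BH.nlim (\<lambda>n. BH.ev 1 (xs n)) x \<Longrightarrow> x \<in> span_closure S"
  by (auto simp: span_closure_def BH.ncl_def)

lemma ev_span_closure: "S \<subseteq> B \<Longrightarrow> xs \<in> words S \<Longrightarrow> BH.ev 1 xs \<in> span_closure S"
  by (rule span_closureI[of "\<lambda>_. xs"]) (use BH.nlim_const BH.ev_closed words_mono in blast)+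

lemma span_closure_subalgebra:
  assumes S: "S \<subseteq> B" "\<And>c a. a \<in> S \<Longrightarrow> (\<lambda>x. scaleC c (a x)) \<in> S" "\<And>a. a \<in> S \<Longrightarrow> adj a \<in> S"
    "\<And>k a l b. a \<in> S \<Longrightarrow> b \<in> S \<Longrightarrow> wmul J k a l b \<in> S"
  shows "cstar_subalgebra BH (span_closure S)"
  unfolding span_closure_def
proof (rule BH.cstar_subalgebra_ncl)
  show "BH.ev 1 ` words S \<subseteq> carrier BH" by (rule ev_words_carrier[OF S(1)])
  show "\<zero>\<^bsub>BH\<^esub> \<in> BH.ev 1 ` words S"
    by (rule image_eqI[of _ _ "[]"]) simp_all
  have SB: "xs \<in> words S \<Longrightarrow> xs \<in> words B" for xs using words_mono[OF S(1)] by blast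
  fix x assume "x \<in> BH.ev 1 ` words S"
  then obtain xs where xs: "xs \<in> words S" "x = BH.ev 1 xs" by blast
  show "cscale BH c x \<in> BH.ev 1 ` words S" for c
    by (rule image_eqI[OF _ wscale_words[OF S(2) xs(1)]]) (simp_all add: xs(2) BH.ev_scale[OF SB[OF xs(1)]])
  show "star BH x \<in> BH.ev 1 ` words S"
    by (rule image_eqI[OF _ wstar_words[OF S(3) xs(1)]]) (simp_all add: xs(2) BH.ev_star[OF _ SB[OF xs(1)]])
  fix y assume "y \<in> BH.ev 1 ` words S"
  then obtain ys where ys: "ys \<in> words S" "y = BH.ev 1 ys" by blast
  show "x \<boxplus> y \<in> BH.ev 1 ` words S"
    by (rule image_eqI[of _ _ "xs @ ys"]) (simp_all add: xs ys BH.ev_append SB)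
  show "x \<boxtimes> y \<in> BH.ev 1 ` words S"
    by (rule image_eqI[OF _ words_wtimes[OF S(4) xs(1) ys(1)]]) (simp_all add: xs ys BH.ev_mult SB)
qed

text \<open>The generators cover only the monomials of degree at least 0; those of negative degree
  are their adjoints, because \<open>S\<close> is closed under adjoints.\<close>

lemma span_closure_least:
  assumes T: "cstar_subalgebra BH T" and S: "S \<subseteq> B" "\<And>a. a \<in> S \<Longrightarrow> adj a \<in> S"
    and gen: "\<And>a n. a \<in> S \<Longrightarrow> a \<boxtimes> J [^]\<^bsub>BH\<^esub> (n::nat) \<in> T"
  shows "span_closure S \<subseteq> T"
  unfolding span_closure_def
proof (rule BH.ncl_subset[OF cstar_subalgebraD(7)[OF T]])
  have m: "BH.wmono k a \<in> T" if a: "a \<in> S" for k a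
  proof (cases "k \<ge> 0")
    case True
    then show ?thesis using gen[OF a] by (simp add: BH.wmono_def)
  next
    case False
    have aB: "adj a \<in> B" "a \<in> B" using a S by blast+
    have "adj (adj a) = a" by (rule adj_adj[OF B_carrier[OF aB(2)]])
    then have "BH.wmono k a = star BH (BH.wmono (-k) (adj a))"
      using BH.wmono_star[OF aB(1), of "-k"] by simp
    moreover have "BH.wmono (-k) (adj a) \<in> T" using gen[OF S(2)[OF a]] False by (simp add: BH.wmono_def)
    ultimately show ?thesis using cstar_subalgebraD(6)[OF T] by simp
  qed
  have "BH.ev 1 xs \<in> T" if "xs \<in> words S" for xs
    using that
  proof (induction xs)
    case (Cons p xs)
    then show ?case using m by (cases p) (auto intro!: cstar_subalgebraD(3,5)[OF T])
  qed (use cstar_subalgebraD(2)[OF T] in simp)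
  then show "BH.ev 1 ` words S \<subseteq> T" by blast
qed

lemma I_B: "I \<subseteq> B"
  using BI.a_subset by simp

lemma I_closed:
  "a \<in> I \<Longrightarrow> b \<in> B \<Longrightarrow> a \<circ> b \<in> I" "a \<in> B \<Longrightarrow> b \<in> I \<Longrightarrow> a \<circ> b \<in> I"
  "a \<in> I \<Longrightarrow> (\<lambda>x. scaleC c (a x)) \<in> I" "a \<in> I \<Longrightarrow> adj a \<in> I"
  "a \<in> I \<Longrightarrow> alphan J n a \<in> I" "a \<in> I \<Longrightarrow> betan J n a \<in> I"
  "a \<in> I \<Longrightarrow> b \<in> I \<Longrightarrow> (\<lambda>x. a x + b x) \<in> I" "(\<lambda>x. 0) \<in> I"
proof -
  show "a \<in> I \<Longrightarrow> b \<in> B \<Longrightarrow> a \<circ> b \<in> I" using BI.I_r_closed[of a b] by (simp add: bounded_operators_simps)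
  show "a \<in> B \<Longrightarrow> b \<in> I \<Longrightarrow> a \<circ> b \<in> I" using BI.I_l_closed[of b a] by (simp add: bounded_operators_simps)
  show "a \<in> I \<Longrightarrow> (\<lambda>x. scaleC c (a x)) \<in> I" using BI.cscale_ideal[of a c] by (simp add: bounded_operators_simps)
  show "a \<in> I \<Longrightarrow> adj a \<in> I" using BI.star_ideal[of a] by (simp add: bounded_operators_simps)
  show "a \<in> I \<Longrightarrow> alphan J n a \<in> I" unfolding alphan_def by (induction n) (auto intro: alpha_I)
  show "a \<in> I \<Longrightarrow> betan J n a \<in> I" unfolding betan_def by (induction n) (auto intro: beta_I)
  show "a \<in> I \<Longrightarrow> b \<in> I \<Longrightarrow> (\<lambda>x. a x + b x) \<in> I"
    using additive_subgroup.a_closed[OF BI.is_additive_subgroup, of a b] by (simp add: bounded_operators_simps)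
  show "(\<lambda>x. 0) \<in> I"
    using additive_subgroup.zero_closed[OF BI.is_additive_subgroup] by (simp add: bounded_operators_simps)
qed

text \<open>Both invariance assumptions enter here: moving a coefficient past the isometry applies
  \<open>alpha\<close>, and compressing by the isometry applies \<open>beta\<close>.\<close>

lemma wmul_I_left: "a \<in> I \<Longrightarrow> b \<in> B \<Longrightarrow> wmul J k a l b \<in> I"
  unfolding wmul_def by (auto intro!: I_closed(1,5,6) alphan_B id_B B_closed(1))

lemma wmul_I_right: "a \<in> B \<Longrightarrow> b \<in> I \<Longrightarrow> wmul J k a l b \<in> I"
  unfolding wmul_def by (auto intro!: I_closed(2,5,6) alphan_B id_B B_closed(1))

lemma funpow_J: "J ^^ n = J [^]\<^bsub>BH\<^esub> n"
  by (induction n) (simp_all add: bounded_operators_simps funpow_Suc_right del: funpow.simps(2))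

lemma alg_gen_eq: "alg_gen B J = span_closure B"
proof
  have gens: "B \<union> {J} \<subseteq> carrier BH" using B_carrier J_carrier by blast
  note sub = BH.cstar_subalgebra_generated[OF gens]
  show "alg_gen B J \<subseteq> span_closure B"
    unfolding alg_gen_def
  proof (rule cstar_generated_least)
    show "cstar_subalgebra BH (span_closure B)"
      by (rule span_closure_subalgebra) (auto intro: B_closed wmul_B)
    have "a \<in> span_closure B" if "a \<in> B" for a
      using ev_span_closure[of B "[(0, a)]"] that B_carrier[OF that] by (simp add: BH.wmono_def)
    moreover have "BH.wmono 1 id = J"
      using J_carrier by (simp add: BH.wmono_def) (simp add: bounded_operators_simps)
    then have "J \<in> span_closure B"
      using ev_span_closure[of B "[(1, id)]"] id_B J_carrier by simp
    ultimately show "B \<union> {J} \<subseteq> span_closure B" by blast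
  qed
  have J_alg: "J \<in> alg_gen B J" and B_alg: "B \<subseteq> alg_gen B J"
    using cstar_generated_superset[of "B \<union> {J}" BH] by (auto simp: alg_gen_def)
  have Jn: "J [^]\<^bsub>BH\<^esub> n \<in> alg_gen B J" for n :: nat
  proof (induction n)
    case 0
    then show ?case using subsetD[OF B_alg id_B] by (simp only: BH.nat_pow_0 bounded_operators_simps(3))
  next
    case (Suc n)
    then show ?case using cstar_subalgebraD(4)[OF sub] J_alg by (simp add: alg_gen_def)
  qed
  show "span_closure B \<subseteq> alg_gen B J"
    by (rule span_closure_least)
      (use sub B_alg Jn cstar_subalgebraD(4)[OF sub] B_closed in \<open>auto simp: alg_gen_def\<close>)
qed

lemma ideal_gen_eq: "ideal_gen I J = span_closure I"
proof
  have IB: "a \<in> I \<Longrightarrow> a \<in> B" for a using I_B by blast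
  let ?G = "{a \<circ> (J ^^ n) |a n. a \<in> I}"
  have gen: "a \<circ> (J ^^ n) = a \<boxtimes> J [^]\<^bsub>BH\<^esub> n" for a n
    by (simp add: funpow_J bounded_operators_simps(2))
  have gens: "?G \<subseteq> carrier BH"
    using B_carrier[OF IB] J_carrier unfolding gen by auto
  show "ideal_gen I J \<subseteq> span_closure I"
    unfolding ideal_gen_def
  proof (rule cstar_generated_least)
    show "cstar_subalgebra BH (span_closure I)"
      by (rule span_closure_subalgebra) (auto intro: I_closed IB wmul_I_left)
    have "a \<circ> (J ^^ n) \<in> span_closure I" if a: "a \<in> I" for a n
      using ev_span_closure[OF I_B, of "[(int n, a)]"] a B_carrier[OF IB[OF a]] J_carrier
      unfolding gen by (simp add: BH.wmono_def)
    then show "?G \<subseteq> span_closure I" by blast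
  qed
  show "span_closure I \<subseteq> ideal_gen I J"
    unfolding ideal_gen_def
  proof (rule span_closure_least[OF BH.cstar_subalgebra_generated[OF gens] I_B I_closed(4)])
    fix a and n :: nat assume "a \<in> I"
    then have "a \<circ> (J ^^ n) \<in> ?G" by blast
    then have "a \<circ> (J ^^ n) \<in> cstar_generated BH ?G" by (rule subsetD[OF cstar_generated_superset])
    then show "a \<boxtimes> J [^]\<^bsub>BH\<^esub> n \<in> cstar_generated BH ?G"
      by (simp only: gen[of a n])
  qed
qed

section \<open>The generated algebra and its ideal\<close>

abbreviation A where "A \<equiv> alg_gen B J"
abbreviation K where "K \<equiv> ideal_gen I J"

lemma A_subalgebra: "cstar_subalgebra BH A"
  unfolding alg_gen_eq by (rule span_closure_subalgebra) (auto intro: B_closed wmul_B)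

lemma K_subalgebra: "cstar_subalgebra BH K"
  unfolding ideal_gen_eq by (rule span_closure_subalgebra) (use I_B in \<open>auto intro: I_closed wmul_I_left\<close>)

lemma B_A: "B \<subseteq> A" and J_A: "J \<in> A"
  using cstar_generated_superset[of "B \<union> {J}" BH] by (auto simp: alg_gen_def)

lemma K_A: "K \<subseteq> A"
  unfolding ideal_gen_eq alg_gen_eq span_closure_def
  using words_mono[OF I_B] by (auto simp: BH.ncl_def) blast

lemma A_carrier: "x \<in> A \<Longrightarrow> x \<in> carrier BH"
  using cstar_subalgebraD(1)[OF A_subalgebra] by blast

lemma one_A: "\<one>\<^bsub>BH\<^esub> \<in> A"
  using subsetD[OF B_A id_B] by (simp only: bounded_operators_simps(3))

lemma A_cstar: "unital_cstar_algebra (subalg A)"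
  by (rule BH.subalgebra_cstar[OF A_subalgebra one_A])

text \<open>A product of words has coefficients in \<open>I\<close> as soon as one factor does;
  approximating both elements by words and passing to the limit gives the general case.\<close>

lemma K_mult:
  assumes x: "x \<in> A" and k: "k \<in> K"
  shows "x \<boxtimes> k \<in> K" "k \<boxtimes> x \<in> K"
proof -
  obtain xs where xs: "\<And>n. xs n \<in> words B" "BH.nlim (\<lambda>n. BH.ev 1 (xs n)) x"
    using x unfolding alg_gen_eq by (rule span_closureE) blast
  obtain ks where ks: "\<And>n. ks n \<in> words I" "BH.nlim (\<lambda>n. BH.ev 1 (ks n)) k"
    using k unfolding ideal_gen_eq by (rule span_closureE) blast
  have ksB: "ks n \<in> words B" for n using ks(1) words_mono[OF I_B] by blast
  show "x \<boxtimes> k \<in> K"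
    unfolding ideal_gen_eq
    using span_closureI[OF words_wtimes[OF wmul_I_right xs(1) ks(1)]] BH.nlim_mult[OF xs(2) ks(2)]
    by (simp add: BH.ev_mult xs(1) ksB)
  show "k \<boxtimes> x \<in> K"
    unfolding ideal_gen_eq
    using span_closureI[OF words_wtimes[OF wmul_I_left ks(1) xs(1)]] BH.nlim_mult[OF ks(2) xs(2)]
    by (simp add: BH.ev_mult xs(1) ksB)
qed

lemma K_closed_ideal: "closed_ideal (subalg A) K"
proof -
  interpret SA: unital_cstar_algebra "subalg A" by (rule A_cstar)
  have "ideal K (subalg A)"
  proof (rule idealI[OF SA.ring_axioms])
    show "subgroup K (add_monoid (subalg A))"
    proof (rule SA.add.subgroupI)
      show "K \<noteq> {}" using cstar_subalgebraD(2)[OF K_subalgebra] by blast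
      fix k assume k: "k \<in> K"
      have "\<ominus>\<^bsub>subalg A\<^esub> k = cscale BH (-1) k" using SA.minus_eq_cscale[of k] k K_A by auto
      then show "\<ominus>\<^bsub>subalg A\<^esub> k \<in> K" using cstar_subalgebraD(5)[OF K_subalgebra k, of "-1"] by simp
    qed (use K_A cstar_subalgebraD(3)[OF K_subalgebra] in auto)
  qed (use K_mult in simp_all)
  moreover have "norm_closed (subalg A) K"
    using BH.norm_closed_subalgebra[OF A_subalgebra one_A K_A] cstar_subalgebraD(7)[OF K_subalgebra] by simp
  ultimately show ?thesis by (simp add: closed_ideal_def)
qed

sublocale AK: cstar_ideal "subalg A" K
  by (intro cstar_ideal.intro cstar_ideal_axioms.intro A_cstar K_closed_ideal)

text \<open>The zeroth coefficient fixes \<open>b\<close> and contracts norms. Applied to words with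
  coefficients in \<open>I\<close> that approximate \<open>b\<close>, it yields elements of the
  closed ideal \<open>I\<close> converging to \<open>b\<close>.\<close>

lemma B_Int_K: assumes b: "b \<in> B" "b \<in> K" shows "b \<in> I"
proof -
  obtain ks where ks: "\<And>n. ks n \<in> words I" "BH.nlim (\<lambda>n. BH.ev 1 (ks n)) b"
    using b(2) unfolding ideal_gen_eq by (rule span_closureE) blast
  have ksB: "ks n \<in> words B" for n using ks(1) words_mono[OF I_B] by blast
  have c0: "xs \<in> words I \<Longrightarrow> coef0 xs \<in> I" for xs
    by (induction xs rule: coef0.induct) (auto intro: I_closed)
  have one: "\<one>\<^bsub>BH\<^esub> \<in> B" using id_B by (simp add: bounded_operators_simps)
  have cl: "norm_closed BH I"
    using I_ideal BH.norm_closed_subalgebra[OF B_subalgebra one I_B] by (simp add: closed_ideal_def)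
  \<comment> \<open>Appended as an entry of degree 0, the negative of \<open>b\<close> makes the
    difference of a word and \<open>b\<close> the value of a word again.\<close>
  let ?b = "\<lambda>x. scaleC (-1) (b x)"
  have bc: "b \<in> carrier BH" by (rule B_carrier[OF b(1)])
  have b': "?b \<in> B" "?b = \<ominus>\<^bsub>BH\<^esub> b"
    using B_closed(3)[OF b(1)] BH.minus_eq_cscale[OF bc] by (simp_all add: bounded_operators_simps)
  have "BH.nlim (\<lambda>n. coef0 (ks n)) b"
  proof (rule BH.nlimI_bound[OF _ bc _ BH.nlimD(3)[OF ks(2)]])
    fix n
    show c: "coef0 (ks n) \<in> carrier BH" by (rule B_carrier[OF coef0_B[OF ksB]])
    have "coef0 (ks n @ [(0, ?b)]) = coef0 (ks n) \<boxminus> b"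
      unfolding a_minus_def b'(2)[symmetric] coef0_append by (simp add: bounded_operators_simps)
    moreover have "BH.ev 1 (ks n @ [(0, ?b)]) = BH.ev 1 (ks n) \<boxminus> b"
      unfolding a_minus_def b'(2)[symmetric] using b'(1) B_carrier[OF b'(1)] ksB[of n]
      by (simp add: BH.ev_append BH.wmono_def)
    ultimately show "cnorm BH (coef0 (ks n) \<boxminus> b) \<le>
        cnorm BH (BH.ev 1 (ks n) \<boxminus> b)"
      using coef0_le[of "ks n @ [(0, ?b)]"] ksB[of n] b'(1) by simp
  qed
  then show ?thesis by (rule BH.norm_closedD[OF cl]) (rule c0[OF ks(1)])
qed

end

text \<open>If \<open>r\<close> exceeded \<open>s\<close>, the powers of \<open>r / s\<close> would
  outgrow every linear function of the exponent. The exponents are powers of two from 4 on, those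
  produced by squaring \<open>x* x\<close> at least once.\<close>

lemma le_if_powers_le:
  fixes r s :: real
  assumes "0 \<le> r" "0 \<le> s" and le: "\<And>j. r ^ (2 ^ (j + 2)) \<le> real (2 ^ (j + 2) * d + 1) * s ^ (2 ^ (j + 2))"
  shows "r \<le> s"
proof (rule ccontr)
  assume "\<not> r \<le> s"
  then have r: "r > s" by simp
  show False
  proof (cases "s = 0")
    case True
    then show False using le[of 0] r by (simp add: power_0_left)
  next
    case False
    then have s: "s > 0" using assms by simp
    define q where "q = r / s"
    have q: "q > 1" using r s by (simp add: q_def)
    \<comment> \<open>The linear bound \<open>n d + 1\<close> divided by the \<open>n\<close>-th
      power of \<open>q\<close>, split into two null sequences.\<close>
    have "(\<lambda>n. real d * (of_nat n / q ^ n) + (1 / q) ^ n) \<longlonglongrightarrow> real d * 0 + 0"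
      using q by (intro tendsto_intros lim_n_over_pown LIMSEQ_power_zero) (auto simp: norm_divide)
    then have "\<forall>\<^sub>F n in sequentially. real d * (of_nat n / q ^ n) + (1 / q) ^ n < 1"
      by (rule order_tendstoD) simp
    then obtain M where M: "\<And>n. n \<ge> M \<Longrightarrow> real d * (of_nat n / q ^ n) + (1 / q) ^ n < 1"
      unfolding eventually_sequentially by blast
    \<comment> \<open>An exponent of the admissible form that also exceeds the threshold
      \<open>M\<close>.\<close>
    define n :: nat where "n = 2 ^ (M + 2)"
    have "M < 2 ^ M" by (rule less_exp)
    also have "(2::nat) ^ M \<le> n" unfolding n_def by (rule power_increasing) auto
    finally have "real d * (of_nat n / q ^ n) + (1 / q) ^ n < 1" using M[of n] by simp
    then have "real (n * d + 1) < q ^ n" using q by (simp add: field_simps power_divide)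
    moreover have "q ^ n \<le> real (n * d + 1)"
      using le[of M] s unfolding n_def[symmetric] by (simp add: q_def power_divide divide_le_eq)
    ultimately show False by simp
  qed
qed

section \<open>Representations of the quotient\<close>

text \<open>Words for the powers of \<open>x* x\<close> with exponent \<open>2^j\<close>. Repeated
  squaring makes every stage after the first the square of a word with self-adjoint values, the form
  that \<open>cnorm_ev_square_le\<close> requires.\<close>

primrec wtower :: "('h::complex_hilbert_space \<Rightarrow> 'h) \<Rightarrow> 'h word \<Rightarrow> nat \<Rightarrow> 'h word" where
  "wtower J xs 0 = wtimes J (wstar xs) xs"
| "wtower J xs (Suc j) = wtimes J (wtower J xs j) (wtower J xs j)"

context cov_rep
begin

lemma wtower_B: "xs \<in> words B \<Longrightarrow> wtower J xs j \<in> words B"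
  by (induction j) (auto intro!: wtimes_B wstar_words B_closed)

lemma wtower_deg: "deg_le d xs \<Longrightarrow> deg_le (2 ^ (j + 1) * d) (wtower J xs j)"
proof (induction j)
  case 0
  then show ?case using deg_le_wtimes[OF deg_le_wstar[OF 0] 0] by (simp add: mult_2)
next
  case (Suc j)
  then show ?case using deg_le_wtimes[OF Suc.IH[OF Suc.prems] Suc.IH[OF Suc.prems], of J] by (simp add: mult_2 algebra_simps)
qed

lemma ev_wtower_0: "xs \<in> words B \<Longrightarrow> cmod z = 1 \<Longrightarrow> ev z (wtower J xs 0) = star E (ev z xs) \<otimes> ev z xs"
  by (subst wtower.simps, subst ev_mult) (auto simp: ev_star intro!: wstar_words B_closed)

lemma ev_wtower_Suc: "xs \<in> words B \<Longrightarrow> cmod z = 1 \<Longrightarrow>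
    ev z (wtower J xs (Suc j)) = ev z (wtower J xs j) \<otimes> ev z (wtower J xs j)"
  by (subst wtower.simps, rule ev_mult) (auto intro!: wtower_B)

lemma wtower_sa: assumes xs: "xs \<in> words B" and z: "cmod z = 1"
  shows "star E (ev z (wtower J xs j)) = ev z (wtower J xs j)"
proof (induction j)
  case 0
  then show ?case unfolding ev_wtower_0[OF assms] using xs by (simp add: star_mult)
next
  case (Suc j)
  then show ?case unfolding ev_wtower_Suc[OF assms] using wtower_B[OF xs] by (simp add: star_mult)
qed

lemma cnorm_wtower: assumes xs: "xs \<in> words B"
  shows "cnorm E (ev 1 (wtower J xs j)) = cnorm E (ev 1 xs) ^ (2 ^ (j + 1))"
proof (induction j)
  case 0
  then show ?case using ev_wtower_0[OF xs, of 1] xs by (simp add: cstar_identity)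
next
  case (Suc j)
  have "cnorm E (ev 1 (wtower J xs (Suc j))) = (cnorm E (ev 1 (wtower J xs j)))\<^sup>2"
    using ev_wtower_Suc[OF xs, of 1 j] cnorm_square[OF ev_closed[OF wtower_B[OF xs]] wtower_sa[OF xs, of 1]] by simp
  then show ?case unfolding Suc by (simp add: power_mult[symmetric] mult.commute)
qed

end

context gauge_setting
begin

lemma K_carrier: "k \<in> K \<Longrightarrow> k \<in> carrier BH"
  using K_A A_carrier by blast

lemma ideal_coset_mult:
  assumes "x \<in> A" "y \<in> A" "k \<in> K" "l \<in> K"
  shows "\<exists>m\<in>K. (x \<boxplus> k) \<boxtimes> (y \<boxplus> l) =
    x \<boxtimes> y \<boxplus> m"
proof -
  let ?m = "x \<boxtimes> l \<boxplus>
    (k \<boxtimes> y \<boxplus> k \<boxtimes> l)"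
  have "?m \<in> K"
    using assms K_mult cstar_subalgebraD(3,4)[OF K_subalgebra] by simp
  moreover have "(x \<boxplus> k) \<boxtimes> (y \<boxplus> l) =
      x \<boxtimes> y \<boxplus> ?m"
    using assms A_carrier K_carrier by (simp add: BH.l_distr BH.r_distr BH.a_ac)
  ultimately show ?thesis by blast
qed

lemma ev_A: "xs \<in> words B \<Longrightarrow> BH.ev 1 xs \<in> A"
  unfolding alg_gen_eq by (rule ev_span_closure) auto

text \<open>The C*-identity and submultiplicativity are applied to the representative
  \<open>x + k\<close>; its powers differ from those of \<open>x\<close> by elements of the
  ideal.\<close>

lemma wtower_mod_K:
  assumes xs: "xs \<in> words B" and k: "k \<in> K"
  shows "\<exists>k'\<in>K. cnorm BH (BH.ev 1 (wtower J xs j) \<boxplus> k') \<le>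
    cnorm BH (BH.ev 1 xs \<boxplus> k) ^ (2 ^ (j + 1))"
proof (induction j)
  case 0
  let ?x = "BH.ev 1 xs"
  note x = ev_A[OF xs] A_carrier[OF ev_A[OF xs]]
  note kc = K_carrier[OF k]
  have sx: "star BH ?x \<in> A" "star BH k \<in> K"
    using cstar_subalgebraD(6)[OF A_subalgebra x(1)] cstar_subalgebraD(6)[OF K_subalgebra k] by simp_all
  obtain m where m: "m \<in> K" "(star BH ?x \<boxplus> star BH k) \<boxtimes> (?x \<boxplus> k) =
      star BH ?x \<boxtimes> ?x \<boxplus> m"
    using ideal_coset_mult[OF sx(1) x(1) sx(2) k] by blast
  have "cnorm BH (BH.ev 1 (wtower J xs 0) \<boxplus> m) =
      (cnorm BH (?x \<boxplus> k))\<^sup>2"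
    using BH.cstar_identity[of "?x \<boxplus> k"] x kc m(2) BH.ev_wtower_0[OF xs, of 1]
    by (simp add: BH.star_add del: wtower.simps)
  then show ?case using m(1) by (intro bexI[of _ m]) simp_all
next
  case (Suc j)
  then obtain k' where k': "k' \<in> K" "cnorm BH (BH.ev 1 (wtower J xs j) \<boxplus> k') \<le>
    cnorm BH (BH.ev 1 xs \<boxplus> k) ^ (2 ^ (j + 1))" by blast
  let ?y = "BH.ev 1 (wtower J xs j)"
  note y = ev_A[OF BH.wtower_B[OF xs], of j] A_carrier[OF ev_A[OF BH.wtower_B[OF xs], of j]]
  note kc = K_carrier[OF k'(1)]
  obtain m where m: "m \<in> K" "(?y \<boxplus> k') \<boxtimes> (?y \<boxplus> k') =
      ?y \<boxtimes> ?y \<boxplus> m"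
    using ideal_coset_mult[OF y(1) y(1) k'(1) k'(1)] by blast
  have "cnorm BH (BH.ev 1 (wtower J xs (Suc j)) \<boxplus> m) \<le>
      cnorm BH (?y \<boxplus> k') * cnorm BH (?y \<boxplus> k')"
    unfolding BH.ev_wtower_Suc[OF xs norm_one] m(2)[symmetric] using y kc by (intro BH.cnorm_mult) auto
  also have "\<dots> \<le> cnorm BH (BH.ev 1 xs \<boxplus> k) ^ (2 ^ (j + 1)) *
      cnorm BH (BH.ev 1 xs \<boxplus> k) ^ (2 ^ (j + 1))"
    using k'(2) y kc BH.cnorm_nonneg by (intro mult_mono) auto
  also have "\<dots> = cnorm BH (BH.ev 1 xs \<boxplus> k) ^ (2 ^ (Suc j + 1))"
    by (simp add: power_add[symmetric] mult_2)
  finally show ?case using m(1) by blast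
qed

end

locale gauge_rep = gauge_setting J B I U + cov_rep J B E \<rho> V
  for J :: "'h::complex_hilbert_space \<Rightarrow> 'h" and B I U and E :: "'e cstar" (structure) and \<rho> V +
  assumes rho_I: "a \<in> I \<Longrightarrow> \<rho> a = \<zero>"
begin

text \<open>Appending a word with coefficients in \<open>I\<close> leaves the image of the zeroth
  coefficient under \<open>\<rho>\<close> unchanged. Hence contractivity of \<open>\<rho>\<close>
  and of the zeroth coefficient bounds it by the norm of each perturbed word, and such perturbations
  approximate every \<open>k\<close> in the ideal.\<close>

lemma cnorm_rho_coef0_le:
  assumes xs: "xs \<in> words B" and k: "k \<in> K"
  shows "cnorm E (\<rho> (coef0 xs)) \<le> cnorm BH (BH.ev 1 xs \<boxplus> k)"
proof -
  obtain ks where ks: "\<And>n. ks n \<in> words I" "BH.nlim (\<lambda>n. BH.ev 1 (ks n)) k"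
    using k unfolding ideal_gen_eq by (rule span_closureE) blast
  have ksB: "ks n \<in> words B" for n using ks(1) words_mono[OF I_B] by blast
  have c0: "ys \<in> words I \<Longrightarrow> coef0 ys \<in> I" for ys
    by (induction ys rule: coef0.induct) (auto intro: I_closed)
  have "cnorm E (\<rho> (coef0 xs)) \<le> cnorm BH (BH.ev 1 xs \<boxplus> BH.ev 1 (ks n))" for n
  proof -
    have w: "xs @ ks n \<in> words B" using xs ksB by simp
    have "\<rho> (coef0 xs) = \<rho> (coef0 (xs @ ks n))"
      using coef0_B[OF xs] coef0_B[OF ksB] rho_I[OF c0[OF ks(1)], of n]
      by (simp add: coef0_append rho_simps)
    also have "cnorm E \<dots> \<le> cnorm BH (coef0 (xs @ ks n))"
      using unital_star_hom_cnorm_le[OF subalg_cstar unital_cstar_algebra_axioms rho, of "coef0 (xs @ ks n)"]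
        coef0_B[OF w] by simp
    also have "\<dots> \<le> cnorm BH (BH.ev 1 (xs @ ks n))" by (rule coef0_le[OF w])
    finally show ?thesis by (simp add: BH.ev_append xs ksB)
  qed
  moreover have "(\<lambda>n. cnorm BH (BH.ev 1 xs \<boxplus> BH.ev 1 (ks n))) \<longlonglongrightarrow>
      cnorm BH (BH.ev 1 xs \<boxplus> k)"
    by (intro BH.nlim_norm BH.nlim_add BH.nlim_const ks(2) BH.ev_closed xs)
  ultimately show ?thesis by (meson LIMSEQ_le_const)
qed

text \<open>The zeroth coefficient of a power of \<open>x* x\<close> loses only a factor linear in the exponent, which
  disappears on taking roots.\<close>

lemma cnorm_ev_le:
  assumes xs: "xs \<in> words B" and k: "k \<in> K"
  shows "cnorm E (ev 1 xs) \<le> cnorm BH (BH.ev 1 xs \<boxplus> k)"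
proof -
  obtain d where d: "deg_le d xs" using deg_le_exists by blast
  have xk: "BH.ev 1 xs \<boxplus> k \<in> carrier BH"
    using K_carrier[OF k] BH.ev_closed[OF xs] by simp
  show ?thesis
  proof (rule le_if_powers_le[where d=d])
    fix j
    let ?y = "wtower J xs j"
    obtain k' where k': "k' \<in> K" "cnorm BH (BH.ev 1 (wtower J xs (Suc j)) \<boxplus> k') \<le>
      cnorm BH (BH.ev 1 xs \<boxplus> k) ^ (2 ^ (Suc j + 1))"
      using wtower_mod_K[OF xs k] by blast
    have "cnorm E (ev 1 xs) ^ (2 ^ (Suc j + 1)) = cnorm E (ev 1 (wtower J xs (Suc j)))"
      by (rule cnorm_wtower[OF xs, symmetric])
    \<comment> \<open>Stage \<open>Suc j\<close> is the square of stage \<open>j\<close>, whose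
      values are self-adjoint and whose degree is at most \<open>2 ^ (j + 1) * d\<close>; this is
      the linear growth of the factor.\<close>
    also have "\<dots> \<le> real (2 * (2 ^ (j + 1) * d) + 1) * cnorm E (\<rho> (coef0 (wtower J xs (Suc j))))"
      unfolding wtower.simps by (rule cnorm_ev_square_le[OF wtower_B[OF xs] wtower_deg[OF d] wtower_sa[OF xs]])
    also have "\<dots> \<le> real (2 * (2 ^ (j + 1) * d) + 1) * cnorm BH (BH.ev 1 xs \<boxplus> k) ^ (2 ^ (Suc j + 1))"
      by (rule mult_left_mono[OF order_trans[OF cnorm_rho_coef0_le[OF wtower_B[OF xs] k'(1)] k'(2)]]) simp
    finally show "cnorm E (ev 1 xs) ^ (2 ^ (j + 2)) \<le>
        real (2 ^ (j + 2) * d + 1) * cnorm BH (BH.ev 1 xs \<boxplus> k) ^ (2 ^ (j + 2))"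
      by (simp add: mult.assoc)
  qed (use cnorm_nonneg ev_closed[OF xs] BH.cnorm_nonneg[OF xk] in auto)
qed

text \<open>The graph of the extension: both components are approximated by one common sequence of
  words. A relation comes first because an operator does not determine a word.\<close>

definition ext_rel :: "('h \<Rightarrow> 'h) \<Rightarrow> 'e \<Rightarrow> bool" where
  "ext_rel x f \<longleftrightarrow> (\<exists>xs. (\<forall>n. xs n \<in> words B) \<and> BH.nlim (\<lambda>n. BH.ev 1 (xs n)) x \<and> nlim (\<lambda>n. ev 1 (xs n)) f)"

lemma ext_relE:
  assumes "ext_rel x f"
  obtains xs where "\<And>n. xs n \<in> words B" "BH.nlim (\<lambda>n. BH.ev 1 (xs n)) x" "nlim (\<lambda>n. ev 1 (xs n)) f"
  using assms unfolding ext_rel_def by blast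

lemma ext_relI:
  "(\<And>n. xs n \<in> words B) \<Longrightarrow> BH.nlim (\<lambda>n. BH.ev 1 (xs n)) x \<Longrightarrow> nlim (\<lambda>n. ev 1 (xs n)) f \<Longrightarrow> ext_rel x f"
  unfolding ext_rel_def by blast

lemma ext_rel_carrier: "ext_rel x f \<Longrightarrow> x \<in> carrier BH" "ext_rel x f \<Longrightarrow> f \<in> carrier E"
  by (auto elim!: ext_relE dest: BH.nlimD(2) nlimD(2))

lemma cnorm_ev_diff_le:
  assumes xs: "xs \<in> words B" and ys: "ys \<in> words B" and k: "k \<in> K"
  shows "cnorm E (ev 1 xs \<ominus> ev 1 ys) \<le>
    cnorm BH ((BH.ev 1 xs \<boxminus> BH.ev 1 ys) \<boxplus> k)"
proof -
  have m: "wscale (-1) ys \<in> words B" by (rule wscale_words[OF B_closed(3) ys])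
  have "ev 1 (xs @ wscale (-1) ys) = ev 1 xs \<ominus> ev 1 ys"
    using xs ys m by (simp add: ev_append ev_scale a_minus_def minus_eq_cscale)
  moreover have "BH.ev 1 (xs @ wscale (-1) ys) = BH.ev 1 xs \<boxminus> BH.ev 1 ys"
    using xs ys m by (simp add: BH.ev_append BH.ev_scale a_minus_def BH.minus_eq_cscale)
  ultimately show ?thesis using cnorm_ev_le[of "xs @ wscale (-1) ys" k] xs m k by simp
qed

text \<open>Equality is asserted for arguments congruent modulo the ideal, which gives at once that
  the extension is well defined and that it vanishes on the ideal.\<close>

lemma ext_rel_unique:
  assumes f: "ext_rel x f" and g: "ext_rel y g" and xy: "x \<boxminus> y \<in> K"
  shows "f = g"
proof -
  obtain xs where xs: "\<And>n. xs n \<in> words B" "BH.nlim (\<lambda>n. BH.ev 1 (xs n)) x" "nlim (\<lambda>n. ev 1 (xs n)) f"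
    using f by (rule ext_relE) blast
  obtain ys where ys: "\<And>n. ys n \<in> words B" "BH.nlim (\<lambda>n. BH.ev 1 (ys n)) y" "nlim (\<lambda>n. ev 1 (ys n)) g"
    using g by (rule ext_relE) blast
  note c = ext_rel_carrier[OF f] ext_rel_carrier[OF g]
  let ?d = "x \<boxminus> y"
  have dc: "?d \<in> carrier BH" using c by simp
  \<comment> \<open>With this perturbation the right-hand sides of the norm estimate converge to
    zero.\<close>
  have k: "\<ominus>\<^bsub>BH\<^esub> ?d \<in> K" by (rule BH.subalgebra_minus[OF K_subalgebra xy])
  have "cnorm E (f \<ominus> g) \<le> cnorm BH (?d \<boxplus> \<ominus>\<^bsub>BH\<^esub> ?d)"
  proof (rule LIMSEQ_le)
    show "(\<lambda>n. cnorm E (ev 1 (xs n) \<ominus> ev 1 (ys n))) \<longlonglongrightarrow> cnorm E (f \<ominus> g)"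
      by (intro nlim_norm nlim_diff xs ys)
    show "(\<lambda>n. cnorm BH ((BH.ev 1 (xs n) \<boxminus> BH.ev 1 (ys n)) \<boxplus> \<ominus>\<^bsub>BH\<^esub> ?d))
        \<longlonglongrightarrow> cnorm BH (?d \<boxplus> \<ominus>\<^bsub>BH\<^esub> ?d)"
      by (intro BH.nlim_norm BH.nlim_add BH.nlim_diff BH.nlim_const xs ys BH.a_inv_closed dc)
  qed (use cnorm_ev_diff_le[OF xs(1) ys(1) k] in blast)
  also have "\<dots> = 0" using dc by (simp add: BH.r_neg)
  finally show ?thesis using cnorm_nonneg[of "f \<ominus> g"] c eq_if_cnorm_diff_0 by fastforce
qed

text \<open>The norm estimate with perturbation zero makes evaluation in \<open>E\<close>
  contractive on differences of words, so it turns words approximating \<open>x\<close> into a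
  Cauchy sequence.\<close>

lemma ext_rel_exists: assumes x: "x \<in> A" shows "\<exists>f. ext_rel x f"
proof -
  obtain xs where xs: "\<And>n. xs n \<in> words B" "BH.nlim (\<lambda>n. BH.ev 1 (xs n)) x"
    using x unfolding alg_gen_eq by (rule span_closureE) blast
  note c = BH.ev_closed[OF xs(1)] A_carrier[OF x]
  have zK: "\<zero>\<^bsub>BH\<^esub> \<in> K" using cstar_subalgebraD(2)[OF K_subalgebra] .
  have "\<exists>f. nlim (\<lambda>n. ev 1 (xs n)) f"
  proof (rule nlim_exists)
    fix e :: real assume "e > 0"
    then have "e/2 > 0" by simp
    then have "\<forall>\<^sub>F n in sequentially. cnorm BH (BH.ev 1 (xs n) \<boxminus> x) < e/2"
      by (rule order_tendstoD(2)[OF BH.nlimD(3)[OF xs(2)]])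
    then obtain N where N: "\<And>n. n \<ge> N \<Longrightarrow> cnorm BH (BH.ev 1 (xs n) \<boxminus> x) < e/2"
      unfolding eventually_sequentially by blast
    have "cnorm E (ev 1 (xs m) \<ominus> ev 1 (xs n)) < e" if "m \<ge> N" "n \<ge> N" for m n
    proof -
      have "cnorm E (ev 1 (xs m) \<ominus> ev 1 (xs n)) \<le> cnorm BH (BH.ev 1 (xs m) \<boxminus> BH.ev 1 (xs n))"
        using cnorm_ev_diff_le[OF xs(1) xs(1) zK, of m n] c by simp
      also have "\<dots> \<le> cnorm BH (BH.ev 1 (xs m) \<boxminus> x) + cnorm BH (x \<boxminus> BH.ev 1 (xs n))"
        using c by (intro BH.cnorm_diff_trans) auto
      also have "cnorm BH (x \<boxminus> BH.ev 1 (xs n)) = cnorm BH (BH.ev 1 (xs n) \<boxminus> x)"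
        using c by (intro BH.cnorm_diff_commute) auto
      finally show ?thesis using N[OF that(1)] N[OF that(2)] by simp
    qed
    then show "\<exists>N. \<forall>m\<ge>N. \<forall>n\<ge>N. cnorm E (ev 1 (xs m) \<ominus> ev 1 (xs n)) < e" by blast
  qed (simp add: xs(1))
  then show ?thesis using ext_relI[OF xs] by blast
qed

lemma ext_rel_hom:
  "ext_rel x f \<Longrightarrow> ext_rel y g \<Longrightarrow> ext_rel (x \<boxplus> y) (f \<oplus> g)"
  "ext_rel x f \<Longrightarrow> ext_rel y g \<Longrightarrow> ext_rel (x \<boxtimes> y) (f \<otimes> g)"
  "ext_rel x f \<Longrightarrow> ext_rel (cscale BH c x) (cscale E c f)"
  "ext_rel x f \<Longrightarrow> ext_rel (star BH x) (star E f)"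
proof -
  assume "ext_rel x f"
  then obtain xs where xs: "\<And>n. xs n \<in> words B" "BH.nlim (\<lambda>n. BH.ev 1 (xs n)) x" "nlim (\<lambda>n. ev 1 (xs n)) f"
    by (rule ext_relE) blast
  show "ext_rel (cscale BH c x) (cscale E c f)"
    by (rule ext_relI[of "\<lambda>n. wscale c (xs n)"])
      (use xs BH.nlim_cscale nlim_cscale wscale_words[OF B_closed(3)] in \<open>simp_all add: BH.ev_scale ev_scale\<close>)
  show "ext_rel (star BH x) (star E f)"
    by (rule ext_relI[of "\<lambda>n. wstar (xs n)"])
      (use xs BH.nlim_star nlim_star wstar_words[OF B_closed(4)] in \<open>simp_all add: BH.ev_star ev_star\<close>)
  assume "ext_rel y g"
  then obtain ys where ys: "\<And>n. ys n \<in> words B" "BH.nlim (\<lambda>n. BH.ev 1 (ys n)) y" "nlim (\<lambda>n. ev 1 (ys n)) g"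
    by (rule ext_relE) blast
  show "ext_rel (x \<boxplus> y) (f \<oplus> g)"
    by (rule ext_relI[of "\<lambda>n. xs n @ ys n"])
      (use xs ys BH.nlim_add nlim_add in \<open>simp_all add: BH.ev_append ev_append\<close>)
  show "ext_rel (x \<boxtimes> y) (f \<otimes> g)"
    by (rule ext_relI[of "\<lambda>n. wtimes J (xs n) (ys n)"])
      (use xs ys BH.nlim_mult nlim_mult wtimes_B in \<open>simp_all add: BH.ev_mult ev_mult\<close>)
qed

lemma ext_rel_word: "xs \<in> words B \<Longrightarrow> ext_rel (BH.ev 1 xs) (ev 1 xs)"
  by (rule ext_relI[of "\<lambda>_. xs"]) (simp_all add: BH.nlim_const nlim_const)

lemma ext_rel_rho: "b \<in> B \<Longrightarrow> ext_rel b (\<rho> b)"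
  using ext_rel_word[of "[(0, b)]"] B_carrier[of b] by (simp add: wmono_def BH.wmono_def rho_simps)

lemma ext_rel_V: "ext_rel J V"
proof -
  have "BH.wmono 1 id = J"
    using J_carrier by (simp add: BH.wmono_def) (simp add: bounded_operators_simps)
  moreover have "wmono 1 id = V" using rho_simps(6) by (simp add: wmono_def)
  ultimately show ?thesis using ext_rel_word[of "[(1, id)]"] id_B J_carrier by simp
qed

lemma extension_exists:
  "\<exists>\<phi>. star_hom (subalg A) E \<phi> \<and> (\<forall>b\<in>B. \<phi> b = \<rho> b) \<and> \<phi> J = V \<and> (\<forall>k\<in>K. \<phi> k = \<zero>)"
proof -
  have zK: "\<zero>\<^bsub>BH\<^esub> \<in> K" using cstar_subalgebraD(2)[OF K_subalgebra] .
  define \<phi> where "\<phi> x = (THE f. ext_rel x f)" for x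
  have eq: "\<phi> x = f" if "ext_rel x f" for x f
    unfolding \<phi>_def
  proof (rule the_equality)
    show "ext_rel x f" by (fact that)
    fix g assume "ext_rel x g"
    then show "g = f" using ext_rel_unique[OF _ that] ext_rel_carrier(1)[OF that] zK by simp
  qed
  have rel: "ext_rel x (\<phi> x)" if "x \<in> A" for x
    using ext_rel_exists[OF that] eq by blast
  have "star_hom (subalg A) E \<phi>"
    by (rule star_homI) (auto intro!: eq ext_rel_hom rel intro: ext_rel_carrier(2)[OF rel])
  moreover have "\<phi> k = \<zero>" if k: "k \<in> K" for k
  proof -
    have "ext_rel \<zero>\<^bsub>BH\<^esub> \<zero>" using ext_rel_word[of "[]"] by simp
    moreover have "k \<boxminus> \<zero>\<^bsub>BH\<^esub> \<in> K"
      by (rule BH.subalgebra_diff[OF K_subalgebra k zK])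
    ultimately show ?thesis using ext_rel_unique rel K_A k by blast
  qed
  ultimately show ?thesis using eq[OF ext_rel_rho] eq[OF ext_rel_V] by blast
qed

end

section \<open>The crossed product\<close>

lemma unital_star_hom_comp:
  "unital_star_hom C D f \<Longrightarrow> unital_star_hom D E g \<Longrightarrow> unital_star_hom C E (\<lambda>x. g (f x))"
  by (auto simp: unital_star_hom_def star_hom_def Pi_iff)

text \<open>The set on which both maps agree is a subalgebra, and it is closed because homomorphisms
  are contractive.\<close>

lemma unital_star_hom_eq_on_generated:
  assumes C: "unital_cstar_algebra C" and D: "unital_cstar_algebra D"
    and f: "unital_star_hom C D f" and g: "unital_star_hom C D g"
    and X: "X \<subseteq> carrier C" "\<And>x. x \<in> X \<Longrightarrow> f x = g x"
    and gen: "cstar_generated C X = carrier C" and x: "x \<in> carrier C"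
  shows "f x = g x"
proof -
  interpret C: unital_cstar_algebra C by fact
  interpret D: unital_cstar_algebra D by fact
  let ?S = "{x \<in> carrier C. f x = g x}"
  have sf: "star_hom C D f" and sg: "star_hom C D g" using f g by (simp_all add: unital_star_hom_def)
  note fD = star_homD[OF sf] and gD = star_homD[OF sg]
  have lim: "D.nlim (\<lambda>n. h (Y n)) (h y)" if h: "unital_star_hom C D h" and Y: "C.nlim Y y" for h Y y
  proof (rule D.nlimI_bound[OF _ _ _ C.nlimD(3)[OF Y]])
    have sh: "star_hom C D h" using h by (simp add: unital_star_hom_def)
    note c = C.nlimD(1,2)[OF Y]
    show "h (Y n) \<in> carrier D" "h y \<in> carrier D" for n using star_homD(1)[OF sh] c by blast+
    show "cnorm D (h (Y n) \<ominus>\<^bsub>D\<^esub> h y) \<le> cnorm C (Y n \<ominus>\<^bsub>C\<^esub> y)" for n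
      using unital_star_hom_cnorm_le[OF C D h, of "Y n \<ominus>\<^bsub>C\<^esub> y"] star_hom_diff[OF C D sh, of "Y n" y] c by simp
  qed
  have "cstar_subalgebra C ?S"
  proof (rule cstar_subalgebraI)
    show "\<zero>\<^bsub>C\<^esub> \<in> ?S" using star_hom_zero[OF C D sf] star_hom_zero[OF C D sg] by simp
    show "norm_closed C ?S"
    proof (rule C.norm_closedI)
      fix Y y assume Y: "C.nlim Y y" "\<And>n. Y n \<in> ?S"
      have "D.nlim (\<lambda>n. f (Y n)) (g y)" using lim[OF g Y(1)] Y(2) by simp
      then show "y \<in> ?S" using D.nlim_unique[OF lim[OF f Y(1)]] C.nlimD(2)[OF Y(1)] by simp
    qed blast
  qed (auto simp: fD gD)
  then have "cstar_generated C X \<subseteq> ?S" using X by (intro cstar_generated_least) auto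
  then show ?thesis using gen x by blast
qed

context gauge_setting
begin

abbreviation Q where "Q \<equiv> cstar_quotient (subalg B) I"
abbreviation P where "P \<equiv> cstar_quotient (subalg A) K"
abbreviation qB where "qB b \<equiv> I +>\<^bsub>subalg B\<^esub> b"
abbreviation qA where "qA x \<equiv> K +>\<^bsub>subalg A\<^esub> x"
abbreviation alQ where "alQ \<equiv> coset_map (subalg B) I (alpha J)"
abbreviation inc where "inc \<equiv> coset_map (subalg A) K id"

section \<open>The induced endomorphism of the quotient\<close>

lemma alpha_hom:
  "a \<in> B \<Longrightarrow> b \<in> B \<Longrightarrow> alpha J (a \<boxtimes> b) = alpha J a \<boxtimes> alpha J b"
  "a \<in> B \<Longrightarrow> b \<in> B \<Longrightarrow> alpha J (a \<boxplus> b) = alpha J a \<boxplus> alpha J b"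
  "a \<in> B \<Longrightarrow> alpha J (cscale BH c a) = cscale BH c (alpha J a)"
  "a \<in> B \<Longrightarrow> alpha J (star BH a) = star BH (alpha J a)"
proof -
  note cov = BH.cov[symmetric]
  note cl = cstar_subalgebraD(3-6)[OF B_subalgebra]
  note c = B_carrier J_carrier BH.star_closed[OF J_carrier]
  show "alpha J (a \<boxtimes> b) = alpha J a \<boxtimes> alpha J b" if "a \<in> B" "b \<in> B"
  proof -
    have "alpha J a \<boxtimes> alpha J b =
        J \<boxtimes> a \<boxtimes> (BH.W \<boxtimes> J) \<boxtimes> b \<boxtimes> BH.W"
      using that c by (simp add: cov BH.m_assoc)
    then show ?thesis using that c cl by (simp add: cov BH.m_assoc BH.W_V)
  qed
  show "a \<in> B \<Longrightarrow> b \<in> B \<Longrightarrow> alpha J (a \<boxplus> b) = alpha J a \<boxplus> alpha J b"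
    using c cl by (simp add: cov BH.l_distr BH.r_distr)
  show "a \<in> B \<Longrightarrow> alpha J (cscale BH c a) = cscale BH c (alpha J a)"
    using c cl by (simp add: cov BH.cscale_mult_left BH.cscale_mult_right)
  show "a \<in> B \<Longrightarrow> alpha J (star BH a) = star BH (alpha J a)"
    using c cl by (simp add: cov BH.star_mult BH.m_assoc)
qed

lemma beta_alpha: "beta J (alpha J a) = a"
proof -
  have "beta J (alpha J a) = (adj J \<circ> J) \<circ> a \<circ> (adj J \<circ> J)" by (simp add: alpha_def beta_def o_assoc)
  then show ?thesis by (simp add: adj_J_J)
qed

lemma alpha_beta: "alpha J (beta J a) = alpha J id \<circ> a \<circ> alpha J id"
  by (simp add: alpha_def beta_def o_assoc)

lemma alQ_qB: assumes b: "b \<in> B" shows "alQ (qB b) = qB (alpha J b)"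
proof (rule coset_map_rcos[OF BI.ideal_axioms])
  show "I \<noteq> {}" using I_closed(8) by blast
  fix k assume k: "k \<in> I"
  have "alpha J (k \<boxplus> b) = alpha J k \<boxplus> alpha J b"
    using k b I_B by (intro alpha_hom) auto
  then show "\<exists>i\<in>I. alpha J (k \<oplus>\<^bsub>subalg B\<^esub> b) = i \<oplus>\<^bsub>subalg B\<^esub> alpha J b"
    using alpha_I[OF k] by auto
qed (use b alpha_B in auto)

lemma I_K: "I \<subseteq> K"
proof
  fix a assume a: "a \<in> I"
  then show "a \<in> K"
    unfolding ideal_gen_eq using ev_span_closure[OF I_B, of "[(0, a)]"] B_carrier[of a] I_B
    by (auto simp: BH.wmono_def)
qed

lemma inc_qB: assumes b: "b \<in> B" shows "inc (qB b) = qA b"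
proof -
  have eq: "qB b = I +>\<^bsub>subalg A\<^esub> b" by (simp add: a_r_coset_def')
  have "inc (I +>\<^bsub>subalg A\<^esub> b) = K +>\<^bsub>subalg A\<^esub> id b"
  proof (rule coset_map_rcos[OF AK.ideal_axioms])
    show "I \<noteq> {}" using I_closed(8) by blast
    fix k assume "k \<in> I"
    then show "\<exists>i\<in>K. id (k \<oplus>\<^bsub>subalg A\<^esub> b) = i \<oplus>\<^bsub>subalg A\<^esub> id b" using I_K by auto
  qed (use b B_A in auto)
  then show ?thesis unfolding eq by simp
qed

lemma Q_cases: assumes "X \<in> carrier Q" obtains b where "b \<in> B" "X = qB b"
  using BI.rcos_cases[OF assms] by auto

lemma P_cases: assumes "X \<in> carrier P" obtains x where "x \<in> A" "X = qA x"
  using AK.rcos_cases[OF assms] by auto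

lemma qB_hom:
  "a \<in> B \<Longrightarrow> b \<in> B \<Longrightarrow> qB a \<oplus>\<^bsub>Q\<^esub> qB b = qB (a \<boxplus> b)"
  "a \<in> B \<Longrightarrow> b \<in> B \<Longrightarrow> qB a \<otimes>\<^bsub>Q\<^esub> qB b = qB (a \<boxtimes> b)"
  "a \<in> B \<Longrightarrow> cscale Q c (qB a) = qB (cscale BH c a)"
  "a \<in> B \<Longrightarrow> star Q (qB a) = qB (star BH a)"
  "\<one>\<^bsub>Q\<^esub> = qB \<one>\<^bsub>BH\<^esub>" "a \<in> B \<Longrightarrow> qB a \<in> carrier Q"
  using BI.rcos_hom(1,2)[of a b] BI.rcos_hom(3)[of a c] BI.rcos_hom(4)[of a] BI.rcos_hom(5) BI.rcos_carrier[of a]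
  by simp_all

lemma qA_hom:
  "x \<in> A \<Longrightarrow> y \<in> A \<Longrightarrow> qA x \<oplus>\<^bsub>P\<^esub> qA y = qA (x \<boxplus> y)"
  "x \<in> A \<Longrightarrow> y \<in> A \<Longrightarrow> qA x \<otimes>\<^bsub>P\<^esub> qA y = qA (x \<boxtimes> y)"
  "x \<in> A \<Longrightarrow> cscale P c (qA x) = qA (cscale BH c x)"
  "x \<in> A \<Longrightarrow> star P (qA x) = qA (star BH x)"
  "\<one>\<^bsub>P\<^esub> = qA \<one>\<^bsub>BH\<^esub>" "x \<in> A \<Longrightarrow> qA x \<in> carrier P"
  using AK.rcos_hom(1,2)[of x y] AK.rcos_hom(3)[of x c] AK.rcos_hom(4)[of x] AK.rcos_hom(5) AK.rcos_carrier[of x]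
  by simp_all

lemma B_ring_closed:
  "a \<in> B \<Longrightarrow> b \<in> B \<Longrightarrow> a \<boxplus> b \<in> B" "a \<in> B \<Longrightarrow> b \<in> B \<Longrightarrow> a \<boxtimes> b \<in> B"
  "a \<in> B \<Longrightarrow> cscale BH c a \<in> B" "a \<in> B \<Longrightarrow> star BH a \<in> B"
  "\<one>\<^bsub>BH\<^esub> \<in> B" "a \<in> B \<Longrightarrow> b \<in> B \<Longrightarrow> a \<boxminus> b \<in> B"
proof -
  show "\<one>\<^bsub>BH\<^esub> \<in> B" using id_B by (simp only: bounded_operators_simps(3))
qed (rule cstar_subalgebraD(3-6)[OF B_subalgebra] BH.subalgebra_diff[OF B_subalgebra]; assumption)+

lemma A_ring_closed:
  "x \<in> A \<Longrightarrow> y \<in> A \<Longrightarrow> x \<boxplus> y \<in> A" "x \<in> A \<Longrightarrow> y \<in> A \<Longrightarrow> x \<boxtimes> y \<in> A"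
  "x \<in> A \<Longrightarrow> cscale BH c x \<in> A" "x \<in> A \<Longrightarrow> star BH x \<in> A"
  by (rule cstar_subalgebraD(3-6)[OF A_subalgebra]; assumption)+

lemma qB_zero: "b \<in> B \<Longrightarrow> qB b = \<zero>\<^bsub>Q\<^esub> \<longleftrightarrow> b \<in> I"
  using BI.rcos_zero_iff[of b] BI.rcos_hom(6) by simp

lemma alQ_star_hom: "star_hom Q Q alQ"
  by (rule star_homI) (auto elim!: Q_cases simp: qB_hom alQ_qB alpha_hom B_ring_closed alpha_B)

text \<open>The map \<open>beta\<close> is a left inverse of \<open>alpha\<close> and preserves
  \<open>I\<close>, so membership of a difference in \<open>I\<close> can be pulled back along
  \<open>alpha\<close>.\<close>

lemma alQ_inj: "inj_on alQ (carrier Q)"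
proof (rule inj_onI)
  fix X Y assume X: "X \<in> carrier Q" and Y: "Y \<in> carrier Q" and eq: "alQ X = alQ Y"
  obtain a where a: "a \<in> B" "X = qB a" using X by (rule Q_cases)
  obtain b where b: "b \<in> B" "Y = qB b" using Y by (rule Q_cases)
  have d: "a \<boxminus> b \<in> B" by (rule B_ring_closed(6)[OF a(1) b(1)])
  have sm: "x \<ominus>\<^bsub>subalg B\<^esub> y = x \<boxminus> y" if "x \<in> B" "y \<in> B" for x y
    by (rule BH.subalgebra_a_minus[OF B_subalgebra B_ring_closed(5) that])
  have "qB (alpha J a) = qB (alpha J b)" using eq a b by (simp add: alQ_qB)
  then have "alpha J a \<boxminus> alpha J b \<in> I"
    using BI.rcos_eq_iff[of "alpha J a" "alpha J b"] alpha_B a b sm by simp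
  moreover have "alpha J a \<boxminus> alpha J b = alpha J (a \<boxminus> b)"
    using a b B_carrier alpha_B B_ring_closed by (simp add: a_minus_def BH.minus_eq_cscale alpha_hom)
  ultimately have "alpha J (a \<boxminus> b) \<in> I" by simp
  then have "beta J (alpha J (a \<boxminus> b)) \<in> I" by (rule beta_I)
  then have "a \<boxminus> b \<in> I" by (simp only: beta_alpha)
  then show "X = Y" using BI.rcos_eq_iff[of a b] a b sm by simp
qed

abbreviation eQ where "eQ \<equiv> qB (alpha J id)"

text \<open>Compression by the projection \<open>eQ\<close> is induced by \<open>alpha\<close> after
  \<open>beta\<close>, so its values lie in the range; and it fixes the range because
  \<open>beta\<close> undoes \<open>alpha\<close>. As a fixed-point condition the range is easily
  seen to be closed.\<close>

lemma alQ_range: "alQ ` carrier Q = {X \<in> carrier Q. eQ \<otimes>\<^bsub>Q\<^esub> X \<otimes>\<^bsub>Q\<^esub> eQ = X}"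
proof -
  have e: "alpha J id \<in> B" by (rule alpha_B[OF id_B])
  have corner: "eQ \<otimes>\<^bsub>Q\<^esub> qB b \<otimes>\<^bsub>Q\<^esub> eQ = alQ (qB (beta J b))" if b: "b \<in> B" for b
  proof -
    have "alpha J (beta J b) = alpha J id \<boxtimes> b \<boxtimes> alpha J id"
      by (simp add: alpha_beta bounded_operators_simps(2))
    then show ?thesis using b e by (simp add: qB_hom alQ_qB beta_B B_ring_closed)
  qed
  show ?thesis
  proof (intro equalityI subsetI)
    fix Z assume "Z \<in> alQ ` carrier Q"
    then obtain X where X: "X \<in> carrier Q" "Z = alQ X" by blast
    obtain b where b: "b \<in> B" "X = qB b" using X(1) by (rule Q_cases)
    have "alQ X \<in> carrier Q" using b by (simp add: alQ_qB qB_hom alpha_B)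
    moreover have "eQ \<otimes>\<^bsub>Q\<^esub> alQ X \<otimes>\<^bsub>Q\<^esub> eQ = alQ X"
      using corner[OF alpha_B[OF b(1)]] b by (simp add: alQ_qB beta_alpha)
    ultimately show "Z \<in> {X \<in> carrier Q. eQ \<otimes>\<^bsub>Q\<^esub> X \<otimes>\<^bsub>Q\<^esub> eQ = X}" using X(2) by simp
  next
    fix X assume "X \<in> {X \<in> carrier Q. eQ \<otimes>\<^bsub>Q\<^esub> X \<otimes>\<^bsub>Q\<^esub> eQ = X}"
    then have X: "X \<in> carrier Q" "eQ \<otimes>\<^bsub>Q\<^esub> X \<otimes>\<^bsub>Q\<^esub> eQ = X" by simp_all
    obtain b where b: "b \<in> B" "X = qB b" using X(1) by (rule Q_cases)
    have "X = alQ (qB (beta J b))" using corner[OF b(1)] X(2) unfolding b(2) by simp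
    then show "X \<in> alQ ` carrier Q" using qB_hom(6)[OF beta_B[OF b(1)]] by blast
  qed
qed

text \<open>The range of \<open>[\<alpha>]\<close> is the corner of the projection \<open>e = [\<alpha>](1)\<close>. If \<open>0 \<le> b \<le> s\<close> with \<open>s\<close> in the corner, then
  \<open>(1 - e) b (1 - e) = 0\<close>; this is derived for operators representing the cosets, where sums of squares are
  positive.\<close>

lemma alQ_hereditary: "hereditary_subalgebra Q (alQ ` carrier Q)"
proof -
  interpret Q: unital_cstar_algebra Q by (rule BI.quotient_cstar)
  have e: "alpha J id \<in> B" by (rule alpha_B[OF id_B])
  have eQ: "eQ \<in> carrier Q" "star Q eQ = eQ"
  proof -
    show "eQ \<in> carrier Q" by (rule qB_hom(6)[OF e])
    have "star BH (alpha J id) = alpha J id"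
      using alpha_hom(4)[OF id_B] BH.star_one by (simp add: bounded_operators_simps(3)[symmetric])
    then show "star Q eQ = eQ" using qB_hom(4)[OF e] by simp
  qed
  note aD = star_homD[OF alQ_star_hom]
  have sub: "cstar_subalgebra Q (alQ ` carrier Q)"
  proof (rule cstar_subalgebraI)
    show "alQ ` carrier Q \<subseteq> carrier Q" using aD(1) by blast
    show "\<zero>\<^bsub>Q\<^esub> \<in> alQ ` carrier Q" using star_hom_zero[OF Q.unital_cstar_algebra_axioms Q.unital_cstar_algebra_axioms alQ_star_hom] by force
    show "norm_closed Q (alQ ` carrier Q)"
    proof (rule Q.norm_closedI)
      fix X x assume X: "Q.nlim X x" "\<And>n. X n \<in> alQ ` carrier Q"
      \<comment> \<open>Compression by \<open>eQ\<close> is continuous and fixes every term, hence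
        also the limit.\<close>
      have "Q.nlim (\<lambda>n. eQ \<otimes>\<^bsub>Q\<^esub> X n \<otimes>\<^bsub>Q\<^esub> eQ) (eQ \<otimes>\<^bsub>Q\<^esub> x \<otimes>\<^bsub>Q\<^esub> eQ)"
        by (intro Q.nlim_mult Q.nlim_const X eQ)
      then have "Q.nlim X (eQ \<otimes>\<^bsub>Q\<^esub> x \<otimes>\<^bsub>Q\<^esub> eQ)" using X(2) by (simp add: alQ_range)
      then have "x = eQ \<otimes>\<^bsub>Q\<^esub> x \<otimes>\<^bsub>Q\<^esub> eQ" by (rule Q.nlim_unique[OF X(1)])
      then show "x \<in> alQ ` carrier Q" using Q.nlimD(2)[OF X(1)] unfolding alQ_range by simp
    qed (use aD(1) in blast)
    fix x assume "x \<in> alQ ` carrier Q"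
    then obtain x' where x': "x' \<in> carrier Q" "x = alQ x'" by blast
    show "cscale Q c x \<in> alQ ` carrier Q" for c
      unfolding x'(2) by (rule image_eqI, rule aD(4)[OF x'(1), symmetric], rule Q.cscale_closed[OF x'(1)])
    show "star Q x \<in> alQ ` carrier Q"
      unfolding x'(2) by (rule image_eqI, rule aD(5)[OF x'(1), symmetric], rule Q.star_closed[OF x'(1)])
    fix y assume "y \<in> alQ ` carrier Q"
    then obtain y' where y': "y' \<in> carrier Q" "y = alQ y'" by blast
    show "x \<oplus>\<^bsub>Q\<^esub> y \<in> alQ ` carrier Q"
      unfolding x'(2) y'(2) by (rule image_eqI, rule aD(2)[OF x'(1) y'(1), symmetric], rule Q.a_closed[OF x'(1) y'(1)])
    show "x \<otimes>\<^bsub>Q\<^esub> y \<in> alQ ` carrier Q"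
      unfolding x'(2) y'(2) by (rule image_eqI, rule aD(3)[OF x'(1) y'(1), symmetric], rule Q.m_closed[OF x'(1) y'(1)])
  qed
  have "b \<in> alQ ` carrier Q" if s: "s \<in> alQ ` carrier Q" and b: "b \<in> carrier Q"
    and pb: "positive_in Q b" and ps: "positive_in Q (s \<ominus>\<^bsub>Q\<^esub> b)" for s b
  proof -
    have sc: "s \<in> carrier Q" "eQ \<otimes>\<^bsub>Q\<^esub> s \<otimes>\<^bsub>Q\<^esub> eQ = s" using s by (simp_all add: alQ_range)
    obtain y where y: "y \<in> carrier Q" "b = star Q y \<otimes>\<^bsub>Q\<^esub> y" using pb by (auto simp: positive_in_def)
    obtain w where w: "w \<in> carrier Q" "s \<ominus>\<^bsub>Q\<^esub> b = star Q w \<otimes>\<^bsub>Q\<^esub> w" using ps by (auto simp: positive_in_def)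
    let ?f = "\<one>\<^bsub>BH\<^esub> \<boxminus> alpha J id"
    have f: "?f \<in> B" by (rule B_ring_closed(6)[OF B_ring_closed(5) e])
    obtain v where v: "v \<in> B" "y = qB v" using y(1) by (rule Q_cases)
    obtain u where u: "u \<in> B" "w = qB u" using w(1) by (rule Q_cases)
    let ?v = "v \<boxtimes> ?f" and ?u = "u \<boxtimes> ?f"
    let ?k = "star BH ?v \<boxtimes> ?v \<boxplus> star BH ?u \<boxtimes> ?u"
    have vB: "?v \<in> B" and uB: "?u \<in> B" by (rule B_ring_closed(2)[OF v(1) f], rule B_ring_closed(2)[OF u(1) f])
    have kB: "?k \<in> B" by (intro B_ring_closed(1,2,4) vB uB)
    define F where "F = qB ?f"
    have sm: "qB ?f = \<one>\<^bsub>Q\<^esub> \<ominus>\<^bsub>Q\<^esub> eQ"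
      using BI.rcos_minus[of "\<one>\<^bsub>BH\<^esub>" "alpha J id"] B_ring_closed(5) e
        BH.subalgebra_a_minus[OF B_subalgebra B_ring_closed(5) B_ring_closed(5) e] by (simp add: qB_hom)
    have F: "F \<in> carrier Q" "star Q F = F" "F = \<one>\<^bsub>Q\<^esub> \<ominus>\<^bsub>Q\<^esub> eQ"
      using sm eQ by (simp_all add: F_def Q.star_diff)
    have ee: "eQ \<otimes>\<^bsub>Q\<^esub> eQ = eQ"
    proof -
      have "alpha J id \<boxtimes> alpha J id = alpha J id"
        using alpha_hom(1)[OF id_B id_B] by (simp add: bounded_operators_simps(2))
      then show ?thesis using qB_hom(2)[OF e e] by simp
    qed
    have eF: "eQ \<otimes>\<^bsub>Q\<^esub> F = \<zero>\<^bsub>Q\<^esub>"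
      unfolding F(3) using eQ(1) ee by (simp add: Q.r_diff_distr)
    have "F \<otimes>\<^bsub>Q\<^esub> s \<otimes>\<^bsub>Q\<^esub> F = F \<otimes>\<^bsub>Q\<^esub> (eQ \<otimes>\<^bsub>Q\<^esub> s) \<otimes>\<^bsub>Q\<^esub> (eQ \<otimes>\<^bsub>Q\<^esub> F)"
      using sc eQ(1) F(1) by (metis Q.m_assoc Q.m_closed)
    then have FsF: "F \<otimes>\<^bsub>Q\<^esub> s \<otimes>\<^bsub>Q\<^esub> F = \<zero>\<^bsub>Q\<^esub>" unfolding eF using sc eQ F by simp
    \<comment> \<open>The sum of the compressions of \<open>b\<close> and \<open>s - b\<close> by
      \<open>1 - e\<close> is that of \<open>s\<close>, which vanishes; so \<open>?k\<close> lies in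
      \<open>I\<close>.\<close>
    have "qB ?k = star Q (y \<otimes>\<^bsub>Q\<^esub> F) \<otimes>\<^bsub>Q\<^esub> (y \<otimes>\<^bsub>Q\<^esub> F) \<oplus>\<^bsub>Q\<^esub> star Q (w \<otimes>\<^bsub>Q\<^esub> F) \<otimes>\<^bsub>Q\<^esub> (w \<otimes>\<^bsub>Q\<^esub> F)"
      unfolding F_def v(2) u(2) using v(1) u(1) f by (simp add: qB_hom B_ring_closed)
    also have "\<dots> = F \<otimes>\<^bsub>Q\<^esub> (star Q y \<otimes>\<^bsub>Q\<^esub> y \<oplus>\<^bsub>Q\<^esub> star Q w \<otimes>\<^bsub>Q\<^esub> w) \<otimes>\<^bsub>Q\<^esub> F"
      using y(1) w(1) F(1,2) by (simp add: Q.star_mult Q.m_assoc Q.l_distr Q.r_distr)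
    also have "star Q y \<otimes>\<^bsub>Q\<^esub> y \<oplus>\<^bsub>Q\<^esub> star Q w \<otimes>\<^bsub>Q\<^esub> w = s"
      unfolding y(2)[symmetric] w(2)[symmetric] using b sc(1) by (rule Q.add_diff_cancel)
    also note FsF
    finally have kI: "?k \<in> I" by (rule iffD1[OF qB_zero[OF kB]])
    have "?v \<in> I"
    proof (rule BI.closed_ideal_dominated[OF I_ideal])
      show "?v \<in> carrier (subalg B)" using vB by simp
      show "?k \<in> I" by (fact kI)
      show "star (subalg B) ?k = ?k"
        using B_carrier[OF vB] B_carrier[OF uB] by (simp add: BH.star_add BH.star_mult)
      fix d assume d: "d \<in> carrier (subalg B)" "star (subalg B) d = d"
      then have dB: "d \<in> carrier BH" "star BH d = d" using B_carrier by auto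
      have subB: "mult (subalg B) = mult BH" "cnorm (subalg B) = cnorm BH"
        by simp_all
      have c: "?v \<boxtimes> d \<in> carrier BH" "?u \<boxtimes> d \<in> carrier BH"
        by (rule BH.m_closed[OF B_carrier[OF vB] dB(1)], rule BH.m_closed[OF B_carrier[OF uB] dB(1)])
      have "(cnorm BH (?v \<boxtimes> d))\<^sup>2 \<le> cnorm BH
        (star BH (?v \<boxtimes> d) \<boxtimes> (?v \<boxtimes> d) \<boxplus>
         star BH (?u \<boxtimes> d) \<boxtimes> (?u \<boxtimes> d))"
        using onorm_square_le_sum[OF c] by (simp add: bounded_operators_simps(2,5,7,8) comp_def)
      also have "star BH (?v \<boxtimes> d) \<boxtimes> (?v \<boxtimes> d) \<boxplus>
         star BH (?u \<boxtimes> d) \<boxtimes> (?u \<boxtimes> d) =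
         d \<boxtimes> ?k \<boxtimes> d"
      proof -
        have gen: "star BH (x \<boxtimes> d) \<boxtimes> (x \<boxtimes> d) \<boxplus>
         star BH (z \<boxtimes> d) \<boxtimes> (z \<boxtimes> d) =
         d \<boxtimes> (star BH x \<boxtimes> x \<boxplus> star BH z \<boxtimes> z) \<boxtimes> d"
          if "x \<in> carrier BH" "z \<in> carrier BH" for x z
          using that dB by (simp add: BH.star_mult BH.m_assoc BH.l_distr BH.r_distr)
        show ?thesis by (rule gen[OF B_carrier[OF vB] B_carrier[OF uB]])
      qed
      finally show "(cnorm (subalg B) (?v \<otimes>\<^bsub>subalg B\<^esub> d))\<^sup>2 \<le> cnorm (subalg B) (d \<otimes>\<^bsub>subalg B\<^esub> ?k \<otimes>\<^bsub>subalg B\<^esub> d)"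
        unfolding subB .
    qed
    then have "qB ?v = \<zero>\<^bsub>Q\<^esub>" by (rule iffD2[OF qB_zero[OF vB]])
    \<comment> \<open>Now \<open>y (1 - e)\<close> vanishes for the root \<open>y\<close> of
      \<open>b\<close>, so \<open>b\<close> is fixed under compression by \<open>e\<close> on both
      sides.\<close>
    then have "y \<otimes>\<^bsub>Q\<^esub> F = \<zero>\<^bsub>Q\<^esub>" unfolding F_def v(2) using v(1) f by (simp add: qB_hom)
    then have "y \<ominus>\<^bsub>Q\<^esub> y \<otimes>\<^bsub>Q\<^esub> eQ = \<zero>\<^bsub>Q\<^esub>" unfolding F(3) using y(1) eQ(1) by (simp add: Q.r_diff_distr)
    then have ye: "y \<otimes>\<^bsub>Q\<^esub> eQ = y" using Q.diff_eq_zero[of y "y \<otimes>\<^bsub>Q\<^esub> eQ"] y(1) eQ(1) by simp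
    then have "eQ \<otimes>\<^bsub>Q\<^esub> star Q y = star Q y" using Q.star_mult[OF y(1) eQ(1)] eQ(2) by simp
    then have "eQ \<otimes>\<^bsub>Q\<^esub> b \<otimes>\<^bsub>Q\<^esub> eQ = b"
      unfolding y(2) using ye y(1) eQ(1) by (metis Q.m_assoc Q.m_closed Q.star_closed)
    then show ?thesis using b by (simp add: alQ_range)
  qed
  then show ?thesis using sub unfolding hereditary_subalgebra_def by blast
qed

section \<open>The quotient of the generated algebra as a crossed product\<close>

lemma inc_unital_star_hom: "unital_star_hom Q P inc"
  unfolding unital_star_hom_def
proof (intro conjI star_homI)
  show "inc \<one>\<^bsub>Q\<^esub> = \<one>\<^bsub>P\<^esub>" using B_ring_closed(5) by (simp only: qB_hom(5) qA_hom(5) inc_qB)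
qed (use B_A in \<open>auto elim!: Q_cases simp: qB_hom inc_qB B_ring_closed qA_hom subset_iff\<close>)

lemma inc_covariant: "covariant_pair Q alQ P inc (qA J)"
  unfolding covariant_pair_def isometry_in_def
proof (intro conjI ballI AK.quotient_cstar inc_unital_star_hom)
  show "qA J \<in> carrier P" by (rule qA_hom(6)[OF J_A])
  show "star P (qA J) \<otimes>\<^bsub>P\<^esub> qA J = \<one>\<^bsub>P\<^esub>"
    using J_A BH.W_V by (simp add: qA_hom A_ring_closed)
  fix X assume "X \<in> carrier Q"
  then obtain b where b: "b \<in> B" "X = qB b" by (rule Q_cases)
  have "b \<in> A" using b B_A by blast
  then show "qA J \<otimes>\<^bsub>P\<^esub> inc X \<otimes>\<^bsub>P\<^esub> star P (qA J) = inc (alQ X)"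
    unfolding b(2) using b(1) J_A BH.cov[OF b(1)] by (simp add: inc_qB alQ_qB alpha_B qA_hom A_ring_closed)
qed

lemma inc_inj: "inj_on inc (carrier Q)"
proof (rule inj_onI)
  fix X Y assume X: "X \<in> carrier Q" and Y: "Y \<in> carrier Q" and eq: "inc X = inc Y"
  obtain a where a: "a \<in> B" "X = qB a" using X by (rule Q_cases)
  obtain b where b: "b \<in> B" "Y = qB b" using Y by (rule Q_cases)
  have AB: "a \<in> A" "b \<in> A" using a b B_A by auto
  have "qA a = qA b" using eq a b by (simp add: inc_qB)
  then have "a \<boxminus> b \<in> K"
    using AK.rcos_eq_iff[of a b] AB BH.subalgebra_a_minus[OF A_subalgebra one_A AB] by simp
  then have "a \<boxminus> b \<in> I" using B_Int_K B_ring_closed(6)[OF a(1) b(1)] by blast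
  then show "X = Y"
    using BI.rcos_eq_iff[of a b] a b BH.subalgebra_a_minus[OF B_subalgebra B_ring_closed(5) a(1) b(1)] by simp
qed

text \<open>The elements of \<open>A\<close> whose cosets lie in the generated subalgebra of the
  quotient form a closed subalgebra, because the quotient map is contractive; it contains
  \<open>B\<close> and \<open>J\<close>, hence all of \<open>A\<close>.\<close>

lemma P_generated: "cstar_generated P (inc ` carrier Q \<union> {qA J}) = carrier P"
proof
  interpret P: unital_cstar_algebra P by (rule AK.quotient_cstar)
  let ?X = "inc ` carrier Q \<union> {qA J}"
  have X: "?X \<subseteq> carrier P"
    using star_homD(1)[of Q P inc] inc_unital_star_hom qA_hom(6)[OF J_A] by (auto simp: unital_star_hom_def)
  show "cstar_generated P ?X \<subseteq> carrier P"
    by (rule cstar_generated_least[OF P.cstar_subalgebra_carrier X])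
  let ?G = "cstar_generated P ?X"
  note G = cstar_subalgebraD[OF P.cstar_subalgebra_generated[OF X]]
  have XG: "?X \<subseteq> ?G" by (rule cstar_generated_superset)
  let ?S = "{x \<in> A. qA x \<in> ?G}"
  have "cstar_subalgebra BH ?S"
  proof (rule cstar_subalgebraI)
    show "?S \<subseteq> carrier BH" using A_carrier by blast
    show "\<zero>\<^bsub>BH\<^esub> \<in> ?S"
      using cstar_subalgebraD(2)[OF A_subalgebra] G(2) AK.rcos_hom(6) by simp
    show "norm_closed BH ?S"
    proof (rule BH.norm_closedI)
      fix Y y assume Y: "BH.nlim Y y" "\<And>n. Y n \<in> ?S"
      have YA: "Y n \<in> A" for n using Y(2) by blast
      have yA: "y \<in> A" by (rule BH.norm_closedD[OF cstar_subalgebraD(7)[OF A_subalgebra] Y(1) YA])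
      have "P.nlim (\<lambda>n. qA (Y n)) (qA y)"
      proof (rule P.nlimI_bound[OF _ _ _ BH.nlimD(3)[OF Y(1)]])
        fix n
        have dA: "Y n \<boxminus> y \<in> A" by (rule BH.subalgebra_diff[OF A_subalgebra YA yA])
        have "qA (Y n) \<ominus>\<^bsub>P\<^esub> qA y = qA (Y n \<boxminus> y)"
          using AK.rcos_minus[of "Y n" y] YA yA BH.subalgebra_a_minus[OF A_subalgebra one_A YA yA] by simp
        then show "cnorm P (qA (Y n) \<ominus>\<^bsub>P\<^esub> qA y) \<le> cnorm BH (Y n \<boxminus> y)"
          using AK.qnorm_le_cnorm[of "Y n \<boxminus> y"] dA by (simp add: AK.qnorm_def)
      qed (simp_all add: qA_hom(6) YA yA)
      then have "qA y \<in> ?G" by (rule P.norm_closedD[OF G(7)]) (use Y(2) in blast)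
      then show "y \<in> ?S" using yA by blast
    qed (use A_carrier in blast)
  qed (use G A_ring_closed in \<open>auto simp: qA_hom(1-4)[symmetric]\<close>)
  moreover have "B \<union> {J} \<subseteq> ?S"
  proof -
    have "b \<in> ?S" if b: "b \<in> B" for b
    proof -
      have "qA b \<in> inc ` carrier Q" using inc_qB[OF b] qB_hom(6)[OF b] by force
      then show ?thesis using XG B_A b by blast
    qed
    moreover have "J \<in> ?S" using XG J_A by blast
    ultimately show ?thesis by blast
  qed
  ultimately have "A \<subseteq> ?S" unfolding alg_gen_def[of B J] by (rule cstar_generated_least)
  then show "carrier P \<subseteq> ?G" by (auto elim!: P_cases)
qed

text \<open>Composed with the quotient map of \<open>B\<close>, the given pair becomes a covariant
  pair for \<open>B\<close> that vanishes on \<open>I\<close>; its extension to \<open>A\<close>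
  vanishes on \<open>K\<close> and therefore descends to cosets.\<close>

lemma P_universal:
  assumes cp: "covariant_pair Q alQ D \<pi> T"
  shows "\<exists>\<Phi>. unital_star_hom P D \<Phi> \<and> (\<forall>X\<in>carrier Q. \<Phi> (inc X) = \<pi> X) \<and> \<Phi> (qA J) = T"
proof -
  have D: "unital_cstar_algebra D" and pi: "unital_star_hom Q D \<pi>" and T: "isometry_in D T"
    and cov: "\<And>X. X \<in> carrier Q \<Longrightarrow> T \<otimes>\<^bsub>D\<^esub> \<pi> X \<otimes>\<^bsub>D\<^esub> star D T = \<pi> (alQ X)"
    using cp by (auto simp: covariant_pair_def)
  let ?\<rho> = "\<lambda>b. \<pi> (qB b)"
  interpret D: unital_cstar_algebra D by (rule D)
  interpret R: gauge_rep J B I U D ?\<rho> T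
  proof (intro gauge_rep.intro gauge_setting_axioms cov_rep.intro isometry_setting_axioms D
      cov_rep_axioms.intro gauge_rep_axioms.intro T)
    show "unital_star_hom (subalg B) D ?\<rho>" by (rule unital_star_hom_comp[OF BI.rcos_unital_star_hom pi])
    show "T \<otimes>\<^bsub>D\<^esub> ?\<rho> b \<otimes>\<^bsub>D\<^esub> star D T = ?\<rho> (alpha J b)" if "b \<in> B" for b
      using cov[OF qB_hom(6)[OF that]] by (simp add: alQ_qB[OF that])
    show "?\<rho> a = \<zero>\<^bsub>D\<^esub>" if "a \<in> I" for a
    proof -
      have "qB a = \<zero>\<^bsub>Q\<^esub>" using qB_zero that I_B by blast
      then show ?thesis using star_hom_zero[OF BI.quotient_cstar D] pi by (simp add: unital_star_hom_def)
    qed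
  qed
  obtain \<phi> where \<phi>: "star_hom (subalg A) D \<phi>" "\<And>b. b \<in> B \<Longrightarrow> \<phi> b = ?\<rho> b" "\<phi> J = T" "\<And>k. k \<in> K \<Longrightarrow> \<phi> k = \<zero>\<^bsub>D\<^esub>"
    using R.extension_exists by blast
  obtain \<Phi> where \<Phi>: "star_hom P D \<Phi>" "\<And>x. x \<in> A \<Longrightarrow> \<Phi> (qA x) = \<phi> x"
    using AK.star_hom_factor[OF D \<phi>(1,4)] by auto
  have "\<Phi> \<one>\<^bsub>P\<^esub> = \<one>\<^bsub>D\<^esub>"
    using \<Phi>(2)[OF one_A] \<phi>(2)[OF B_ring_closed(5)] pi by (simp add: qA_hom(5) qB_hom(5) unital_star_hom_def)
  moreover have "\<Phi> (inc X) = \<pi> X" if X: "X \<in> carrier Q" for X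
  proof -
    obtain b where b: "b \<in> B" "X = qB b" using X by (rule Q_cases)
    then show ?thesis using inc_qB[OF b(1)] \<Phi>(2)[OF subsetD[OF B_A b(1)]] \<phi>(2)[OF b(1)] by simp
  qed
  ultimately show ?thesis using \<Phi> \<phi>(3) J_A by (auto simp: unital_star_hom_def)
qed

lemma P_crossed_product: "crossed_product TYPE('d) Q alQ P inc (qA J)"
  unfolding crossed_product_def
  using BI.quotient_cstar alQ_star_hom alQ_inj alQ_hereditary inc_covariant inc_inj P_generated P_universal
  by blast

text \<open>To map \<open>C\<close> into the quotient, its universality is tested at the type of
  sets of operators, where the cosets live; the map back comes from universality of the quotient,
  which holds at every type. Both composites fix the generators.\<close>

lemma crossed_product_unique:
  assumes cp: "crossed_product TYPE(('h \<Rightarrow> 'h) set) Q alQ C \<iota> L"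
  shows "cstar_isomorphic C P"
proof -
  have cov: "covariant_pair Q alQ C \<iota> L" and gen: "cstar_generated C (\<iota> ` carrier Q \<union> {L}) = carrier C"
    and univ: "\<And>(D :: ('h \<Rightarrow> 'h) set cstar) \<pi> T. covariant_pair Q alQ D \<pi> T \<Longrightarrow>
      \<exists>\<Phi>. unital_star_hom C D \<Phi> \<and> (\<forall>b\<in>carrier Q. \<Phi> (\<iota> b) = \<pi> b) \<and> \<Phi> L = T"
    using cp by (auto simp: crossed_product_def)
  have C: "unital_cstar_algebra C" and iota: "unital_star_hom Q C \<iota>" and L: "L \<in> carrier C"
    using cov by (auto simp: covariant_pair_def isometry_in_def)
  obtain \<Phi> where \<Phi>: "unital_star_hom C P \<Phi>" "\<And>X. X \<in> carrier Q \<Longrightarrow> \<Phi> (\<iota> X) = inc X" "\<Phi> L = qA J"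
    using univ[OF inc_covariant] by blast
  obtain \<Psi> where \<Psi>: "unital_star_hom P C \<Psi>" "\<And>X. X \<in> carrier Q \<Longrightarrow> \<Psi> (inc X) = \<iota> X" "\<Psi> (qA J) = L"
    using P_universal[OF cov] by blast
  have idC: "unital_star_hom C C (\<lambda>x. x)" and idP: "unital_star_hom P P (\<lambda>x. x)"
    by (auto simp: unital_star_hom_def star_hom_def)
  have XC: "\<iota> ` carrier Q \<union> {L} \<subseteq> carrier C"
    using iota L star_homD(1)[of Q C \<iota>] by (auto simp: unital_star_hom_def)
  have XP: "inc ` carrier Q \<union> {qA J} \<subseteq> carrier P"
    using inc_unital_star_hom qA_hom(6)[OF J_A] star_homD(1)[of Q P inc] by (auto simp: unital_star_hom_def)
  have PC: "\<Psi> (\<Phi> x) = x" if "x \<in> carrier C" for x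
    by (rule unital_star_hom_eq_on_generated[OF C C unital_star_hom_comp[OF \<Phi>(1) \<Psi>(1)] idC XC _ gen that])
      (auto simp: \<Phi> \<Psi>)
  have CP: "\<Phi> (\<Psi> x) = x" if "x \<in> carrier P" for x
    by (rule unital_star_hom_eq_on_generated[OF AK.quotient_cstar AK.quotient_cstar
          unital_star_hom_comp[OF \<Psi>(1) \<Phi>(1)] idP XP _ P_generated that])
      (auto simp: \<Phi> \<Psi>)
  have sh: "star_hom C P \<Phi>" "star_hom P C \<Psi>" using \<Phi>(1) \<Psi>(1) by (simp_all add: unital_star_hom_def)
  have "bij_betw \<Phi> (carrier C) (carrier P)"
    by (rule bij_betw_byWitness[where f'=\<Psi>]) (use PC CP star_homD(1)[OF sh(1)] star_homD(1)[OF sh(2)] in auto)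
  then show ?thesis using sh(1) by (auto simp: cstar_isomorphic_def)
qed

end

theorem proposition3p3:
  fixes J :: "'h::complex_hilbert_space \<Rightarrow> 'h"
    and B I :: "('h \<Rightarrow> 'h) set"
    and U :: "real \<Rightarrow> 'h \<Rightarrow> 'h"
  assumes "isometry_in bounded_operators J"
    and "cstar_subalgebra bounded_operators B" and "id \<in> B"
    and "\<forall>a\<in>B. alpha J a \<in> B" and "\<forall>a\<in>B. beta J a \<in> B"
    and "\<forall>\<theta>. U (\<theta> + 1) = U \<theta>"
    and "\<forall>\<theta>. unitary_in bounded_operators (U \<theta>)"
    and "\<forall>\<theta>. \<forall>a\<in>B. U \<theta> \<circ> a = a \<circ> U \<theta>"
    and "\<forall>\<theta>. U \<theta> \<circ> J =
           cscale bounded_operators (exp (2 * complex_of_real pi * \<i> * complex_of_real \<theta>)) (J \<circ> U \<theta>)"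
    and "closed_ideal (subalg B) I"
    and "alpha J ` I \<subseteq> I" and "beta J ` I \<subseteq> I"
  shows "closed_ideal (subalg (alg_gen B J)) (ideal_gen I J) \<and>
    crossed_product TYPE('d)
      (cstar_quotient (subalg B) I) (coset_map (subalg B) I (alpha J))
      (cstar_quotient (subalg (alg_gen B J)) (ideal_gen I J))
      (coset_map (subalg (alg_gen B J)) (ideal_gen I J) id)
      (ideal_gen I J +>\<^bsub>subalg (alg_gen B J)\<^esub> J) \<and>
    (\<forall>(C :: 'c cstar) \<iota> L.
      crossed_product TYPE(('h \<Rightarrow> 'h) set)
        (cstar_quotient (subalg B) I) (coset_map (subalg B) I (alpha J)) C \<iota> L \<longrightarrow>
      cstar_isomorphic C (cstar_quotient (subalg (alg_gen B J)) (ideal_gen I J)))"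
proof -
  interpret gauge_setting J B I U
  proof
    fix \<theta>
    have "exp (2 * complex_of_real pi * \<i> * complex_of_real \<theta>) = cis (2 * pi * \<theta>)"
      by (simp add: cis_conv_exp mult_ac)
    then show "U \<theta> \<circ> J = cscale bounded_operators (cis (2 * pi * \<theta>)) (J \<circ> U \<theta>)"
      using assms(9) by metis
  qed (use assms in blast)+
  show ?thesis
    using K_closed_ideal P_crossed_product crossed_product_unique by blast
qed

end
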